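(* Let $k$ be a field, $n$ a positive integer, $q\in k^\times$ arbitrary, and $A=\mathcal{O}_q(M_n(k))$. The antistandard products $[T\mid T']$, as $(T,T')$ runs over all antistandard bitableaux, form a $k$-basis for $A$.
   Context: $A=\mathcal{O}_q(M_n(k))$ is the $k$-algebra with generators $X_{ij}$ ($1\le i,j\le n$) and relations $X_{ij}X_{lj}=qX_{lj}X_{ij}$ for $i<l$; $X_{ij}X_{im}=qX_{im}X_{ij}$ for $j<m$; $X_{ij}X_{lm}=X_{lm}X_{ij}$ for $i<l$, $j>m$; $X_{ij}X_{lm}-X_{lm}X_{ij}=(q-q^{-1})X_{im}X_{lj}$ for $i<l$, $j<m$. For subsets $I=\{i_1<\cdots<i_s\}$, $J=\{j_1<\cdots<j_s\}$ of $\{1,\dots,n\}$ of the same cardinality, the quantum minor is $[I\mid J]=\sum_{\sigma\in S_s}(-q)^{\ell(\sigma)}X_{i_1j_{\sigma(1)}}\cdots X_{i_sj_{\sigma(s)}}$. A tableau is a Young diagram (left-justified rows of weakly decreasing lengths, possibly empty) with an entry in each box; here entries are in $\{1,\dots,n\}$. A tableau is decreasing if all its rows are strictly decreasing (left to right) and all its columns are nonincreasing (top to bottom). A bitableau is a pair $(T,T')$ of tableaux of the same shape; it is antistandard if $T$ and $T'$ are both decreasing. If the $j$-th rows of $T$ and $T'$ have entry sets $I_j$ and $J_j$ ($j=1,\dots,l$), then $[T\mid T']=[I_1\mid J_1][I_2\mid J_2]\cdots[I_l\mid J_l]$ (equal to $1$ for the empty bitableau); it is called an antistandard product when $(T,T')$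 is antistandard. *)

theory Defs
  imports
    "HOL-Algebra.QuotRing"
    "HOL-Combinatorics.Permutations"
    "HOL-Library.Poly_Mapping"
    "Jordan_Normal_Form.VS_Connect"
begin

section \<open>Free algebras\<close>

text \<open>
  Words under concatenation, written additively: \<^typ>\<open>'a \<Rightarrow>\<^sub>0 'b\<close> carries the
  convolution product of a monoid algebra as soon as the exponents form a
  (not necessarily commutative) additive monoid.  With words as exponents this is the
  free associative algebra.
\<close>

datatype 'a free_monoid = Word (letters: "'a list")

instantiation free_monoid :: (type) monoid_add
begin

definition zero_free_monoid :: "'a free_monoid" where
  "0 = Word []"

definition plus_free_monoid :: "'a free_monoid \<Rightarrow> 'a free_monoid \<Rightarrow> 'a free_monoid" where
  "u + v = Word (letters u @ letters v)"

instance
  by standard (simp_all add: zero_free_monoid_def plus_free_monoid_def)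

end

type_synonym ('x, 'k) free_algebra = "'x free_monoid \<Rightarrow>\<^sub>0 'k"

definition scalar :: "'k::field \<Rightarrow> ('x, 'k) free_algebra" where
  "scalar c = Poly_Mapping.single 0 c"

definition gen :: "'x \<Rightarrow> ('x, 'k::field) free_algebra" where
  "gen x = Poly_Mapping.single (Word [x]) 1"

definition free_algebra_ring :: "'x set \<Rightarrow> ('x, 'k::field) free_algebra ring" where
  "free_algebra_ring S =
     \<lparr>carrier = {f. \<forall>w\<in>Poly_Mapping.keys f. set (letters w) \<subseteq> S},
      mult = (*), one = 1, zero = 0, add = (+)\<rparr>"

section \<open>The quantum matrix algebra\<close>

abbreviation X :: "nat \<Rightarrow> nat \<Rightarrow> (nat \<times> nat, 'k::field) free_algebra" where
  "X i j \<equiv> gen (i, j)"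

abbreviation free_matrix_ring :: "nat \<Rightarrow> (nat \<times> nat, 'k::field) free_algebra ring" where
  "free_matrix_ring n \<equiv> free_algebra_ring ({1..n} \<times> {1..n})"

definition qmatrix_relators :: "nat \<Rightarrow> 'k::field \<Rightarrow> (nat \<times> nat, 'k) free_algebra set" where
  "qmatrix_relators n q =
     {X i j * X l j - scalar q * X l j * X i j | i j l.
        {i, j, l} \<subseteq> {1..n} \<and> i < l} \<union>
     {X i j * X i m - scalar q * X i m * X i j | i j m.
        {i, j, m} \<subseteq> {1..n} \<and> j < m} \<union>
     {X i j * X l m - X l m * X i j | i j l m.
        {i, j, l, m} \<subseteq> {1..n} \<and> i < l \<and> j > m} \<union>
     {X i j * X l m - X l m * X i j - scalar (q - inverse q) * X i m * X l j | i j l m.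
        {i, j, l, m} \<subseteq> {1..n} \<and> i < l \<and> j < m}"

definition qmatrix_ideal :: "nat \<Rightarrow> 'k::field \<Rightarrow> (nat \<times> nat, 'k) free_algebra set" where
  "qmatrix_ideal n q = Idl\<^bsub>free_matrix_ring n\<^esub> (qmatrix_relators n q)"

abbreviation qmatrix_ring :: "nat \<Rightarrow> 'k::field \<Rightarrow> (nat \<times> nat, 'k) free_algebra set ring" where
  "qmatrix_ring n q \<equiv> free_matrix_ring n Quot qmatrix_ideal n q"

definition qmatrix_proj ::
    "nat \<Rightarrow> 'k::field \<Rightarrow> (nat \<times> nat, 'k) free_algebra \<Rightarrow> (nat \<times> nat, 'k) free_algebra set" where
  "qmatrix_proj n q f = qmatrix_ideal n q +>\<^bsub>free_matrix_ring n\<^esub> f"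

text \<open>
  The quotient ring with its scalar multiplication, given by the structure map
  \<open>c \<mapsto> c \<cdot> 1\<close> from the field.
\<close>

definition qmatrix_algebra ::
    "nat \<Rightarrow> 'k::field \<Rightarrow> ('k, (nat \<times> nat, 'k) free_algebra set) module" where
  "qmatrix_algebra n q =
     \<lparr>carrier = carrier (qmatrix_ring n q),
      mult = mult (qmatrix_ring n q),
      one = one (qmatrix_ring n q),
      zero = zero (qmatrix_ring n q),
      add = add (qmatrix_ring n q),
      smult = (\<lambda>c a. qmatrix_proj n q (scalar c) \<otimes>\<^bsub>qmatrix_ring n q\<^esub> a)\<rparr>"

text \<open>
  The relators lie in the free algebra and the record is a vector space, so that
  \<^const>\<open>genideal\<close> and \<^const>\<open>vectorspace.basis\<close> have their intended meaning.
\<close>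

lemma ring_free_algebra_ring:
  "ring (free_algebra_ring S :: ('a, 'k::field) free_algebra ring)"
  (is "ring ?R")
proof (rule ringI)
  show "abelian_group ?R"
  proof (rule abelian_groupI)
    fix x assume "x \<in> carrier ?R"
    then have "- x \<in> carrier ?R"
      by (auto simp: free_algebra_ring_def in_keys_iff)
    then show "\<exists>y\<in>carrier ?R. y \<oplus>\<^bsub>?R\<^esub> x = \<zero>\<^bsub>?R\<^esub>"
      by (rule bexI[rotated]) (simp add: free_algebra_ring_def)
  qed (use keys_add in \<open>fastforce simp: free_algebra_ring_def algebra_simps\<close>)+
  show "Group.monoid ?R"
  proof (rule monoidI)
    fix f g :: "('a, 'k) free_algebra"
    assume "f \<in> carrier ?R" "g \<in> carrier ?R"
    then show "f \<otimes>\<^bsub>?R\<^esub> g \<in> carrier ?R"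
      using keys_mult[of f g] by (fastforce simp: free_algebra_ring_def plus_free_monoid_def)
  qed (auto simp: free_algebra_ring_def algebra_simps zero_free_monoid_def)
qed (auto simp: free_algebra_ring_def algebra_simps)

lemma scalar_carrier: "scalar c \<in> carrier (free_algebra_ring S)"
  by (auto simp: scalar_def free_algebra_ring_def zero_free_monoid_def)

lemma qmatrix_relators_carrier: "qmatrix_relators n q \<subseteq> carrier (free_matrix_ring n)"
proof -
  let ?R = "free_matrix_ring n :: (nat \<times> nat, 'a) free_algebra ring"
  interpret R: ring ?R by (rule ring_free_algebra_ring)
  have X: "X i j \<in> carrier ?R" if "i \<in> {1..n}" "j \<in> {1..n}" for i j
    using that by (auto simp: gen_def free_algebra_ring_def)
  have mult: "f * g \<in> carrier ?R" if "f \<in> carrier ?R" "g \<in> carrier ?R" for f g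
    using R.m_closed[OF that] by (simp add: free_algebra_ring_def)
  have diff: "f - g \<in> carrier ?R" if "f \<in> carrier ?R" "g \<in> carrier ?R" for f g
    using that keys_diff[of f g] by (fastforce simp: free_algebra_ring_def)
  show ?thesis
    unfolding qmatrix_relators_def by (auto simp del: atLeastAtMost_iff One_nat_def intro!: X mult diff scalar_carrier)
qed

lemma ideal_qmatrix_ideal: "ideal (qmatrix_ideal n q) (free_matrix_ring n)"
  unfolding qmatrix_ideal_def
  by (rule ring.genideal_ideal[OF ring_free_algebra_ring qmatrix_relators_carrier])

lemma vectorspace_qmatrix_algebra:
  "vectorspace class_ring (qmatrix_algebra n (q :: 'k::field))"
proof -
  let ?R = "free_matrix_ring n :: (nat \<times> nat, 'k) free_algebra ring"
  let ?Q = "qmatrix_ring n q" and ?A = "qmatrix_algebra n q" and ?s = "\<lambda>c. qmatrix_proj n q (scalar c)"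
  interpret I: ideal "qmatrix_ideal n q" ?R by (rule ideal_qmatrix_ideal)
  interpret Q: ring ?Q by (rule I.quotient_is_ring)
  have hom: "qmatrix_proj n q \<in> Ring.ring_hom ?R ?Q"
    using I.rcos_ring_hom by (simp add: qmatrix_proj_def[abs_def])
  have s: "?s c \<in> carrier ?Q" for c
    using ring_hom_closed[OF hom scalar_carrier] .
  have s_add: "?s (c + d) = ?s c \<oplus>\<^bsub>?Q\<^esub> ?s d" for c d
    using ring_hom_add[OF hom scalar_carrier[of c] scalar_carrier[of d]]
    by (simp add: free_algebra_ring_def scalar_def single_add)
  have s_mult: "?s (c * d) = ?s c \<otimes>\<^bsub>?Q\<^esub> ?s d" for c d
    using ring_hom_mult[OF hom scalar_carrier[of c] scalar_carrier[of d]]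
    by (simp add: free_algebra_ring_def scalar_def mult_single)
  have s_one: "?s 1 = \<one>\<^bsub>?Q\<^esub>"
    using ring_hom_one[OF hom] by (simp add: free_algebra_ring_def scalar_def single_one)
  have "abelian_group ?A"
  proof (rule abelian_groupI)
    fix x assume "x \<in> carrier ?A"
    then show "\<exists>y\<in>carrier ?A. y \<oplus>\<^bsub>?A\<^esub> x = \<zero>\<^bsub>?A\<^esub>"
      by (intro bexI[of _ "\<ominus>\<^bsub>?Q\<^esub> x"]) (simp_all add: qmatrix_algebra_def Q.l_neg del: One_nat_def)
  qed (auto simp: qmatrix_algebra_def Q.a_ac simp del: One_nat_def)
  then have "module class_ring ?A"
    by (intro moduleI class_cring.is_cring)
       (auto simp: qmatrix_algebra_def s s_add s_mult s_one Q.l_distr Q.r_distr Q.m_assoc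
             simp del: One_nat_def)
  then show ?thesis
    by (intro vectorspace.intro class_field.field_axioms)
qed

section \<open>Quantum minors\<close>

text \<open>The length of a permutation of \<open>{0, \<dots>, s - 1}\<close> is its number of inversions.\<close>

definition perm_length :: "nat \<Rightarrow> (nat \<Rightarrow> nat) \<Rightarrow> nat" where
  "perm_length s \<sigma> = card {(a, b). a < b \<and> b < s \<and> \<sigma> a > \<sigma> b}"

text \<open>
  The defining expression of the minor, formed in the free algebra and then taken
  modulo the relations.  Rows and columns are enumerated increasingly, from index \<open>0\<close>.
\<close>

definition qminor_expr :: "'k::field \<Rightarrow> nat set \<Rightarrow> nat set \<Rightarrow> (nat \<times> nat, 'k) free_algebra" where
  "qminor_expr q I J =
     (let s = card I; is = sorted_list_of_set I; js = sorted_list_of_set J in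
       \<Sum>\<sigma> | \<sigma> permutes {..<s}.
         scalar ((- q) ^ perm_length s \<sigma>) * (\<Prod>a\<leftarrow>[0..<s]. X (is ! a) (js ! \<sigma> a)))"

definition qminor ::
    "nat \<Rightarrow> 'k::field \<Rightarrow> nat set \<Rightarrow> nat set \<Rightarrow> (nat \<times> nat, 'k) free_algebra set" where
  "qminor n q I J = qmatrix_proj n q (qminor_expr q I J)"

section \<open>Tableaux and bitableaux\<close>

text \<open>
  A tableau is the list of its rows, from top to bottom.  Excluding empty rows makes
  this representation of a filled Young diagram unique.
\<close>

type_synonym tableau = "nat list list"

definition shape :: "tableau \<Rightarrow> nat list" where
  "shape T = map length T"

definition is_tableau :: "nat \<Rightarrow> tableau \<Rightarrow> bool" where
  "is_tableau n T \<longleftrightarrow>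
     sorted_wrt (\<ge>) (shape T) \<and> (\<forall>r\<in>set T. r \<noteq> [] \<and> set r \<subseteq> {1..n})"

definition decreasing_tableau :: "tableau \<Rightarrow> bool" where
  "decreasing_tableau T \<longleftrightarrow>
     (\<forall>r\<in>set T. sorted_wrt (>) r) \<and>
     (\<forall>i i' c. i < i' \<and> i' < length T \<and> c < length (T ! i') \<longrightarrow> T ! i ! c \<ge> T ! i' ! c)"

definition is_bitableau :: "nat \<Rightarrow> tableau \<times> tableau \<Rightarrow> bool" where
  "is_bitableau n = (\<lambda>(T, T'). is_tableau n T \<and> is_tableau n T' \<and> shape T = shape T')"

definition antistandard_bitableaux :: "nat \<Rightarrow> (tableau \<times> tableau) set" where
  "antistandard_bitableaux n =
     {(T, T'). is_bitableau n (T, T') \<and> decreasing_tableau T \<and> decreasing_tableau T'}"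

definition bitableau_product ::
    "nat \<Rightarrow> 'k::field \<Rightarrow> tableau \<times> tableau \<Rightarrow> (nat \<times> nat, 'k) free_algebra set" where
  "bitableau_product n q = (\<lambda>(T, T').
     foldr (\<lambda>(r, r') a. qminor n q (set r) (set r') \<otimes>\<^bsub>qmatrix_algebra n q\<^esub> a)
       (zip T T') \<one>\<^bsub>qmatrix_algebra n q\<^esub>)"

end

theory Submission
  imports Defs "HOL-Combinatorics.Multiset_Permutations"
begin

text \<open>
  Independence: an upper triangular quantum matrix times a lower triangular one, with commuting
  entries in quantum tori, is again a quantum matrix, so the algebra maps to a quantum torus.  By
  the quantum Cauchy--Binet formula \<open>[I|J]\<close> is sent to the sum over \<open>K\<close> of
  \<open>[I|K] [K|J]\<close>, and for a suitable weight of the torus coordinates the rearrangement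
  inequality singles out one heaviest term: \<open>K\<close> consists of the largest indices and all the
  matchings are order preserving.  Its exponent counts the entries in each column of the two
  rows.  Heaviest terms multiply, and the columns of an antistandard bitableau are determined by
  their multisets of entries, so distinct antistandard products have distinct leading exponents.

  Spanning: up to scalars, permuting the letters of a monomial only produces terms with a smaller
  sum of the products \<open>i * j\<close>, so one monomial for each multiset of letters suffices.  For given row
  and column content, the Robinson--Schensted--Knuth correspondence embeds these multisets
  into the antistandard bitableaux of that content; the independent products are therefore at
  least as many as the spanning monomials, and span.
\<close>

section \<open>Decreasing tableaux and their column profiles\<close>

text \<open>Decreasing rows suit the heaviest terms: in the order-preserving matching with the
  largest indices, the entry in column \<open>c\<close>, counted from 0, is paired with
  \<open>n - c\<close> whatever the length of its row, so the exponents of the rows of a tableau add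
  up column by column. The value of \<open>q\<close> may be 1 or another root of unity, so a leading
  coefficient must not be a sum that could cancel. The computation is therefore made with
  \<open>q\<close> as a formal central variable, and the heaviest term of each minor turns out to be
  a single monomial whose coefficient is a nonzero scalar times a power of that variable; only then
  does \<open>q\<close> get its value. The price is that relators vanish only modulo an ideal
  containing the difference between the variable and its value. The triangular matrices are, up to
  transposition, products of \<open>n\<close> bidiagonal ones in independent coordinates. A
  bidiagonal matrix only asks that consecutive entries of its staircase \<open>q\<close>-commute,
  and the product makes entry \<open>(i, b)\<close> a sum over lattice paths from \<open>i\<close>
  to \<open>b\<close>, so that an exponent records which step is made at which time.\<close>

definition profile :: "tableau \<Rightarrow> nat \<Rightarrow> nat \<Rightarrow> nat" where
  "profile T c i = card {p. p < length T \<and> c < length (T ! p) \<and> i \<le> T ! p ! c}"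

lemma downward_closed_nat:
  fixes A :: "nat set"
  assumes "finite A" "\<And>x y. x \<in> A \<Longrightarrow> y < x \<Longrightarrow> y \<in> A"
  shows "A = {..<card A}"
proof -
  define m where "m = (LEAST x. x \<notin> A)"
  have "\<exists>x. x \<notin> A"
    using assms(1) infinite_UNIV_nat by (metis UNIV_eq_I)
  then have "m \<notin> A"
    unfolding m_def by (rule LeastI_ex)
  moreover have "x \<in> A" if "x < m" for x
    using not_less_Least[of x "\<lambda>x. x \<notin> A"] that unfolding m_def by blast
  moreover have "x < m" if "x \<in> A" for x
    using that assms(2)[OF that, of m] \<open>m \<notin> A\<close> by (metis linorder_neqE_nat)
  ultimately have "A = {..<m}"
    by auto
  then show ?thesis
    by simp
qed

text \<open>Row lengths and columns decrease weakly from top to bottom, so the rows counted by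
  \<open>profile\<close> are the topmost ones. Hence the numbers \<open>profile\<close> locate every
  box and bound its entry.\<close>

lemma profile_iff:
  assumes T: "is_tableau n T" "decreasing_tableau T"
  shows "p < length T \<and> c < length (T ! p) \<and> i \<le> T ! p ! c \<longleftrightarrow> p < profile T c i"
proof -
  let ?A = "{p. p < length T \<and> c < length (T ! p) \<and> i \<le> T ! p ! c}"
  have "?A = {..<card ?A}"
  proof (rule downward_closed_nat)
    fix x y assume x: "x \<in> ?A" and "y < x"
    then have "length (T ! x) \<le> length (T ! y)"
      using T(1) by (auto simp: is_tableau_def shape_def sorted_wrt_map sorted_wrt_iff_nth_less)
    moreover have "T ! x ! c \<le> T ! y ! c"
      using T(2) x \<open>y < x\<close> by (auto simp: decreasing_tableau_def)
    ultimately show "y \<in> ?A"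
      using x \<open>y < x\<close> by auto
  qed simp
  then show ?thesis
    unfolding profile_def by blast
qed

lemma tableau_entry_pos:
  assumes "is_tableau n T" "p < length T" "c < length (T ! p)"
  shows "1 \<le> T ! p ! c" "T ! p ! c \<le> n"
proof -
  have "T ! p ! c \<in> {1..n}"
    using assms nth_mem[OF assms(2)] nth_mem[OF assms(3)] unfolding is_tableau_def by blast
  then show "1 \<le> T ! p ! c" "T ! p ! c \<le> n"
    by auto
qed

lemma tableau_eqI:
  assumes T: "is_tableau n T" "decreasing_tableau T" and S: "is_tableau n S" "decreasing_tableau S"
    and eq: "\<And>c i. 1 \<le> i \<Longrightarrow> profile T c i = profile S c i"
  shows "T = S"
proof -
  have iff: "p < length T \<and> c < length (T ! p) \<and> i \<le> T ! p ! c \<longleftrightarrow>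
      p < length S \<and> c < length (S ! p) \<and> i \<le> S ! p ! c" if "1 \<le> i" for p c i
    unfolding profile_iff[OF T] profile_iff[OF S] using eq[OF that] by simp
  \<comment> \<open>Entries are at least 1, so the threshold 1 selects exactly the boxes of the
    diagram.\<close>
  have box: "p < length T \<and> c < length (T ! p) \<longleftrightarrow> p < length S \<and> c < length (S ! p)" for p c
    using iff[of 1 p c] tableau_entry_pos[OF T(1)] tableau_entry_pos[OF S(1)] by blast
  have ne: "p < length T \<Longrightarrow> 0 < length (T ! p)" "p < length S \<Longrightarrow> 0 < length (S ! p)" for p
    using T(1) S(1) nth_mem by (auto simp: is_tableau_def)
  have len: "p < length T \<longleftrightarrow> p < length S" for p
    using box[of p 0] ne[of p] by blast
  have rows: "length (T ! p) = length (S ! p)" if "p < length T" for p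
    using box[of p] len[of p] that by (meson linorder_neqE_nat less_irrefl)
  show ?thesis
  proof (intro nth_equalityI)
    show "length T = length S"
      using len by (meson linorder_neqE_nat less_irrefl)
    fix p c assume p: "p < length T" and c: "c < length (T ! p)"
    have "T ! p ! c \<le> S ! p ! c" "S ! p ! c \<le> T ! p ! c"
      using iff[of "T ! p ! c" p c] iff[of "S ! p ! c" p c] p c box[of p c]
        tableau_entry_pos(1)[OF T(1), of p c] tableau_entry_pos(1)[OF S(1), of p c] by auto
    then show "T ! p ! c = S ! p ! c"
      by simp
  qed (use rows in auto)
qed

section \<open>The Robinson--Schensted--Knuth correspondence\<close>

text \<open>Fomin's local rule; the matrix and the parts of the partitions are indexed from \<open>0\<close>.\<close>

fun growth :: "(nat \<Rightarrow> nat \<Rightarrow> nat) \<Rightarrow> nat \<Rightarrow> nat \<Rightarrow> nat \<Rightarrow> nat" where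
  "growth a 0 j = (\<lambda>r. 0)"
| "growth a (Suc i) 0 = (\<lambda>r. 0)"
| "growth a (Suc i) (Suc j) = (\<lambda>r. case r of
     0 \<Rightarrow> max (growth a i (Suc j) 0) (growth a (Suc i) j 0) + a i j
   | Suc r \<Rightarrow> max (growth a i (Suc j) (Suc r)) (growth a (Suc i) j (Suc r)) +
       min (growth a i (Suc j) r) (growth a (Suc i) j r) - growth a i j r)"

lemma growth_0_right [simp]: "growth a i 0 = (\<lambda>r. 0)"
  by (cases i) auto

text \<open>The skew shape \<open>m / l\<close> is a horizontal strip. This interlacing also keeps
  the truncated subtraction in \<open>growth\<close> exact.\<close>

definition strip :: "(nat \<Rightarrow> nat) \<Rightarrow> (nat \<Rightarrow> nat) \<Rightarrow> bool" where
  "strip l m \<longleftrightarrow> (\<forall>r. l r \<le> m r \<and> m (Suc r) \<le> l r)"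

text \<open>Both \<open>m (Suc r)\<close> and \<open>v (Suc r)\<close> are at most
  \<open>l r\<close>, so the new part \<open>Suc r\<close> is at most
  \<open>min (m r) (v r)\<close>; and \<open>l r\<close> is at most this minimum, so the new part is
  no smaller than either old one.\<close>

lemma strip_growth_step:
  assumes "strip (growth a i j) (growth a i (Suc j))" "strip (growth a i j) (growth a (Suc i) j)"
  shows "strip (growth a i (Suc j)) (growth a (Suc i) (Suc j))"
    and "strip (growth a (Suc i) j) (growth a (Suc i) (Suc j))"
proof -
  define l m v where "l = growth a i j" "m = growth a i (Suc j)" "v = growth a (Suc i) j"
  have r: "l r \<le> m r" "m (Suc r) \<le> l r" "l r \<le> v r" "v (Suc r) \<le> l r" for r
    using assms by (auto simp: strip_def l_m_v_def)
  show "strip (growth a i (Suc j)) (growth a (Suc i) (Suc j))"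
    unfolding strip_def growth.simps l_m_v_def[symmetric]
  proof (intro allI conjI)
    fix s
    show "m s \<le> (case s of 0 \<Rightarrow> max (m 0) (v 0) + a i j | Suc r \<Rightarrow> max (m (Suc r)) (v (Suc r)) + min (m r) (v r) - l r)"
    proof (cases s)
      case (Suc k)
      have "l k \<le> min (m k) (v k)"
        using r by simp
      then show ?thesis
        unfolding Suc nat.case by linarith
    qed simp
    show "(case Suc s of 0 \<Rightarrow> max (m 0) (v 0) + a i j | Suc r \<Rightarrow> max (m (Suc r)) (v (Suc r)) + min (m r) (v r) - l r) \<le> m s"
      using r[of s] by (auto simp: max_def min_def)
  qed
  show "strip (growth a (Suc i) j) (growth a (Suc i) (Suc j))"
    unfolding strip_def growth.simps l_m_v_def[symmetric]
  proof (intro allI conjI)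
    fix s
    show "v s \<le> (case s of 0 \<Rightarrow> max (m 0) (v 0) + a i j | Suc r \<Rightarrow> max (m (Suc r)) (v (Suc r)) + min (m r) (v r) - l r)"
    proof (cases s)
      case (Suc k)
      have "l k \<le> min (m k) (v k)"
        using r by simp
      then show ?thesis
        unfolding Suc nat.case by linarith
    qed simp
    show "(case Suc s of 0 \<Rightarrow> max (m 0) (v 0) + a i j | Suc r \<Rightarrow> max (m (Suc r)) (v (Suc r)) + min (m r) (v r) - l r) \<le> v s"
      using r[of s] by (auto simp: max_def min_def)
  qed
qed

lemma strip_growth:
  "strip (growth a i j) (growth a (Suc i) j) \<and> strip (growth a i j) (growth a i (Suc j))"
proof (induction "i + j" arbitrary: i j rule: less_induct)
  case less
  have "strip (growth a i j) (growth a (Suc i) j)"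
  proof (cases j)
    case (Suc j')
    with less[of i j'] show ?thesis
      using strip_growth_step(1)[of a i j'] by simp
  qed (simp add: strip_def)
  moreover have "strip (growth a i j) (growth a i (Suc j))"
  proof (cases i)
    case (Suc i')
    with less[of i' j] show ?thesis
      using strip_growth_step(2)[of a i' j] by simp
  qed (simp add: strip_def)
  ultimately show ?case by blast
qed

text \<open>A horizontal strip lets at most one further part become positive.\<close>

lemma growth_support: "i \<le> r \<Longrightarrow> growth a i j r = 0"
proof (induction i arbitrary: r)
  case (Suc i)
  then obtain s where "r = Suc s" "i \<le> s"
    by (cases r) auto
  then show ?case
    using Suc.IH[of s] strip_growth[of a i j] by (auto simp: strip_def) (metis le_zero_eq)
qed simp

text \<open>Summed over all parts, the maxima and minima of the two neighbours recombine to their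
  sums, although each minimum enters one part later. With \<open>i < N\<close> the last parts of
  \<open>l\<close> and \<open>m\<close>, which this shift drops, are zero.\<close>

lemma growth_sum_step:
  assumes "i < N"
  shows "(\<Sum>r<N. growth a (Suc i) (Suc j) r) + (\<Sum>r<N. growth a i j r) =
    (\<Sum>r<N. growth a i (Suc j) r) + (\<Sum>r<N. growth a (Suc i) j r) + a i j"
proof -
  obtain M where M: "N = Suc M" "i \<le> M"
    using assms by (cases N) auto
  define l m v where "l = growth a i j" "m = growth a i (Suc j)" "v = growth a (Suc i) j"
  have zero: "l M = 0" "m M = 0"
    using M growth_support by (auto simp: l_m_v_def)
  have le: "l r \<le> m r" "l r \<le> v r" for r
    using strip_growth[of a i j] by (auto simp: strip_def l_m_v_def)
  have "(\<Sum>r<N. growth a (Suc i) (Suc j) r) =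
    max (m 0) (v 0) + a i j + (\<Sum>r<M. max (m (Suc r)) (v (Suc r)) + min (m r) (v r) - l r)"
    unfolding M sum.lessThan_Suc_shift by (simp add: l_m_v_def)
  moreover have "(\<Sum>r<M. max (m (Suc r)) (v (Suc r)) + min (m r) (v r) - l r) + (\<Sum>r<M. l r) =
    (\<Sum>r<M. max (m (Suc r)) (v (Suc r)) + min (m r) (v r))"
    unfolding sum.distrib[symmetric] by (rule sum.cong) (use le in \<open>auto simp: add_increasing\<close>)
  moreover have "\<dots> = (\<Sum>r<M. max (m (Suc r)) (v (Suc r))) + (\<Sum>r<M. min (m r) (v r))"
    by (rule sum.distrib)
  moreover have "max (m 0) (v 0) + (\<Sum>r<M. max (m (Suc r)) (v (Suc r))) = (\<Sum>r<N. max (m r) (v r))"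
    unfolding M by (rule sum.lessThan_Suc_shift[symmetric])
  moreover have "(\<Sum>r<M. min (m r) (v r)) = (\<Sum>r<N. min (m r) (v r))"
    using zero M by simp
  moreover have "(\<Sum>r<M. l r) = (\<Sum>r<N. l r)"
    using zero M by simp
  moreover have "(\<Sum>r<N. max (m r) (v r)) + (\<Sum>r<N. min (m r) (v r)) = (\<Sum>r<N. m r) + (\<Sum>r<N. v r)"
    unfolding sum.distrib[symmetric] by (rule sum.cong) (auto simp: max_def min_def)
  ultimately show ?thesis
    unfolding l_m_v_def by linarith
qed

lemma growth_sum: "i \<le> N \<Longrightarrow> (\<Sum>r<N. growth a i j r) = (\<Sum>i'<i. \<Sum>j'<j. a i' j')"
proof (induction a i j rule: growth.induct)
  case (3 a i j)
  have "(\<Sum>r<N. growth a (Suc i) (Suc j) r) + (\<Sum>i'<i. \<Sum>j'<j. a i' j') =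
    (\<Sum>i'<i. \<Sum>j'<Suc j. a i' j') + (\<Sum>i'<Suc i. \<Sum>j'<j. a i' j') + a i j"
    using growth_sum_step[of i N a j] 3 by simp
  then show ?case
    by (simp add: sum.distrib)
qed simp_all

text \<open>The local rule can be run backwards: part \<open>Suc r\<close> at the far corner of a
  square returns part \<open>r\<close> at the near corner, and part 0 returns the matrix entry. The
  induction starts at the outer boundary, where the two chains are given.\<close>

lemma growth_inj:
  assumes row: "\<And>i. i \<le> n \<Longrightarrow> growth a i n = growth b i n"
    and col: "\<And>j. j \<le> n \<Longrightarrow> growth a n j = growth b n j"
  shows "i < n \<Longrightarrow> j < n \<Longrightarrow> a i j = b i j"
proof -
  have eq: "growth a i j = growth b i j" if "i \<le> n" "j \<le> n" for i j
    using that
  proof (induction "(n - i) + (n - j)" arbitrary: i j rule: less_induct)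
    case less
    show ?case
    proof (cases "i = n \<or> j = n")
      case False
      then have m: "growth a i (Suc j) = growth b i (Suc j)" and v: "growth a (Suc i) j = growth b (Suc i) j"
        and k: "growth a (Suc i) (Suc j) = growth b (Suc i) (Suc j)"
        using less by (auto simp del: growth.simps)
      show ?thesis
      proof
        fix r
        have "growth c i j r \<le> growth c i (Suc j) r" "growth c i j r \<le> growth c (Suc i) j r" for c
          using strip_growth[of c i j] by (auto simp: strip_def)
        note le = this[of a] this[of b]
        from k have "growth a (Suc i) (Suc j) (Suc r) = growth b (Suc i) (Suc j) (Suc r)"
          by simp
        then have "max (growth b i (Suc j) (Suc r)) (growth b (Suc i) j (Suc r)) +
            min (growth b i (Suc j) r) (growth b (Suc i) j r) - growth a i j r =
          max (growth b i (Suc j) (Suc r)) (growth b (Suc i) j (Suc r)) +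
            min (growth b i (Suc j) r) (growth b (Suc i) j r) - growth b i j r"
          unfolding growth.simps m v nat.case .
        moreover have "growth a i j r \<le> min (growth b i (Suc j) r) (growth b (Suc i) j r)"
          "growth b i j r \<le> min (growth b i (Suc j) r) (growth b (Suc i) j r)"
          using le unfolding m v by simp_all
        ultimately show "growth a i j r = growth b i j r"
          by linarith
      qed
    qed (use less row col in auto)
  qed
  assume "i < n" "j < n"
  then have "growth a (Suc i) (Suc j) 0 = growth b (Suc i) (Suc j) 0"
    "growth a i (Suc j) = growth b i (Suc j)" "growth a (Suc i) j = growth b (Suc i) j"
    using eq[of "Suc i" "Suc j"] eq[of i "Suc j"] eq[of "Suc i" j] by (auto simp del: growth.simps)
  then show "a i j = b i j"
    by simp
qed

text \<open>
  A chain of horizontal strips read from the largest entry downwards: the boxes with entry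
  at least \<open>n + 1 - k\<close> have column lengths \<open>g k\<close>.
\<close>

definition chain :: "nat \<Rightarrow> (nat \<Rightarrow> nat \<Rightarrow> nat) \<Rightarrow> bool" where
  "chain n g \<longleftrightarrow> (\<forall>r. g 0 r = 0) \<and> (\<forall>k. strip (g k) (g (Suc k)))"

text \<open>A box that enters the chain at step \<open>k\<close> belongs to the
  \<open>n + 1 - k\<close> shapes from there up to step \<open>n\<close>, and this number is its
  entry.\<close>

definition chain_tableau :: "nat \<Rightarrow> (nat \<Rightarrow> nat \<Rightarrow> nat) \<Rightarrow> tableau" where
  "chain_tableau n g = map (\<lambda>p. map (\<lambda>c. card {k\<in>{1..n}. p < g k c}) [0..<card {c\<in>{..<n}. p < g n c}])
     [0..<g n 0]"

context
  fixes n :: nat and g :: "nat \<Rightarrow> nat \<Rightarrow> nat"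
  assumes chain: "chain n g"
begin

lemma chain_step: "g k r \<le> g (Suc k) r" "g (Suc k) (Suc r) \<le> g k r"
  using chain by (auto simp: chain_def strip_def)

lemma chain_mono: "k \<le> k' \<Longrightarrow> g k r \<le> g k' r"
  by (rule lift_Suc_mono_le[of "\<lambda>k. g k r"]) (auto simp: chain_step)

lemma chain_antimono: "r \<le> r' \<Longrightarrow> g k r' \<le> g k r"
  by (rule lift_Suc_antimono_le[of "g k"]) (use chain_step le_trans in blast)

lemma chain_support: "k \<le> r \<Longrightarrow> g k r = 0"
proof (induction k arbitrary: r)
  case 0
  then show ?case using chain by (simp add: chain_def)
next
  case (Suc k)
  then show ?case
    using chain_step(2)[of k "r - 1"] Suc.IH[of "r - 1"] by (cases r) auto
qed

lemma chain_row_length: "c < card {c\<in>{..<n}. p < g n c} \<longleftrightarrow> p < g n c"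
proof -
  have "{c\<in>{..<n}. p < g n c} = {..<card {c\<in>{..<n}. p < g n c}}"
    by (rule downward_closed_nat) (auto intro: less_le_trans[OF _ chain_antimono])
  moreover have "c < n" if "p < g n c"
    using that chain_support[of n c] by (cases "c < n") auto
  ultimately show ?thesis
    by blast
qed

text \<open>The steps at which a box is present form a final segment of \<open>{1..n}\<close>, and
  such a segment has at least \<open>i\<close> elements iff it contains
  \<open>n + 1 - i\<close>.\<close>

lemma chain_entry: "i \<in> {1..n} \<Longrightarrow> i \<le> card {k\<in>{1..n}. p < g k c} \<longleftrightarrow> p < g (n + 1 - i) c"
proof
  assume i: "i \<in> {1..n}" and "p < g (n + 1 - i) c"
  then have "{n + 1 - i..n} \<subseteq> {k\<in>{1..n}. p < g k c}"
    by (auto intro: less_le_trans[OF _ chain_mono])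
  then have "card {n + 1 - i..n} \<le> card {k\<in>{1..n}. p < g k c}"
    by (rule card_mono[rotated]) simp
  then show "i \<le> card {k\<in>{1..n}. p < g k c}"
    using i by auto
next
  assume i: "i \<in> {1..n}" and le: "i \<le> card {k\<in>{1..n}. p < g k c}"
  show "p < g (n + 1 - i) c"
  proof (rule ccontr)
    assume "\<not> p < g (n + 1 - i) c"
    then have "k > n + 1 - i" if "p < g k c" for k
      using that chain_mono[of k "n + 1 - i" c] by (meson leI less_le_trans)
    then have "{k\<in>{1..n}. p < g k c} \<subseteq> {n + 2 - i..n}"
      by fastforce
    then have "card {k\<in>{1..n}. p < g k c} \<le> card {n + 2 - i..n}"
      by (rule card_mono[rotated]) simp
    then show False
      using i le by auto
  qed
qed

lemma chain_tableau_length: "length (chain_tableau n g) = g n 0"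
  by (simp add: chain_tableau_def)

lemma chain_tableau_row_length:
  "p < g n 0 \<Longrightarrow> length (chain_tableau n g ! p) = card {c\<in>{..<n}. p < g n c}"
  by (simp add: chain_tableau_def)

lemma chain_tableau_box:
  "p < length (chain_tableau n g) \<and> c < length (chain_tableau n g ! p) \<longleftrightarrow> p < g n c"
  using chain_row_length[of c p] chain_antimono[of 0 c n]
  by (auto simp: chain_tableau_length chain_tableau_row_length)

lemma chain_tableau_entry:
  "p < g n c \<Longrightarrow> chain_tableau n g ! p ! c = card {k\<in>{1..n}. p < g k c}"
  using chain_row_length[of c p] chain_antimono[of 0 c n] by (simp add: chain_tableau_def)

lemma chain_tableau_ge:
  assumes "i \<in> {1..n}"
  shows "p < length (chain_tableau n g) \<and> c < length (chain_tableau n g ! p) \<and>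
    i \<le> chain_tableau n g ! p ! c \<longleftrightarrow> p < g (n + 1 - i) c"
proof -
  have "g (n + 1 - i) c \<le> g n c"
    by (rule chain_mono) (use assms in auto)
  then show ?thesis
    using chain_tableau_box[of p c] chain_tableau_entry[of p c] chain_entry[OF assms, of p c] by auto
qed

lemma profile_chain_tableau: "i \<in> {1..n} \<Longrightarrow> profile (chain_tableau n g) c i = g (n + 1 - i) c"
  unfolding profile_def by (simp only: chain_tableau_ge) simp

lemma is_tableau_chain_tableau: "is_tableau n (chain_tableau n g)"
proof -
  have "sorted_wrt (\<ge>) (shape (chain_tableau n g))"
    by (auto simp: shape_def sorted_wrt_iff_nth_less chain_tableau_length chain_tableau_row_length
        intro!: card_mono)
  moreover have "r \<noteq> [] \<and> set r \<subseteq> {1..n}" if r: "r \<in> set (chain_tableau n g)" for r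
  proof -
    from r obtain p where p: "p < g n 0" "r = chain_tableau n g ! p"
      by (auto simp: in_set_conv_nth chain_tableau_length)
    have "x \<in> {1..n}" if "x \<in> set r" for x
    proof -
      from that obtain c where c: "c < length r" "x = r ! c"
        by (auto simp: in_set_conv_nth)
      then have pc: "p < g n c"
        using chain_tableau_box[of p c] p by (simp add: chain_tableau_length)
      then have "n \<noteq> 0"
        using chain_support[of 0 c] by (cases n) auto
      have x: "x = card {k\<in>{1..n}. p < g k c}"
        using c p chain_tableau_entry[OF pc] by simp
      have "1 \<le> x"
        unfolding x using chain_entry[of 1 p c] pc \<open>n \<noteq> 0\<close> by simp
      moreover have "x \<le> card {1..n}"
        unfolding x by (rule card_mono) auto
      ultimately show ?thesis
        by simp
    qed
    moreover have "0 < length r"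
      using chain_tableau_box[of p 0] p by (simp add: chain_tableau_length)
    ultimately show ?thesis
      by auto
  qed
  ultimately show ?thesis
    by (simp add: is_tableau_def)
qed

text \<open>The partitions are read as column lengths. Then
  \<open>g (Suc k) (Suc c) \<le> g k c\<close> says that the left neighbour of a box added at step
  \<open>Suc k\<close> was already present at step \<open>k\<close>, so its entry is strictly
  larger.\<close>

lemma decreasing_chain_tableau: "decreasing_tableau (chain_tableau n g)"
  unfolding decreasing_tableau_def
proof (intro conjI ballI allI impI)
  let ?T = "chain_tableau n g"
  note tab = is_tableau_chain_tableau
  fix r assume "r \<in> set ?T"
  then obtain p where p: "p < length ?T" "r = ?T ! p"
    by (auto simp: in_set_conv_nth)
  have "r ! Suc c < r ! c" if c: "Suc c < length r" for c
  proof -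
    let ?i = "r ! Suc c"
    have i: "?i \<in> {1..n}"
      using tableau_entry_pos[OF tab p(1), of "Suc c"] c p by simp
    then have "p < g (n + 1 - ?i) (Suc c)"
      using chain_tableau_ge[OF i, of p "Suc c"] p c by simp
    also have "n + 1 - ?i = Suc (n - ?i)"
      using i by auto
    also have "g (Suc (n - ?i)) (Suc c) \<le> g (n - ?i) c"
      by (rule chain_step)
    finally have gt: "p < g (n - ?i) c" .
    then have "n - ?i \<noteq> 0"
      using chain_support[of 0 c] by auto
    then have "Suc ?i \<in> {1..n}"
      by auto
    from chain_tableau_ge[OF this, of p c] gt p show ?thesis
      by simp
  qed
  then show "sorted_wrt (>) r"
    by (subst sorted_wrt_iff_nth_Suc_transp) (auto intro!: transpI)
next
  fix p p' c
  let ?T = "chain_tableau n g"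
  assume "p < p' \<and> p' < length ?T \<and> c < length (?T ! p')"
  then have pp: "p < p'" and "p' < g n c"
    using chain_tableau_box[of p' c] by auto
  moreover have "card {k\<in>{1..n}. p' < g k c} \<le> card {k\<in>{1..n}. p < g k c}"
    by (rule card_mono) (use pp in auto)
  ultimately show "?T ! p' ! c \<le> ?T ! p ! c"
    by (simp add: chain_tableau_entry)
qed

lemma size_filter_concat:
  "size (filter_mset P (mset (concat T))) = card {(p, c). p < length T \<and> c < length (T ! p) \<and> P (T ! p ! c)}"
proof -
  have row: "size (filter_mset P (mset r)) = card {c. c < length r \<and> P (r ! c)}" for r :: "'a list"
    by (metis length_filter_conv_card mset_filter size_mset)
  have "size (filter_mset P (mset (concat T))) = (\<Sum>r\<leftarrow>T. size (filter_mset P (mset r)))"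
    by (induction T) auto
  also have "\<dots> = (\<Sum>p<length T. card {c. c < length (T ! p) \<and> P (T ! p ! c)})"
    by (simp add: sum_list_sum_nth row atLeast0LessThan)
  also have "\<dots> = card (SIGMA p:{..<length T}. {c. c < length (T ! p) \<and> P (T ! p ! c)})"
    by simp
  also have "(SIGMA p:{..<length T}. {c. c < length (T ! p) \<and> P (T ! p ! c)}) =
    {(p, c). p < length T \<and> c < length (T ! p) \<and> P (T ! p ! c)}"
    by auto
  finally show ?thesis .
qed

lemma chain_tableau_content:
  assumes i: "i \<in> {1..n}"
  shows "size (filter_mset ((\<le>) i) (mset (concat (chain_tableau n g)))) = (\<Sum>c<n. g (n + 1 - i) c)"
proof -
  let ?A = "SIGMA c:{..<n}. {..<g (n + 1 - i) c}"
  have "{(p, c). p < length (chain_tableau n g) \<and> c < length (chain_tableau n g ! p) \<and>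
      i \<le> chain_tableau n g ! p ! c} = {(p, c). p < g (n + 1 - i) c}"
    by (simp only: chain_tableau_ge[OF i])
  also have "\<dots> = prod.swap ` ?A"
  proof -
    have "c < n" if "p < g (n + 1 - i) c" for p c
    proof (rule ccontr)
      assume "\<not> c < n"
      then have "n + 1 - i \<le> c"
        using i by auto
      then show False
        using that chain_support by fastforce
    qed
    then show ?thesis
      by (auto simp: image_iff)
  qed
  finally show ?thesis
    unfolding size_filter_concat by (simp add: card_image)
qed

end

section \<open>The correspondence on multisets of letters, its injectivity and its content\<close>

lemma multiset_eq_by_thresholds:
  fixes A B :: "nat multiset"
  assumes "set_mset A \<subseteq> {1..n}" "set_mset B \<subseteq> {1..n}"
    and eq: "\<And>i. i \<in> {1..n} \<Longrightarrow> size (filter_mset ((\<le>) i) A) = size (filter_mset ((\<le>) i) B)"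
  shows "A = B"
proof (rule multiset_eqI)
  fix x
  have split: "size (filter_mset ((\<le>) x) M) = count M x + size (filter_mset ((\<le>) (Suc x)) M)" for M
  proof -
    have "filter_mset ((\<le>) x) M = filter_mset (\<lambda>y. y = x) M + filter_mset ((\<le>) (Suc x)) M"
      by (rule multiset_eqI) auto
    then show ?thesis
      by (simp add: filter_eq_replicate_mset)
  qed
  show "count A x = count B x"
  proof (cases "x \<in> {1..n}")
    case True
    have "size (filter_mset ((\<le>) (Suc x)) A) = size (filter_mset ((\<le>) (Suc x)) B)"
    proof (cases "x = n")
      case True
      have empty: "filter_mset ((\<le>) (Suc n)) M = {#}" if "set_mset M \<subseteq> {1..n}" for M
        using that by (auto simp: filter_mset_eq_conv multiset_eq_iff subset_iff not_in_iff)
      show ?thesis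
        unfolding True by (simp only: empty[OF assms(1)] empty[OF assms(2)])
    qed (use eq[of "Suc x"] \<open>x \<in> {1..n}\<close> in auto)
    then show ?thesis
      using split[of A] split[of B] eq[OF True] by simp
  next
    case False
    then show ?thesis
      using assms by (metis count_inI subsetD)
  qed
qed

text \<open>Rows and columns are reversed because the chains above start with the largest entry.\<close>

definition flip_matrix :: "nat \<Rightarrow> (nat \<times> nat) multiset \<Rightarrow> nat \<Rightarrow> nat \<Rightarrow> nat" where
  "flip_matrix n M i j = count M (n - i, n - j)"

definition rsk :: "nat \<Rightarrow> (nat \<times> nat) multiset \<Rightarrow> tableau \<times> tableau" where
  "rsk n M = (chain_tableau n (\<lambda>k. growth (flip_matrix n M) k n),
              chain_tableau n (\<lambda>k. growth (flip_matrix n M) n k))"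

lemma chain_growth: "chain n (\<lambda>k. growth a k m)" "chain n (\<lambda>k. growth a m k)"
  using strip_growth by (auto simp: chain_def)

text \<open>Both boundary chains of the growth diagram end at its far corner
  \<open>growth _ n n\<close>, whence the common shape.\<close>

lemma rsk_antistandard: "rsk n M \<in> antistandard_bitableaux n"
proof -
  have "shape (chain_tableau n g) = shape (chain_tableau n g')" if "g n = g' n" for g g'
    using that by (simp add: shape_def chain_tableau_def)
  from this[of "\<lambda>k. growth (flip_matrix n M) k n" "\<lambda>k. growth (flip_matrix n M) n k"] show ?thesis
    unfolding rsk_def antistandard_bitableaux_def is_bitableau_def
    by (simp add: is_tableau_chain_tableau[OF chain_growth(1)] is_tableau_chain_tableau[OF chain_growth(2)]
        decreasing_chain_tableau[OF chain_growth(1)] decreasing_chain_tableau[OF chain_growth(2)])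
qed

lemma inj_on_rsk: "inj_on (rsk n) {M. set_mset M \<subseteq> {1..n} \<times> {1..n}}"
proof (rule inj_onI)
  fix M M' assume M: "M \<in> {M. set_mset M \<subseteq> {1..n} \<times> {1..n}}" "M' \<in> {M. set_mset M \<subseteq> {1..n} \<times> {1..n}}"
    and eq: "rsk n M = rsk n M'"
  \<comment> \<open>A chain is recovered from its tableau, since the profile at threshold
    \<open>n + 1 - k\<close> is \<open>g k\<close>. For \<open>k = 0\<close> the threshold leaves
    \<open>{1..n}\<close>, but \<open>g 0\<close> vanishes for every chain.\<close>
  have chain_eq: "g k = g' k"
    if "chain n g" "chain n g'" "chain_tableau n g = chain_tableau n g'" "k \<le> n" for g g' k
  proof
    fix c
    show "g k c = g' k c"
    proof (cases "k = 0")
      case True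
      then show ?thesis
        using that by (simp add: chain_def)
    next
      case False
      then have "n + 1 - k \<in> {1..n}" "n + 1 - (n + 1 - k) = k"
        using \<open>k \<le> n\<close> by auto
      then show ?thesis
        using profile_chain_tableau[OF that(1), of "n + 1 - k" c]
          profile_chain_tableau[OF that(2), of "n + 1 - k" c] that(3) by simp
    qed
  qed
  let ?a = "flip_matrix n M" and ?b = "flip_matrix n M'"
  have tab: "chain_tableau n (\<lambda>k. growth ?a k n) = chain_tableau n (\<lambda>k. growth ?b k n)"
    "chain_tableau n (\<lambda>k. growth ?a n k) = chain_tableau n (\<lambda>k. growth ?b n k)"
    using eq unfolding rsk_def prod.inject by blast+
  have "growth ?a k n = growth ?b k n" if "k \<le> n" for k
    using chain_eq[OF chain_growth(1)[of n ?a n] chain_growth(1)[of n ?b n] tab(1) that] .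
  moreover have "growth ?a n k = growth ?b n k" if "k \<le> n" for k
    using chain_eq[OF chain_growth(2)[of n ?a n] chain_growth(2)[of n ?b n] tab(2) that] .
  ultimately have flip: "flip_matrix n M i j = flip_matrix n M' i j" if "i < n" "j < n" for i j
    using growth_inj[of n ?a ?b i j] that by blast
  show "M = M'"
  proof (rule multiset_eqI)
    fix x :: "nat \<times> nat"
    obtain i j where x: "x = (i, j)"
      by (cases x)
    show "count M x = count M' x"
    proof (cases "i \<in> {1..n} \<and> j \<in> {1..n}")
      case True
      then have "n - i < n" "n - j < n" "n - (n - i) = i" "n - (n - j) = j"
        by auto
      then show ?thesis
        using flip[of "n - i" "n - j"] by (simp add: flip_matrix_def x)
    next
      case False
      then have "x \<notin># M" "x \<notin># M'"
        using M x by auto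
      then show ?thesis
        by (simp add: not_in_iff)
    qed
  qed
qed

lemma sum_count_eq_size:
  assumes "finite S"
  shows "(\<Sum>x\<in>S. count M x) = size (filter_mset (\<lambda>x. x \<in> S) M)"
  using assms
proof (induction S rule: finite_induct)
  case (insert y S)
  have "filter_mset (\<lambda>x. x \<in> insert y S) M = filter_mset (\<lambda>x. x = y) M + filter_mset (\<lambda>x. x \<in> S) M"
    using insert.hyps by (intro multiset_eqI) auto
  with insert show ?case
    by (simp add: filter_eq_replicate_mset)
qed simp

text \<open>Index \<open>i'\<close> stands for row \<open>n - i'\<close>, so
  \<open>i' < n + 1 - i\<close> selects the rows from \<open>i\<close> on. The unrestricted
  direction is the threshold 1 of the same block count.\<close>

lemma sum_flip_matrix:
  assumes M: "set_mset M \<subseteq> {1..n} \<times> {1..n}" and i: "i \<in> {1..n}"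
  shows "(\<Sum>i'<n + 1 - i. \<Sum>j'<n. flip_matrix n M i' j') = size (filter_mset ((\<le>) i) (image_mset fst M))"
    and "(\<Sum>i'<n. \<Sum>j'<n + 1 - i. flip_matrix n M i' j') = size (filter_mset ((\<le>) i) (image_mset snd M))"
proof -
  have block: "(\<Sum>i'<n + 1 - a. \<Sum>j'<n + 1 - b. flip_matrix n M i' j') =
      size (filter_mset (\<lambda>x. a \<le> fst x \<and> b \<le> snd x) M)"
    if "a \<in> {1..n}" "b \<in> {1..n}" for a b
  proof -
    have "(\<Sum>i'<n + 1 - a. \<Sum>j'<n + 1 - b. flip_matrix n M i' j') =
      (\<Sum>x\<in>{..<n + 1 - a} \<times> {..<n + 1 - b}. count M (n - fst x, n - snd x))"
      by (simp add: sum.cartesian_product flip_matrix_def case_prod_beta)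
    also have "\<dots> = (\<Sum>x\<in>{a..n} \<times> {b..n}. count M x)"
      by (rule sum.reindex_bij_witness[where i = "\<lambda>x. (n - fst x, n - snd x)" and j = "\<lambda>x. (n - fst x, n - snd x)"])
         (use that in auto)
    also have "\<dots> = size (filter_mset (\<lambda>x. x \<in> {a..n} \<times> {b..n}) M)"
      by (rule sum_count_eq_size) simp
    also have "filter_mset (\<lambda>x. x \<in> {a..n} \<times> {b..n}) M = filter_mset (\<lambda>x. a \<le> fst x \<and> b \<le> snd x) M"
      using M by (intro filter_mset_cong) auto
    finally show ?thesis .
  qed
  have 1: "filter_mset (\<lambda>x. i \<le> fst x \<and> 1 \<le> snd x) M = filter_mset (\<lambda>x. i \<le> fst x) M"
    "filter_mset (\<lambda>x. 1 \<le> fst x \<and> i \<le> snd x) M = filter_mset (\<lambda>x. i \<le> snd x) M"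
    using M by (auto intro!: filter_mset_cong)
  have "1 \<in> {1..n}"
    using i by auto
  from block[OF i this] block[OF this i]
  show "(\<Sum>i'<n + 1 - i. \<Sum>j'<n. flip_matrix n M i' j') = size (filter_mset ((\<le>) i) (image_mset fst M))"
    and "(\<Sum>i'<n. \<Sum>j'<n + 1 - i. flip_matrix n M i' j') = size (filter_mset ((\<le>) i) (image_mset snd M))"
    unfolding 1 by (simp_all add: filter_mset_image_mset)
qed

lemma tableau_content: "is_tableau n T \<Longrightarrow> set_mset (mset (concat T)) \<subseteq> {1..n}"
  by (auto simp: is_tableau_def)

text \<open>By \<open>growth_sum\<close> the partition at step \<open>n + 1 - i\<close> of a
  boundary chain has as many boxes as there are letters with index at least \<open>i\<close>, and
  these counts determine a multiset.\<close>

lemma rsk_content: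
  assumes M: "set_mset M \<subseteq> {1..n} \<times> {1..n}"
  shows "mset (concat (fst (rsk n M))) = image_mset fst M"
    and "mset (concat (snd (rsk n M))) = image_mset snd M"
proof -
  show "mset (concat (fst (rsk n M))) = image_mset fst M"
  proof (rule multiset_eq_by_thresholds[of _ n])
    show "set_mset (mset (concat (fst (rsk n M)))) \<subseteq> {1..n}"
      unfolding rsk_def fst_conv by (intro tableau_content is_tableau_chain_tableau chain_growth)
    show "set_mset (image_mset fst M) \<subseteq> {1..n}"
      using M by auto
    fix i assume i: "i \<in> {1..n}"
    show "size (filter_mset ((\<le>) i) (mset (concat (fst (rsk n M))))) = size (filter_mset ((\<le>) i) (image_mset fst M))"
      unfolding rsk_def fst_conv chain_tableau_content[OF chain_growth(1) i] sum_flip_matrix(1)[OF M i, symmetric]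
      by (rule growth_sum) (use i in auto)
  qed
  show "mset (concat (snd (rsk n M))) = image_mset snd M"
  proof (rule multiset_eq_by_thresholds[of _ n])
    show "set_mset (mset (concat (snd (rsk n M)))) \<subseteq> {1..n}"
      unfolding rsk_def snd_conv by (intro tableau_content is_tableau_chain_tableau chain_growth)
    show "set_mset (image_mset snd M) \<subseteq> {1..n}"
      using M by auto
    fix i assume i: "i \<in> {1..n}"
    show "size (filter_mset ((\<le>) i) (mset (concat (snd (rsk n M))))) = size (filter_mset ((\<le>) i) (image_mset snd M))"
      unfolding rsk_def snd_conv chain_tableau_content[OF chain_growth(2) i] sum_flip_matrix(2)[OF M i, symmetric]
      by (rule growth_sum) simp
  qed
qed

section \<open>Quantum matrices over a ring\<close>

definition central :: "'r::ring_1 \<Rightarrow> bool" where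
  "central q \<longleftrightarrow> (\<forall>a. a * q = q * a)"

lemma central_commute: "central q \<Longrightarrow> a * q = q * a"
  by (simp add: central_def)

lemma central_left_commute: "central q \<Longrightarrow> a * (q * b) = q * (a * b)"
  by (metis central_def mult.assoc)

lemma central_diff: "central p \<Longrightarrow> central q \<Longrightarrow> central (p - q)"
  by (simp add: central_def algebra_simps)

lemma central_zero: "central 0"
  by (simp add: central_def)

lemma central_uminus: "central q \<Longrightarrow> central (- q)"
  by (simp add: central_def)

lemma central_power: "central q \<Longrightarrow> central (q ^ k)"
proof (induction k)
  case (Suc k)
  then show ?case
    unfolding central_def power_Suc by (metis mult.assoc)
qed (simp add: central_def)

text \<open>Here \<open>p\<close> stands for the inverse of \<open>q\<close>. Both are ring elements
  rather than scalars, because \<open>q\<close> will be a formal variable; centrality is assumed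
  where it is used.\<close>

definition qmat :: "nat \<Rightarrow> 'r::ring_1 \<Rightarrow> 'r \<Rightarrow> (nat \<Rightarrow> nat \<Rightarrow> 'r) \<Rightarrow> bool" where
  "qmat n q p x \<longleftrightarrow> (\<forall>i\<in>{1..n}. \<forall>j\<in>{1..n}. \<forall>l\<in>{1..n}. \<forall>m\<in>{1..n}.
     (i < l \<longrightarrow> x i j * x l j = q * (x l j * x i j)) \<and>
     (j < m \<longrightarrow> x i j * x i m = q * (x i m * x i j)) \<and>
     (i < l \<and> m < j \<longrightarrow> x i j * x l m = x l m * x i j) \<and>
     (i < l \<and> j < m \<longrightarrow> x i j * x l m = x l m * x i j + (q - p) * (x i m * x l j)))"

lemma
  assumes "qmat n q p x" "i \<in> {1..n}" "j \<in> {1..n}" "l \<in> {1..n}" "m \<in> {1..n}"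
  shows qmat_col: "i < l \<Longrightarrow> x i j * x l j = q * (x l j * x i j)"
    and qmat_row: "j < m \<Longrightarrow> x i j * x i m = q * (x i m * x i j)"
    and qmat_anti: "i < l \<Longrightarrow> m < j \<Longrightarrow> x i j * x l m = x l m * x i j"
    and qmat_diag: "i < l \<Longrightarrow> j < m \<Longrightarrow> x i j * x l m = x l m * x i j + (q - p) * (x i m * x l j)"
  using assms unfolding qmat_def by blast+

lemma qmat_transpose: "qmat n q p x \<Longrightarrow> qmat n q p (\<lambda>i j. x j i)"
  unfolding qmat_def[of n q p "\<lambda>i j. x j i"]
  by (auto simp: qmat_col qmat_row qmat_diag simp del: atLeastAtMost_iff One_nat_def)
     (metis qmat_anti)+

text \<open>The relations for a product of matrices hold neither term by term nor row by row, but
  for the terms with inner indices \<open>(k, p)\<close> and \<open>(p, k)\<close> taken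
  together.\<close>

lemma sum_sum_eqI:
  fixes F G :: "'b \<Rightarrow> 'b \<Rightarrow> 'a::ab_group_add"
  assumes "finite A" "\<And>k. k \<in> A \<Longrightarrow> F k k = G k k"
    and "\<And>k p. k \<in> A \<Longrightarrow> p \<in> A \<Longrightarrow> k \<noteq> p \<Longrightarrow> F k p + F p k = G k p + G p k"
  shows "(\<Sum>k\<in>A. \<Sum>p\<in>A. F k p) = (\<Sum>k\<in>A. \<Sum>p\<in>A. G k p)"
  using assms
proof (induction A rule: finite_induct)
  case (insert a A)
  have split: "(\<Sum>k\<in>insert a A. \<Sum>p\<in>insert a A. H k p) =
      H a a + (\<Sum>p\<in>A. H a p + H p a) + (\<Sum>k\<in>A. \<Sum>p\<in>A. H k p)" for H :: "'b \<Rightarrow> 'b \<Rightarrow> 'a"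
    using insert.hyps by (simp add: sum.distrib algebra_simps)
  have "(\<Sum>p\<in>A. F a p + F p a) = (\<Sum>p\<in>A. G a p + G p a)"
    using insert.hyps insert.prems(2) by (intro sum.cong refl) auto
  moreover have "(\<Sum>k\<in>A. \<Sum>p\<in>A. F k p) = (\<Sum>k\<in>A. \<Sum>p\<in>A. G k p)"
    using insert.prems by (intro insert.IH) auto
  ultimately show ?case
    unfolding split using insert.prems(1)[of a] by simp
qed simp

lemma sum_sum_eq_linorderI:
  fixes F G :: "'b::linorder \<Rightarrow> 'b \<Rightarrow> 'a::ab_group_add"
  assumes "finite A" "\<And>k. k \<in> A \<Longrightarrow> F k k = G k k"
    and less: "\<And>k p. k \<in> A \<Longrightarrow> p \<in> A \<Longrightarrow> k < p \<Longrightarrow> F k p + F p k = G k p + G p k"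
  shows "(\<Sum>k\<in>A. \<Sum>p\<in>A. F k p) = (\<Sum>k\<in>A. \<Sum>p\<in>A. G k p)"
proof (rule sum_sum_eqI)
  fix k p assume "k \<in> A" "p \<in> A" "k \<noteq> p"
  then show "F k p + F p k = G k p + G p k"
    using less[of k p] less[of p k] by (cases "k < p") (auto simp: add.commute)
qed (use assms in auto)

definition mat_prod :: "nat \<Rightarrow> (nat \<Rightarrow> nat \<Rightarrow> 'r::ring_1) \<Rightarrow> (nat \<Rightarrow> nat \<Rightarrow> 'r) \<Rightarrow> nat \<Rightarrow> nat \<Rightarrow> 'r" where
  "mat_prod n x y i j = (\<Sum>k\<in>{1..n}. x i k * y k j)"

lemma mat_prod_mult:
  assumes comm: "\<And>i j k l. x i j * y k l = y k l * x i j"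
  shows "mat_prod n x y i j * mat_prod n x y l m =
    (\<Sum>k\<in>{1..n}. \<Sum>p\<in>{1..n}. (x i k * x l p) * (y k j * y p m))"
proof -
  have "x i k * y k j * (x l p * y p m) = (x i k * x l p) * (y k j * y p m)" for k p
    by (metis comm mult.assoc)
  then show ?thesis
    unfolding mat_prod_def sum_product by simp
qed

lemma mat_prod_col:
  assumes q: "central q" "central p" "q * p = 1"
    and x: "qmat n q p x" and y: "qmat n q p y"
    and comm: "\<And>i j k l. x i j * y k l = y k l * x i j"
    and ij: "i \<in> {1..n}" "j \<in> {1..n}" "l \<in> {1..n}" "i < l"
  shows "mat_prod n x y i j * mat_prod n x y l j = q * (mat_prod n x y l j * mat_prod n x y i j)"
proof -
  note [simp] = central_left_commute[OF q(1), of "x _ _"] central_left_commute[OF q(2), of "x _ _"]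
  show ?thesis
    unfolding mat_prod_mult[of x y, OF comm] sum_distrib_left
  proof (rule sum_sum_eq_linorderI)
    fix k assume k: "k \<in> {1..n}"
    show "x i k * x l k * (y k j * y k j) = q * (x l k * x i k * (y k j * y k j))"
      by (simp add: qmat_col[OF x ij(1) k ij(3) k ij(4)] mult.assoc)
  next
    fix k s assume k: "k \<in> {1..n}" and s: "s \<in> {1..n}" and "k < s"
    let ?a = "x l s * x i k" and ?b = "x l k * x i s" and ?c = "y s j * y k j"
    have 1: "x i k * x l s = ?a + (q - p) * ?b"
      using qmat_diag[OF x ij(1) k ij(3) s ij(4) \<open>k < s\<close>] qmat_anti[OF x ij(1) s ij(3) k ij(4) \<open>k < s\<close>]
      by simp
    have 2: "x i s * x l k = ?b"
      using qmat_anti[OF x ij(1) s ij(3) k ij(4) \<open>k < s\<close>] .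
    have 3: "y k j * y s j = q * ?c"
      using qmat_col[OF y k ij(2) s ij(2) \<open>k < s\<close>] .
    have [simp]: "p * (q * z) = z" for z
      using q(3) central_commute[OF q(1), of p] by (simp flip: mult.assoc)
    \<comment> \<open>Both sides become \<open>q * (?a * ?c) + q * (q * (?b * ?c))\<close>: as
      \<open>q * p = 1\<close>, the correction contributes \<open>q * q - 1\<close> times
      \<open>?b * ?c\<close>, and the second summand supplies the missing one.\<close>
    show "x i k * x l s * (y k j * y s j) + x i s * x l k * (y s j * y k j) =
      q * (x l k * x i s * (y k j * y s j)) + q * (x l s * x i k * (y s j * y k j))"
      unfolding 1 2 3
      by (simp add: distrib_right left_diff_distrib right_diff_distrib mult.assoc)
  qed simp
qed

lemma mat_prod_transpose:
  assumes comm: "\<And>i j k l. x i j * y k l = y k l * x i j"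
  shows "mat_prod n x y i j = mat_prod n (\<lambda>i j. y j i) (\<lambda>i j. x j i) j i"
  unfolding mat_prod_def by (simp add: comm)

text \<open>This is the fact that matrix comultiplication respects the quantum relations. The row
  relation is the column relation for the transposed factors in reverse order, which commuting
  entries allow.\<close>

lemma qmat_mat_prod:
  assumes q: "central q" "central p" "q * p = 1"
    and x: "qmat n q p x" and y: "qmat n q p y"
    and comm: "\<And>i j k l. x i j * y k l = y k l * x i j"
  shows "qmat n q p (mat_prod n x y)"
proof -
  let ?z = "mat_prod n x y" and ?r = "q - p"
  have r: "central ?r"
    by (simp add: central_diff q)
  note [simp] = central_left_commute[OF q(1), of "x _ _"] central_left_commute[OF q(2), of "x _ _"]
     central_left_commute[OF q(1), of "y _ _"] central_left_commute[OF q(2), of "y _ _"]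
     central_left_commute[OF r, of "x _ _"] central_left_commute[OF r, of "y _ _"]
  have qp [simp]: "q * (p * z) = z" for z
    using q(3) by (simp flip: mult.assoc)
  have pq [simp]: "p * (q * z) = z" for z
    using q(3) central_commute[OF q(1), of p] by (simp flip: mult.assoc)
  have anti: "?z i j * ?z l m = ?z l m * ?z i j"
    if ij: "i \<in> {1..n}" "j \<in> {1..n}" "l \<in> {1..n}" "m \<in> {1..n}" "i < l" "m < j" for i j l m
    unfolding mat_prod_mult[of x y, OF comm]
  proof (rule sum_sum_eq_linorderI)
    fix k assume k: "k \<in> {1..n}"
    show "x i k * x l k * (y k j * y k m) = x l k * x i k * (y k m * y k j)"
      using qmat_col[OF x ij(1) k ij(3) k ij(5)] qmat_row[OF y k ij(4) ij(1) ij(2) ij(6)]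
      by (simp add: mult.assoc)
  next
    fix k s assume k: "k \<in> {1..n}" and s: "s \<in> {1..n}" and ks: "k < s"
    have 1: "x i k * x l s = x l s * x i k + ?r * (x i s * x l k)"
      using qmat_diag[OF x ij(1) k ij(3) s ij(5) ks] .
    have 2: "x i s * x l k = x l k * x i s"
      using qmat_anti[OF x ij(1) s ij(3) k ij(5) ks] .
    have 3: "y k m * y s j = y s j * y k m + ?r * (y k j * y s m)"
      using qmat_diag[OF y k ij(4) s ij(2) ks ij(6)] .
    have 4: "y k j * y s m = y s m * y k j"
      using qmat_anti[OF y k ij(2) s ij(4) ks ij(6)] .
    show "x i k * x l s * (y k j * y s m) + x i s * x l k * (y s j * y k m) =
      x l k * x i s * (y k m * y s j) + x l s * x i k * (y s m * y k j)"
      unfolding 1 2 3 4 by (simp add: distrib_right distrib_left mult.assoc)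
  qed simp
  have diag: "?z i j * ?z l m = ?z l m * ?z i j + ?r * (?z i m * ?z l j)"
    if ij: "i \<in> {1..n}" "j \<in> {1..n}" "l \<in> {1..n}" "m \<in> {1..n}" "i < l" "j < m" for i j l m
    unfolding mat_prod_mult[of x y, OF comm] sum_distrib_left sum.distrib[symmetric]
  proof (rule sum_sum_eq_linorderI)
    fix k assume k: "k \<in> {1..n}"
    \<comment> \<open>With equal inner indices each factor contributes one \<open>q\<close>, and
      \<open>1 + (q - p) * q = q * q\<close> accounts for the diagonal correction.\<close>
    have "z + ?r * (q * z) = q * (q * z)" for z
      by (simp add: left_diff_distrib)
    then show "x i k * x l k * (y k j * y k m) =
        x l k * x i k * (y k m * y k j) + ?r * (x i k * x l k * (y k m * y k j))"
      using qmat_col[OF x ij(1) k ij(3) k ij(5)] qmat_row[OF y k ij(2) ij(1) ij(4) ij(6)]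
      by (simp add: mult.assoc)
  next
    fix k s assume k: "k \<in> {1..n}" and s: "s \<in> {1..n}" and ks: "k < s"
    have 1: "x i k * x l s = x l s * x i k + ?r * (x i s * x l k)"
      using qmat_diag[OF x ij(1) k ij(3) s ij(5) ks] .
    have 2: "x i s * x l k = x l k * x i s"
      using qmat_anti[OF x ij(1) s ij(3) k ij(5) ks] .
    have 3: "y k j * y s m = y s m * y k j + ?r * (y k m * y s j)"
      using qmat_diag[OF y k ij(2) s ij(4) ks ij(6)] .
    have 4: "y k m * y s j = y s j * y k m"
      using qmat_anti[OF y k ij(4) s ij(2) ks ij(6)] .
    show "x i k * x l s * (y k j * y s m) + x i s * x l k * (y s j * y k m) =
      (x l k * x i s * (y k m * y s j) + ?r * (x i k * x l s * (y k m * y s j))) +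
      (x l s * x i k * (y s m * y k j) + ?r * (x i s * x l k * (y s m * y k j)))"
      unfolding 1 2 3 4 by (simp add: distrib_right distrib_left mult.assoc)
  qed simp
  have col: "?z i j * ?z l j = q * (?z l j * ?z i j)"
    if "i \<in> {1..n}" "j \<in> {1..n}" "l \<in> {1..n}" "i < l" for i j l
    using mat_prod_col[OF q x y comm that] .
  have row: "?z i j * ?z i m = q * (?z i m * ?z i j)"
    if "i \<in> {1..n}" "j \<in> {1..n}" "m \<in> {1..n}" "j < m" for i j m
    unfolding mat_prod_transpose[of x y, OF comm]
    by (rule mat_prod_col[OF q qmat_transpose[OF y] qmat_transpose[OF x]])
      (use that comm in auto)
  show ?thesis
    unfolding qmat_def by (intro ballI conjI impI) (auto intro!: col row anti diag simp del: atLeastAtMost_iff)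
qed

section \<open>Quantum minors by row expansion\<close>

text \<open>A function on column sets represents an element of a quantum exterior algebra;
  \<open>row_op\<close> is left multiplication by the one-form whose coefficients are row
  \<open>i\<close>.\<close>

definition row_op :: "'r::ring_1 \<Rightarrow> (nat \<Rightarrow> nat \<Rightarrow> 'r) \<Rightarrow> nat \<Rightarrow> (nat set \<Rightarrow> 'r) \<Rightarrow> nat set \<Rightarrow> 'r" where
  "row_op q x i f J = (\<Sum>j\<in>J. (- q) ^ card {l\<in>J. l < j} * (x i j * f (J - {j})))"

text \<open>Rows form a list, so that repeated and unordered rows make sense; the proof of the
  Cauchy-Binet formula produces them.\<close>

fun row_minor :: "'r::ring_1 \<Rightarrow> (nat \<Rightarrow> nat \<Rightarrow> 'r) \<Rightarrow> nat list \<Rightarrow> nat set \<Rightarrow> 'r" where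
  "row_minor q x [] J = (if J = {} then 1 else 0)"
| "row_minor q x (i # is) J = row_op q x i (row_minor q x is) J"

lemma row_minor_Cons: "row_minor q x (i # is) = row_op q x i (row_minor q x is)"
  by (rule ext) simp

text \<open>The two orders in which columns \<open>j < m\<close> can be removed differ by one in the
  exponent of \<open>- q\<close>. This is the source of the factor in the two exterior relations
  below.\<close>

lemma card_less_remove:
  fixes J :: "nat set"
  assumes "finite J" "j \<in> J" "m \<in> J" "j < m"
  shows "card {l\<in>J - {m}. l < j} = card {l\<in>J. l < j}"
    and "card {l\<in>J. l < m} = Suc (card {l\<in>J - {j}. l < m})"
proof -
  have "{l\<in>J - {m}. l < j} = {l\<in>J. l < j}"
    using assms by auto
  then show "card {l\<in>J - {m}. l < j} = card {l\<in>J. l < j}"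
    by simp
  have "{l\<in>J. l < m} = insert j {l\<in>J - {j}. l < m}"
    using assms by auto
  then show "card {l\<in>J. l < m} = Suc (card {l\<in>J - {j}. l < m})"
    using assms(1) by simp
qed

lemma row_op_row_op:
  assumes q: "central q" and J: "finite J"
  shows "row_op q x i (row_op q x k f) J = (\<Sum>j\<in>J. \<Sum>m\<in>J. if j = m then 0 else
    (- q) ^ (card {l\<in>J. l < j} + card {l\<in>J - {j}. l < m}) * (x i j * x k m * f (J - {j} - {m})))"
proof -
  have q': "central ((- q) ^ e)" for e
    by (intro central_power central_uminus q)
  have "(- q) ^ card {l\<in>J. l < j} * (x i j * row_op q x k f (J - {j})) =
    (\<Sum>m\<in>J. if j = m then 0 else
      (- q) ^ (card {l\<in>J. l < j} + card {l\<in>J - {j}. l < m}) * (x i j * x k m * f (J - {j} - {m})))"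
    (is "?L = ?R") if j: "j \<in> J" for j
  proof -
    have "?L = (\<Sum>m\<in>J-{j}.
      (- q) ^ (card {l\<in>J. l < j} + card {l\<in>J - {j}. l < m}) * (x i j * x k m * f (J - {j} - {m})))"
      unfolding row_op_def[of q x k] sum_distrib_left power_add
      by (simp add: mult.assoc central_left_commute[OF q', of "x _ _"])
    also have "\<dots> = ?R"
      by (rule sum.mono_neutral_cong_left) (use J in auto)
    finally show ?thesis .
  qed
  then show ?thesis
    unfolding row_op_def[of q x i] by simp
qed

text \<open>The one-form of a row squares to zero: the factor \<open>q\<close> from the row relation
  cancels against the extra \<open>- q\<close> of the other order of removal.\<close>

lemma row_op_same:
  assumes q: "central q" and x: "qmat n q p x" and k: "k \<in> {1..n}" and J: "J \<subseteq> {1..n}"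
  shows "row_op q x k (row_op q x k f) J = 0"
proof -
  have fin: "finite J"
    using J finite_subset by blast
  have "row_op q x k (row_op q x k f) J = (\<Sum>j\<in>J. \<Sum>m\<in>J. 0)"
    unfolding row_op_row_op[OF q fin]
  proof (rule sum_sum_eq_linorderI[OF fin])
    fix j m assume jm: "j \<in> J" "m \<in> J" "j < m"
    let ?e = "card {l\<in>J. l < j} + card {l\<in>J - {j}. l < m}"
    have set: "J - {m} - {j} = J - {j} - {m}"
      by auto
    have e: "card {l\<in>J. l < m} + card {l\<in>J - {m}. l < j} = Suc ?e"
      using card_less_remove[OF fin jm] by simp
    have row: "x k j * x k m = q * (x k m * x k j)"
      using qmat_row[OF x k _ k _ jm(3)] jm J by blast
    have "(- q) ^ ?e * (q * z) = q * ((- q) ^ ?e * z)" for z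
      by (rule central_left_commute[OF q])
    then show "(if j = m then 0 else (- q) ^ ?e * (x k j * x k m * f (J - {j} - {m}))) +
      (if m = j then 0 else (- q) ^ (card {l\<in>J. l < m} + card {l\<in>J - {m}. l < j}) *
        (x k m * x k j * f (J - {m} - {j}))) = 0 + 0"
      unfolding set e row using jm by (simp add: mult.assoc)
  qed simp
  then show ?thesis by simp
qed

text \<open>For columns \<open>j < m\<close> the right side carries the correction
  \<open>(q - p)\<close> of the diagonal relation. Multiplied by \<open>- q\<close> it becomes
  \<open>1 - q * q\<close>, which turns the term with factor \<open>q * q\<close> into the one
  required on the left.\<close>

lemma row_op_swap:
  assumes q: "central q" "q * p = 1" and x: "qmat n q p x"
    and kl: "k \<in> {1..n}" "l \<in> {1..n}" "k < l" and J: "J \<subseteq> {1..n}"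
  shows "row_op q x l (row_op q x k f) J = - q * row_op q x k (row_op q x l f) J"
proof -
  have fin: "finite J"
    using J finite_subset by blast
  show ?thesis
    unfolding row_op_row_op[OF q(1) fin] sum_distrib_left
  proof (rule sum_sum_eq_linorderI[OF fin])
    fix j m assume jm: "j \<in> J" "m \<in> J" "j < m"
    let ?e = "card {l\<in>J. l < j} + card {l\<in>J - {j}. l < m}"
    have jm': "j \<in> {1..n}" "m \<in> {1..n}"
      using jm J by auto
    have set: "J - {m} - {j} = J - {j} - {m}"
      by auto
    have e: "card {l\<in>J. l < m} + card {l\<in>J - {m}. l < j} = Suc ?e"
      using card_less_remove[OF fin jm] by simp
    have anti: "x k m * x l j = x l j * x k m"
      using qmat_anti[OF x kl(1) jm'(2) kl(2) jm'(1) kl(3) jm(3)] .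
    have diag: "x k j * x l m = x l m * x k j + (q - p) * (x l j * x k m)"
      using qmat_diag[OF x kl(1) jm'(1) kl(2) jm'(2) kl(3) jm(3)] anti by simp
    define s where "s = (- q) ^ ?e"
    have comm: "s * (q * z) = q * (s * z)" for z
      by (rule central_left_commute[OF q(1)])
    have qp: "q * (p * z) = z" for z
      using q(2) by (simp flip: mult.assoc)
    have "q * (s * (p * z)) = s * z" for z
      using comm[of "p * z"] qp[of z] by simp
    then show "(if j = m then 0 else (- q) ^ ?e * (x l j * x k m * f (J - {j} - {m}))) +
      (if m = j then 0 else (- q) ^ (card {l\<in>J. l < m} + card {l\<in>J - {m}. l < j}) *
        (x l m * x k j * f (J - {m} - {j}))) =
      - q * (if j = m then 0 else (- q) ^ ?e * (x k j * x l m * f (J - {j} - {m}))) +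
      - q * (if m = j then 0 else (- q) ^ (card {l\<in>J. l < m} + card {l\<in>J - {m}. l < j}) *
        (x k m * x l j * f (J - {m} - {j})))"
      unfolding set e power_Suc diag anti s_def[symmetric] using jm
      by (simp add: comm mult.assoc distrib_left distrib_right left_diff_distrib right_diff_distrib)
  qed simp
qed

lemma row_op_cong:
  "(\<And>j. j \<in> J \<Longrightarrow> f (J - {j}) = g (J - {j})) \<Longrightarrow> row_op q x i f J = row_op q x i g J"
  unfolding row_op_def by simp

lemma row_op_central:
  assumes "central c"
  shows "row_op q x i (\<lambda>J. c * f J) J = c * row_op q x i f J"
  unfolding row_op_def sum_distrib_left
  by (simp add: central_left_commute[OF assms, of "x _ _"] central_left_commute[OF assms, of "(- q) ^ _"])

text \<open>Insertion sort with the two exterior relations: every smaller row that is passed costs a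
  factor \<open>- q\<close>, and meeting an equal row gives zero.\<close>

lemma row_minor_insort:
  assumes q: "central q" "q * p = 1" and x: "qmat n q p x"
    and k: "k \<in> {1..n}" and ks: "set ks \<subseteq> {1..n}" "sorted_wrt (<) ks" and J: "J \<subseteq> {1..n}"
  shows "row_minor q x (k # ks) J =
    (if k \<in> set ks then 0 else (- q) ^ card {l\<in>set ks. l < k} * row_minor q x (insort k ks) J)"
  using ks J
proof (induction ks arbitrary: J)
  case Nil
  then show ?case by simp
next
  case (Cons k1 ks)
  consider "k < k1" | "k = k1" | "k1 < k" by linarith
  then show ?case
  proof cases
    case 1
    then have "{l\<in>set (k1 # ks). l < k} = {}" and notin: "k \<notin> set (k1 # ks)"
      using Cons.prems by auto
    then have card: "card {l\<in>set (k1 # ks). l < k} = 0"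
      by (simp only: card.empty)
    show ?thesis
      unfolding card using 1 notin by simp
  next
    case 2
    then show ?thesis
      using row_op_same[OF q(1) x k Cons.prems(3)] by (simp add: row_minor_Cons)
  next
    case 3
    define c where "c = (if k \<in> set ks then 0 else (- q) ^ card {l\<in>set ks. l < k})"
    have c: "central c"
      unfolding c_def by (simp add: central_zero central_power central_uminus q(1))
    have "{l\<in>set (k1 # ks). l < k} = insert k1 {l\<in>set ks. l < k}"
      using 3 by auto
    moreover have "k1 \<notin> set ks"
      using Cons.prems by auto
    ultimately have card: "card {l\<in>set (k1 # ks). l < k} = Suc (card {l\<in>set ks. l < k})"
      by simp
    have "row_minor q x (k # k1 # ks) J = - q * row_op q x k1 (row_op q x k (row_minor q x ks)) J"
      using row_op_swap[OF q x _ k 3 Cons.prems(3)] Cons.prems(1) by (simp add: row_minor_Cons)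
    also have "row_op q x k1 (row_op q x k (row_minor q x ks)) J =
        row_op q x k1 (\<lambda>J. c * row_minor q x (insort k ks) J) J"
    proof (rule row_op_cong)
      fix j
      have "J - {j} \<subseteq> {1..n}"
        using Cons.prems(3) by blast
      then show "row_op q x k (row_minor q x ks) (J - {j}) = c * row_minor q x (insort k ks) (J - {j})"
        using Cons.IH[of "J - {j}"] Cons.prems by (simp add: c_def)
    qed
    also have "\<dots> = c * row_op q x k1 (row_minor q x (insort k ks)) J"
      by (rule row_op_central[OF c])
    finally show ?thesis
      using 3 card by (simp add: c_def mult.assoc row_minor_Cons)
  qed
qed

lemma row_op_sorted_minor:
  assumes q: "central q" "q * p = 1" and x: "qmat n q p x"
    and k: "k \<in> {1..n}" and K: "K \<subseteq> {1..n}" and J: "J \<subseteq> {1..n}"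
  shows "row_op q x k (row_minor q x (sorted_list_of_set K)) J =
    (if k \<in> K then 0
     else (- q) ^ card {l\<in>K. l < k} * row_minor q x (sorted_list_of_set (insert k K)) J)"
proof -
  have fin: "finite K"
    using K finite_subset by blast
  show ?thesis
    using row_minor_insort[OF q x k _ _ J, of "sorted_list_of_set K"] fin K
    by (simp add: sorted_list_of_set_insert_remove)
qed

lemma row_minor_commute:
  assumes q: "central q" and "\<And>i j. x i j * b = b * x i j"
  shows "row_minor q x is J * b = b * row_minor q x is J"
proof (induction "is" arbitrary: J)
  case (Cons i "is")
  have q': "central ((- q) ^ e)" for e
    by (intro central_power central_uminus q)
  have move: "s * (x i j * r) * b = b * (s * (x i j * r))"
    if "r * b = b * r" "central s" for s r j
  proof -
    have "x i j * (b * r) = b * (x i j * r)"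
      by (simp add: assms(2) flip: mult.assoc)
    then show ?thesis
      by (simp add: mult.assoc that(1) central_left_commute[OF that(2), of b])
  qed
  show ?case
    unfolding row_minor.simps row_op_def sum_distrib_left sum_distrib_right
    by (intro sum.cong refl move Cons.IH q')
qed simp

text \<open>Expand the product along its first row. Row \<open>k\<close> of \<open>y\<close> then
  stands before the rows \<open>K\<close>, where it either repeats one of them and gives zero, or is
  sorted in at the cost of a power of \<open>- q\<close>.\<close>

theorem cauchy_binet:
  assumes q: "central q" "q * p = 1" and y: "qmat n q p y"
    and comm: "\<And>i j k l. x i j * y k l = y k l * x i j"
    and J: "J \<subseteq> {1..n}"
  shows "row_minor q (mat_prod n x y) is J =
    (\<Sum>K\<in>Pow {1..n}. row_minor q x is K * row_minor q y (sorted_list_of_set K) J)"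
  using J
proof (induction "is" arbitrary: J)
  case Nil
  have "(\<Sum>K\<in>Pow {1..n}. row_minor q x [] K * row_minor q y (sorted_list_of_set K) J) =
      (\<Sum>K\<in>{{}}. row_minor q x [] K * row_minor q y (sorted_list_of_set K) J)"
    by (rule sum.mono_neutral_right) auto
  then show ?case by simp
next
  case (Cons i "is")
  let ?N = "{1..n}" and ?A = "row_minor q x is"
  let ?Y = "\<lambda>K. row_minor q y (sorted_list_of_set K)"
  let ?s = "\<lambda>J j. (- q) ^ card {l\<in>J. l < j}"
  have s: "central (?s J j)" for J j
    by (intro central_power central_uminus q)
  have A: "?A K * y k j = y k j * ?A K" for K k j
    by (rule row_minor_commute[OF q(1) comm])
  have IH: "row_minor q (mat_prod n x y) is (J - {j}) = (\<Sum>K\<in>Pow ?N. ?A K * ?Y K (J - {j}))" for j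
    using Cons.IH[of "J - {j}"] Cons.prems by blast
  have "row_minor q (mat_prod n x y) (i # is) J =
    (\<Sum>j\<in>J. ?s J j * (mat_prod n x y i j * (\<Sum>K\<in>Pow ?N. ?A K * ?Y K (J - {j}))))"
    unfolding row_minor.simps row_op_def IH ..
  also have "\<dots> = (\<Sum>j\<in>J. \<Sum>k\<in>?N. \<Sum>K\<in>Pow ?N. x i k * ?A K * (?s J j * (y k j * ?Y K (J - {j}))))"
  proof (rule sum.cong[OF refl])
    fix j
    have swap: "a * (b * c * (d * e)) = b * d * (a * (c * e))" if "central a" "d * c = c * d" for a b c d e :: 'a
    proof -
      have "c * (d * e) = d * (c * e)"
        by (simp add: that(2) flip: mult.assoc)
      then show ?thesis
        by (simp add: mult.assoc central_left_commute[OF that(1), of b] central_left_commute[OF that(1), of d])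
    qed
    show "?s J j * (mat_prod n x y i j * (\<Sum>K\<in>Pow ?N. ?A K * ?Y K (J - {j}))) =
      (\<Sum>k\<in>?N. \<Sum>K\<in>Pow ?N. x i k * ?A K * (?s J j * (y k j * ?Y K (J - {j}))))"
      unfolding mat_prod_def sum_product
      unfolding sum_distrib_left by (intro sum.cong refl swap s A)
  qed
  also have "\<dots> = (\<Sum>k\<in>?N. \<Sum>j\<in>J. \<Sum>K\<in>Pow ?N. x i k * ?A K * (?s J j * (y k j * ?Y K (J - {j}))))"
    by (rule sum.swap)
  also have "\<dots> = (\<Sum>k\<in>?N. \<Sum>K\<in>Pow ?N. x i k * ?A K * row_op q y k (?Y K) J)"
    unfolding row_op_def sum_distrib_left by (intro sum.cong refl sum.swap)
  also have "\<dots> = (\<Sum>k\<in>?N. \<Sum>K\<in>Pow ?N.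
      if k \<in> K then 0 else ?s K k * (x i k * ?A K) * ?Y (insert k K) J)"
  proof (intro sum.cong refl)
    fix k K assume "k \<in> ?N" "K \<in> Pow ?N"
    then have "row_op q y k (?Y K) J = (if k \<in> K then 0 else ?s K k * ?Y (insert k K) J)"
      using Cons.prems by (intro row_op_sorted_minor[OF q y]) blast+
    moreover have "x i k * ?A K * (?s K k * b) = ?s K k * (x i k * ?A K) * b" for b
      unfolding mult.assoc[of "?s K k"] by (rule central_left_commute[OF s])
    ultimately show "x i k * ?A K * row_op q y k (?Y K) J =
      (if k \<in> K then 0 else ?s K k * (x i k * ?A K) * ?Y (insert k K) J)"
      by (simp only: if_distrib mult_zero_right if_cancel split: if_split) simp
  qed
  also have "\<dots> = (\<Sum>(k, K)\<in>{(k, K). k \<in> ?N \<and> K \<subseteq> ?N \<and> k \<notin> K}.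
      ?s K k * (x i k * ?A K) * ?Y (insert k K) J)"
    unfolding sum.cartesian_product by (rule sum.mono_neutral_cong_right) auto
  \<comment> \<open>Regrouped by the enlarged set, the sorting factor
    \<open>(- q) ^ card {l\<in>K. l < k}\<close> is exactly the factor needed to expand the minor of
    \<open>x\<close> along its first row.\<close>
  also have "\<dots> = (\<Sum>(K, k)\<in>(SIGMA K:Pow ?N. K). ?s K k * (x i k * ?A (K - {k})) * ?Y K J)"
  proof (rule sum.reindex_bij_witness[where j = "\<lambda>(k, K). (insert k K, k)" and i = "\<lambda>(K, k). (k, K - {k})"])
    fix a assume "a \<in> {(k, K). k \<in> ?N \<and> K \<subseteq> ?N \<and> k \<notin> K}"
    then obtain k K where a: "a = (k, K)" "k \<notin> K" by auto
    have "{l\<in>insert k K. l < k} = {l\<in>K. l < k}"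
      by auto
    then show "(case case a of (k, K) \<Rightarrow> (insert k K, k) of (K, k) \<Rightarrow> ?s K k * (x i k * ?A (K - {k})) * ?Y K J) =
      (case a of (k, K) \<Rightarrow> ?s K k * (x i k * ?A K) * ?Y (insert k K) J)"
      using a by simp
  qed auto
  also have "\<dots> = (\<Sum>K\<in>Pow ?N. \<Sum>k\<in>K. ?s K k * (x i k * ?A (K - {k})) * ?Y K J)"
    by (rule sum.Sigma[symmetric]) (auto intro: finite_subset)
  also have "\<dots> = (\<Sum>K\<in>Pow ?N. row_minor q x (i # is) K * ?Y K J)"
    by (simp add: row_op_def sum_distrib_right)
  finally show ?case .
qed

lemma row_minor_eq_0: "finite J \<Longrightarrow> card J \<noteq> length is \<Longrightarrow> row_minor q x is J = 0"
proof (induction "is" arbitrary: J)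
  case (Cons i "is")
  have "row_minor q x is (J - {j}) = 0" if "j \<in> J" for j
  proof (rule Cons.IH)
    show "card (J - {j}) \<noteq> length is"
      using Cons.prems card_Suc_Diff1[OF Cons.prems(1) that] by simp
  qed (use Cons.prems in simp)
  then show ?case
    by (simp add: row_op_def)
qed simp

fun inversions :: "nat list \<Rightarrow> nat" where
  "inversions [] = 0"
| "inversions (j # js) = card {l\<in>set js. l < j} + inversions js"

text \<open>The factor of the first column \<open>j\<close> counts the later columns below
  \<open>j\<close>, that is, the inversions starting at the first position.\<close>

lemma row_minor_permutations:
  assumes q: "central q"
  shows "finite J \<Longrightarrow> card J = length is \<Longrightarrow>
    row_minor q x is J = (\<Sum>js\<in>permutations_of_set J. (- q) ^ inversions js * prod_list (map2 x is js))"
proof (induction "is" arbitrary: J)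
  case (Cons i "is")
  have q': "central ((- q) ^ e)" for e
    by (intro central_power central_uminus q)
  have fin: "finite J" and ne: "J \<noteq> {}"
    using Cons.prems by auto
  have "(\<Sum>js\<in>permutations_of_set J. (- q) ^ inversions js * prod_list (map2 x (i # is) js)) =
    (\<Sum>j\<in>J. \<Sum>js\<in>(#) j ` permutations_of_set (J - {j}).
       (- q) ^ inversions js * prod_list (map2 x (i # is) js))"
    unfolding permutations_of_set_nonempty[OF ne]
    by (rule sum.UNION_disjoint) (use fin in auto)
  also have "\<dots> = (\<Sum>j\<in>J. (- q) ^ card {l\<in>J. l < j} * (x i j * row_minor q x is (J - {j})))"
  proof (rule sum.cong[OF refl])
    fix j assume j: "j \<in> J"
    have "(\<Sum>js\<in>(#) j ` permutations_of_set (J - {j}). (- q) ^ inversions js * prod_list (map2 x (i # is) js)) =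
      (\<Sum>js\<in>permutations_of_set (J - {j}). (- q) ^ inversions (j # js) * (x i j * prod_list (map2 x is js)))"
      by (subst sum.reindex) auto
    also have "\<dots> = (\<Sum>js\<in>permutations_of_set (J - {j}).
        (- q) ^ card {l\<in>J. l < j} * (x i j * ((- q) ^ inversions js * prod_list (map2 x is js))))"
    proof (rule sum.cong[OF refl])
      fix js assume "js \<in> permutations_of_set (J - {j})"
      then have "{l\<in>set js. l < j} = {l\<in>J. l < j}"
        using permutations_of_setD by auto
      then show "(- q) ^ inversions (j # js) * (x i j * prod_list (map2 x is js)) =
        (- q) ^ card {l\<in>J. l < j} * (x i j * ((- q) ^ inversions js * prod_list (map2 x is js)))"
        by (simp add: power_add mult.assoc central_left_commute[OF q', of "x i j"])
    qed
    also have "\<dots> = (- q) ^ card {l\<in>J. l < j} * (x i j * row_minor q x is (J - {j}))"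
      using Cons j by (simp add: sum_distrib_left)
    finally show "(\<Sum>js\<in>(#) j ` permutations_of_set (J - {j}). (- q) ^ inversions js * prod_list (map2 x (i # is) js)) =
      (- q) ^ card {l\<in>J. l < j} * (x i j * row_minor q x is (J - {j}))" .
  qed
  finally show ?case
    by (simp add: row_op_def)
qed simp

section \<open>A quantum torus\<close>

abbreviation (input) "lookup \<equiv> Poly_Mapping.lookup"
abbreviation (input) "keys \<equiv> Poly_Mapping.keys"

text \<open>
  A coordinate is \<open>((e, t), p)\<close>; only \<open>p\<close> and \<open>p + 1\<close> with the same label \<open>(e, t)\<close> fail to commute.
  The Boolean \<open>e\<close> separates the coordinates of the upper and of the lower triangular factor.
\<close>

type_synonym expo = "((bool \<times> nat) \<times> nat) \<Rightarrow>\<^sub>0 nat"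

text \<open>The form is deliberately not antisymmetric: it counts a coordinate followed by its
  successor but not the reverse, so that commuting the two costs exactly one power of
  \<open>q\<close> and no square root of \<open>q\<close> appears.\<close>

definition pairing :: "expo \<Rightarrow> expo \<Rightarrow> nat" where
  "pairing v w = (\<Sum>p\<in>keys v.
     lookup v p * lookup w (fst p, Suc (snd p)))"

lemma pairing_superset:
  assumes "finite S" "keys v \<subseteq> S"
  shows "pairing v w = (\<Sum>p\<in>S. lookup v p * lookup w (fst p, Suc (snd p)))"
  unfolding pairing_def
  by (rule sum.mono_neutral_left) (use assms in \<open>auto simp: in_keys_iff\<close>)

lemma pairing_add_left: "pairing (u + v) w = pairing u w + pairing v w"
proof -
  let ?S = "keys u \<union> keys v"
  have "keys (u + v) \<subseteq> ?S"
    by (rule Poly_Mapping.keys_add)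
  then show ?thesis
    by (subst (1 2 3) pairing_superset[of ?S])
       (auto simp: lookup_add algebra_simps sum.distrib)
qed

lemma pairing_add_right: "pairing u (v + w) = pairing u v + pairing u w"
  by (simp add: pairing_def lookup_add algebra_simps sum.distrib)

lemma pairing_zero [simp]: "pairing 0 v = 0" "pairing v 0 = 0"
  by (simp_all add: pairing_def)

text \<open>
  The Heisenberg monoid of the bilinear form: its monoid algebra is a quantum torus whose
  parameter is the central generator, so it is a ring type not depending on a value of \<open>q\<close>.
\<close>

datatype heis = Heis (hcent: int) (hexp: expo)

instantiation heis :: monoid_add
begin

definition zero_heis :: heis where
  "0 = Heis 0 0"

definition plus_heis :: "heis \<Rightarrow> heis \<Rightarrow> heis" where
  "a + b = Heis (hcent a + hcent b + int (pairing (hexp a) (hexp b))) (hexp a + hexp b)"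

instance
  by standard (simp_all add: zero_heis_def plus_heis_def pairing_add_left pairing_add_right ac_simps)

end

type_synonym 'k torus = "heis \<Rightarrow>\<^sub>0 'k"

definition heis_mon :: "int \<Rightarrow> expo \<Rightarrow> 'k::field \<Rightarrow> 'k torus" where
  "heis_mon c v a = Poly_Mapping.single (Heis c v) a"

lemma heis_mon_mult: "heis_mon c v a * heis_mon d w b = heis_mon (c + d + int (pairing v w)) (v + w) (a * b)"
  by (simp add: heis_mon_def mult_single plus_heis_def)

lemma one_heis_mon: "1 = heis_mon 0 0 1"
  by (simp add: heis_mon_def zero_heis_def flip: single_one)

lemma poly_mapping_sum_single:
  "(\<Sum>k\<in>keys f. Poly_Mapping.single k (lookup f k)) = f"
proof (rule poly_mapping_eqI)
  fix k
  show "lookup (\<Sum>k\<in>keys f. Poly_Mapping.single k (lookup f k)) k =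
    lookup f k"
    by (simp add: lookup_sum lookup_single when_def in_keys_iff)
qed

lemma central_heis_mon: "central (heis_mon c 0 a :: 'k::field torus)"
proof -
  have "Poly_Mapping.single h b * heis_mon c 0 a = heis_mon c 0 a * Poly_Mapping.single h b" for h and b :: 'k
    by (simp add: heis_mon_def mult_single plus_heis_def ac_simps)
  then have "(\<Sum>k\<in>keys f. Poly_Mapping.single k (lookup f k)) * heis_mon c 0 a =
    heis_mon c 0 a * (\<Sum>k\<in>keys f. Poly_Mapping.single k (lookup f k))" for f :: "'k torus"
    by (simp add: sum_distrib_left sum_distrib_right)
  then show ?thesis
    unfolding central_def poly_mapping_sum_single by blast
qed

abbreviation qgen :: "'k::field torus" where
  "qgen \<equiv> heis_mon 1 0 1"

abbreviation qgen_inv :: "'k::field torus" where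
  "qgen_inv \<equiv> heis_mon (- 1) 0 1"

lemma qgen_inverse: "qgen * qgen_inv = 1"
  by (simp add: heis_mon_mult one_heis_mon)

lemma minus_qgen_power: "(- qgen) ^ e = (heis_mon (int e) 0 ((- 1) ^ e) :: 'k::field torus)"
proof (induction e)
  case (Suc e)
  have "- qgen = (heis_mon 1 0 (- 1) :: 'k torus)"
    by (simp add: heis_mon_def single_uminus)
  with Suc show ?case
    by (simp add: heis_mon_mult)
qed (simp add: one_heis_mon)

definition coord :: "(bool \<times> nat) \<times> nat \<Rightarrow> 'k::field torus" where
  "coord p = heis_mon 0 (Poly_Mapping.single p 1) 1"

lemma pairing_single:
  "pairing (Poly_Mapping.single p 1) (Poly_Mapping.single p' 1) =
    (if p' = (fst p, Suc (snd p)) then 1 else 0)"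
  by (simp add: pairing_def lookup_single when_def)

lemma coord_commute:
  assumes "s \<noteq> s' \<or> (b \<noteq> Suc a \<and> a \<noteq> Suc b)"
  shows "coord (s, a) * coord (s', b) = (coord (s', b) * coord (s, a) :: 'k::field torus)"
  using assms by (auto simp: coord_def heis_mon_mult pairing_single add.commute simp del: One_nat_def)

lemma coord_q_commute:
  "coord (s, a) * coord (s, Suc a) = (qgen * (coord (s, Suc a) * coord (s, a)) :: 'k::field torus)"
  by (auto simp: coord_def heis_mon_mult pairing_single add.commute simp del: One_nat_def)

section \<open>Bidiagonal and triangular quantum matrices\<close>

definition bidiag :: "bool \<times> nat \<Rightarrow> nat \<Rightarrow> nat \<Rightarrow> 'k::field torus" where
  "bidiag s i j = (if j = i then coord (s, 2 * i) else if j = Suc i then coord (s, Suc (2 * i)) else 0)"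

text \<open>The nonzero entries form a staircase with coordinates \<open>2 * i\<close>,
  \<open>2 * i + 1\<close>, \<open>2 * i + 2\<close> and so on, which moves alternately along a row
  and down a column. Two of them share a row or a column exactly when they are neighbours.\<close>

lemma qmat_bidiag: "qmat n qgen qgen_inv (bidiag s :: nat \<Rightarrow> nat \<Rightarrow> 'k::field torus)"
  unfolding qmat_def
proof (intro ballI conjI impI)
  fix i j l m :: nat
  let ?x = "bidiag s :: nat \<Rightarrow> nat \<Rightarrow> 'k::field torus"
  have q: "coord (s, a) * coord (s, b) = (qgen * (coord (s, b) * coord (s, a)) :: 'k torus)"
    if "b = Suc a" for a b
    using that coord_q_commute by simp
  { assume "i < l"
    then show "?x i j * ?x l j = qgen * (?x l j * ?x i j)"
      by (auto simp: bidiag_def intro!: q) }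
  { assume "j < m"
    then show "?x i j * ?x i m = qgen * (?x i m * ?x i j)"
      by (auto simp: bidiag_def intro!: q) }
  { assume "i < l \<and> m < j"
    then show "?x i j * ?x l m = ?x l m * ?x i j"
      by (auto simp: bidiag_def) }
  { assume "i < l \<and> j < m"
    \<comment> \<open>A nonzero \<open>?x i m\<close> needs \<open>m \<le> Suc i\<close> and a
      nonzero \<open>?x l j\<close> needs \<open>l \<le> j\<close>, which contradicts
      \<open>i < l\<close> and \<open>j < m\<close>.\<close>
    then have "?x i m * ?x l j = 0" "?x i j * ?x l m = ?x l m * ?x i j"
      by (auto simp: bidiag_def intro!: coord_commute; presburger)+
    then show "?x i j * ?x l m = ?x l m * ?x i j + (qgen - qgen_inv) * (?x i m * ?x l j)"
      by simp }
qed

lemma qmat_identity: "qmat n q p (\<lambda>i j. if i = j then 1 else 0)"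
  unfolding qmat_def by auto

text \<open>Entry \<open>(i, b)\<close> is a sum over lattice paths from \<open>i\<close> to
  \<open>b\<close>: factor number \<open>t\<close> either rests, with an even coordinate, or moves
  up by one, with an odd coordinate. The label \<open>t\<close> makes the coordinates of different
  factors commute.\<close>

fun upper :: "nat \<Rightarrow> bool \<Rightarrow> nat \<Rightarrow> nat \<Rightarrow> nat \<Rightarrow> 'k::field torus" where
  "upper n e 0 = (\<lambda>i j. if i = j then 1 else 0)"
| "upper n e (Suc t) = mat_prod n (upper n e t) (bidiag (e, Suc t))"

lemma bidiag_commute:
  assumes "\<And>a. b * coord (s, a) = coord (s, a) * b"
  shows "b * bidiag s i j = bidiag s i j * b"
  using assms by (simp add: bidiag_def)

lemma mat_prod_commute:
  assumes "\<And>i j. b * x i j = x i j * b" "\<And>i j. b * y i j = y i j * b"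
  shows "b * mat_prod n x y i j = mat_prod n x y i j * b"
proof -
  have "b * (x i k * y k j) = (x i k * y k j) * b" for k
    using assms by (metis mult.assoc)
  then show ?thesis
    unfolding mat_prod_def sum_distrib_left sum_distrib_right by simp
qed

lemma upper_commute:
  assumes "\<And>t' a. t' \<le> t \<Longrightarrow> b * coord ((e, t'), a) = coord ((e, t'), a) * b"
  shows "b * upper n e t i j = upper n e t i j * b"
  using assms
proof (induction t arbitrary: i j)
  case (Suc t)
  show ?case
    unfolding upper.simps
    by (rule mat_prod_commute) (use Suc in \<open>auto intro: bidiag_commute\<close>)
qed simp

lemma qmat_upper: "qmat n qgen qgen_inv (upper n e t :: nat \<Rightarrow> nat \<Rightarrow> 'k::field torus)"
proof (induction t)
  case (Suc t)
  have "upper n e t i j * bidiag (e, Suc t) k l = (bidiag (e, Suc t) k l * upper n e t i j :: 'k torus)"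
    for i j k l
    by (intro bidiag_commute upper_commute[symmetric] coord_commute) simp
  then show ?case
    unfolding upper.simps
    by (intro qmat_mat_prod central_heis_mon qgen_inverse Suc qmat_bidiag)
qed (simp add: qmat_identity)

abbreviation lower :: "nat \<Rightarrow> nat \<Rightarrow> nat \<Rightarrow> 'k::field torus" where
  "lower n \<equiv> \<lambda>i j. upper n True n j i"

abbreviation full :: "nat \<Rightarrow> nat \<Rightarrow> nat \<Rightarrow> 'k::field torus" where
  "full n \<equiv> mat_prod n (upper n False n) (lower n)"

lemma upper_lower_commute:
  "upper n False t i j * upper n True t' k l = (upper n True t' k l * upper n False t i j :: 'k::field torus)"
  by (intro upper_commute upper_commute[symmetric] coord_commute) simp

lemma qmat_full: "qmat n qgen qgen_inv (full n :: nat \<Rightarrow> nat \<Rightarrow> 'k::field torus)"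
  by (intro qmat_mat_prod central_heis_mon qgen_inverse qmat_upper qmat_transpose upper_lower_commute)

section \<open>Leading exponents\<close>

text \<open>
  With this weight the heaviest term of the entry \<open>(i, b)\<close> of \<open>upper\<close> takes its steps as early as
  possible and has weight \<open>i * (b - i)\<close>: up to a function of \<open>i\<close> this is \<open>i * b\<close>, to which the
  rearrangement inequality applies.
\<close>

definition coord_weight :: "(bool \<times> nat) \<times> nat \<Rightarrow> int" where
  "coord_weight p = (if odd (snd p) then int (snd p div 2) + 1 - int (snd (fst p)) else 0)"

definition weight :: "expo \<Rightarrow> int" where
  "weight v = (\<Sum>p\<in>keys v. int (lookup v p) * coord_weight p)"

lemma weight_superset:
  assumes "finite S" "keys v \<subseteq> S"
  shows "weight v = (\<Sum>p\<in>S. int (lookup v p) * coord_weight p)"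
  unfolding weight_def
  by (rule sum.mono_neutral_left) (use assms in \<open>auto simp: in_keys_iff\<close>)

lemma weight_zero [simp]: "weight 0 = 0"
  by (simp add: weight_def)

lemma weight_add: "weight (u + v) = weight u + weight v"
proof -
  let ?S = "keys u \<union> keys v"
  have "keys (u + v) \<subseteq> ?S"
    by (rule Poly_Mapping.keys_add)
  then show ?thesis
    by (subst (1 2 3) weight_superset[of ?S])
       (auto simp: lookup_add algebra_simps sum.distrib)
qed

lemma weight_single: "weight (Poly_Mapping.single p 1) = coord_weight p"
  by (simp add: weight_def)

definition below :: "int \<Rightarrow> 'k::field torus \<Rightarrow> bool" where
  "below a f \<longleftrightarrow> (\<forall>h\<in>keys f. weight (hexp h) \<le> a)"

lemma below_zero [simp]: "below a 0"
  by (simp add: below_def)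

lemma below_mono: "below a f \<Longrightarrow> a \<le> b \<Longrightarrow> below b f"
  unfolding below_def by fastforce

lemma below_add: "below a f \<Longrightarrow> below a g \<Longrightarrow> below a (f + g)"
  unfolding below_def using Poly_Mapping.keys_add[of f g] by blast

lemma below_sum: "(\<And>k. k \<in> A \<Longrightarrow> below a (f k)) \<Longrightarrow> below a (sum f A)"
  by (induction A rule: infinite_finite_induct) (auto intro: below_add)

lemma below_mult: "below a f \<Longrightarrow> below b g \<Longrightarrow> below (a + b) (f * g)"
  unfolding below_def using keys_mult[of f g]
  by (fastforce simp: plus_heis_def weight_add)

lemma below_heis_mon: "below (weight v) (heis_mon c v a)"
  by (simp add: below_def heis_mon_def)

text \<open>The top weight is attained by one monomial with one power of the formal variable. Its
  coefficient therefore stays nonzero when the variable gets any nonzero value.\<close>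

definition leads :: "expo \<Rightarrow> 'k::field torus \<Rightarrow> bool" where
  "leads v f \<longleftrightarrow> (\<exists>c a g. a \<noteq> 0 \<and> below (weight v - 1) g \<and> f = heis_mon c v a + g)"

lemma leads_heis_mon: "a \<noteq> 0 \<Longrightarrow> leads v (heis_mon c v a)"
  unfolding leads_def by (intro exI[of _ c] exI[of _ a] exI[of _ 0]) simp

lemma leads_below: "leads v f \<Longrightarrow> below (weight v) f"
  unfolding leads_def using below_add[OF below_heis_mon below_mono] by fastforce

lemma leads_mult:
  assumes "leads v f" "leads w g"
  shows "leads (v + w) (f * g)"
proof -
  obtain c a f' where f: "a \<noteq> 0" "below (weight v - 1) f'" "f = heis_mon c v a + f'"
    using assms(1) unfolding leads_def by blast
  obtain d b g' where g: "b \<noteq> 0" "below (weight w - 1) g'" "g = heis_mon d w b + g'"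
    using assms(2) unfolding leads_def by blast
  have "below (weight v - 1 + weight w) (f' * g)"
    by (intro below_mult f leads_below assms)
  moreover have "below (weight v + (weight w - 1)) (heis_mon c v a * g')"
    by (intro below_mult g below_heis_mon)
  ultimately have "below (weight (v + w) - 1) (f' * g + heis_mon c v a * g')"
    by (intro below_add) (auto simp: weight_add algebra_simps)
  moreover have "f * g = heis_mon (c + d + int (pairing v w)) (v + w) (a * b) + (f' * g + heis_mon c v a * g')"
    unfolding heis_mon_mult[symmetric] unfolding f(3) g(3) by (simp add: algebra_simps)
  moreover have "a * b \<noteq> 0"
    using f(1) g(1) by simp
  ultimately show ?thesis
    unfolding leads_def by blast
qed

lemma leads_add: "leads v f \<Longrightarrow> below (weight v - 1) g \<Longrightarrow> leads v (f + g)"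
  unfolding leads_def by (metis add.assoc below_add)

lemma leads_sum:
  assumes "finite A" "k \<in> A" "leads v (f k)"
    and "\<And>j. j \<in> A \<Longrightarrow> j \<noteq> k \<Longrightarrow> below (weight v - 1) (f j)"
  shows "leads v (sum f A)"
  using assms by (subst sum.remove[of A k]) (auto intro!: leads_add below_sum)

lemma leads_unit: "leads 0 ((- qgen) ^ e :: 'k::field torus)"
  unfolding minus_qgen_power by (rule leads_heis_mon) simp

text \<open>The path of the heaviest term: all \<open>b - i\<close> steps at the times 1 to
  \<open>b - i\<close>, then rest at \<open>b\<close>. The recursion removes the last factor, which
  is a step only if \<open>t\<close> factors are too few to reach \<open>b\<close>.\<close>

fun path :: "bool \<Rightarrow> nat \<Rightarrow> nat \<Rightarrow> nat \<Rightarrow> expo" where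
  "path e 0 i b = 0"
| "path e (Suc t) i b = (if b \<le> i + t
     then path e t i b + Poly_Mapping.single ((e, Suc t), 2 * b) 1
     else path e t i (b - 1) + Poly_Mapping.single ((e, Suc t), Suc (2 * (b - 1))) 1)"

lemma leads_coord: "leads (Poly_Mapping.single p 1) (coord p)"
  unfolding coord_def by (rule leads_heis_mon) simp

lemma upper_Suc:
  assumes "b \<in> {1..n}"
  shows "upper n e (Suc t) i b = upper n e t i b * coord ((e, Suc t), 2 * b) +
    (if b = 1 then 0 else upper n e t i (b - 1) * coord ((e, Suc t), Suc (2 * (b - 1))))"
proof -
  have "upper n e (Suc t) i b = (\<Sum>k\<in>{1..n}.
      (if k = b then upper n e t i b * coord ((e, Suc t), 2 * b) else 0) +
      (if k = b - 1 then upper n e t i (b - 1) * coord ((e, Suc t), Suc (2 * (b - 1))) else 0))"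
    unfolding upper.simps mat_prod_def
    by (rule sum.cong[OF refl]) (use assms in \<open>auto simp: bidiag_def\<close>)
  also have "\<dots> = upper n e t i b * coord ((e, Suc t), 2 * b) +
    (if b = 1 then 0 else upper n e t i (b - 1) * coord ((e, Suc t), Suc (2 * (b - 1))))"
    unfolding sum.distrib using assms by (auto simp: sum.delta)
  finally show ?thesis .
qed

lemma upper_eq_0:
  "i \<in> {1..n} \<Longrightarrow> b \<in> {1..n} \<Longrightarrow> b < i \<or> i + t < b \<Longrightarrow> upper n e t i b = (0 :: 'k::field torus)"
proof (induction t arbitrary: b)
  case (Suc t)
  have "upper n e t i b = (0 :: 'k torus)"
    using Suc.prems by (intro Suc.IH) auto
  moreover have "upper n e t i (b - 1) = (0 :: 'k torus)" if "b \<noteq> 1"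
    using Suc.prems that by (intro Suc.IH) auto
  ultimately show ?case
    unfolding upper_Suc[OF Suc.prems(2)] by simp
qed auto

text \<open>The step into \<open>b\<close> at time \<open>t\<close> weighs \<open>b - t\<close>,
  which is \<open>i\<close> for every step of the earliest path. Stepping at time
  \<open>Suc t\<close> although \<open>b \<le> i + t\<close> loses \<open>i + t + 1 - b\<close>,
  which is at least 1.\<close>

lemma upper_leads:
  "i \<in> {1..n} \<Longrightarrow> b \<in> {1..n} \<Longrightarrow> i \<le> b \<Longrightarrow> b \<le> i + t \<Longrightarrow>
    leads (path e t i b) (upper n e t i b :: 'k::field torus) \<and>
    weight (path e t i b) = int i * (int b - int i)"
proof (induction t arbitrary: b)
  case 0
  then show ?case
    by (simp add: one_heis_mon leads_heis_mon)
next
  case (Suc t)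
  let ?c = "coord ((e, Suc t), 2 * b) :: 'k torus"
  let ?d = "coord ((e, Suc t), Suc (2 * (b - 1))) :: 'k torus"
  have cw: "coord_weight ((e, Suc t), 2 * b) = 0"
    "coord_weight ((e, Suc t), Suc (2 * (b - 1))) = int b - int (Suc t)"
    using Suc.prems by (auto simp: coord_weight_def)
  have U: "upper n e (Suc t) i b = upper n e t i b * ?c + (if b = 1 then 0 else upper n e t i (b - 1) * ?d)"
    by (rule upper_Suc[OF Suc.prems(2)])
  show ?case
  proof (cases "b \<le> i + t")
    case True
    note IH = Suc.IH[OF Suc.prems(1-3) True]
    let ?w = "path e (Suc t) i b"
    have w: "weight ?w = int i * (int b - int i)"
      using IH True cw by (simp add: weight_add weight_single del: One_nat_def)
    have "leads ?w (upper n e t i b * ?c)"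
      using leads_mult[OF conjunct1[OF IH] leads_coord] True by simp
    moreover have "below (weight ?w - 1) (if b = 1 then 0 else upper n e t i (b - 1) * ?d)"
    proof (cases "i \<le> b - 1 \<and> b \<noteq> 1")
      case True
      then have "below (int i * (int (b - 1) - int i)) (upper n e t i (b - 1) :: 'k torus)"
        using Suc.IH[of "b - 1"] Suc.prems \<open>b \<le> i + t\<close> leads_below by fastforce
      moreover have "below (int b - int (Suc t)) ?d"
        using leads_below[OF leads_coord, of "((e, Suc t), Suc (2 * (b - 1)))"] cw
        by (simp only: weight_single)
      ultimately have "below (int i * (int (b - 1) - int i) + (int b - int (Suc t))) (upper n e t i (b - 1) * ?d)"
        by (rule below_mult)
      moreover have "int i * (int (b - 1) - int i) + (int b - int (Suc t)) \<le> weight ?w - 1"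
        using Suc.prems \<open>b \<le> i + t\<close> unfolding w by (simp add: of_nat_diff algebra_simps)
      ultimately show ?thesis
        using True by (simp add: below_mono)
    next
      case False
      then have "b \<noteq> 1 \<Longrightarrow> upper n e t i (b - 1) = (0 :: 'k torus)"
        using Suc.prems by (intro upper_eq_0) auto
      then show ?thesis
        by auto
    qed
    ultimately show ?thesis
      unfolding U using w leads_add by blast
  next
    case False
    then have b: "b = i + t + 1" "b \<noteq> 1"
      using Suc.prems by auto
    have "upper n e t i b = (0 :: 'k torus)"
      using False Suc.prems by (intro upper_eq_0) auto
    then have "upper n e (Suc t) i b = upper n e t i (b - 1) * ?d"
      unfolding U using b(2) by simp
    moreover have IH: "leads (path e t i (b - 1)) (upper n e t i (b - 1) :: 'k torus) \<and>
        weight (path e t i (b - 1)) = int i * (int (b - 1) - int i)"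
      using Suc.prems b by (intro Suc.IH) auto
    moreover have "path e (Suc t) i b = path e t i (b - 1) + Poly_Mapping.single ((e, Suc t), Suc (2 * (b - 1))) 1"
      using False by simp
    moreover have "leads (path e (Suc t) i b) (upper n e t i (b - 1) * ?d)"
      unfolding calculation(3) by (rule leads_mult[OF conjunct1[OF IH] leads_coord])
    moreover have "weight (path e (Suc t) i b) = int i * (int b - int i)"
      unfolding calculation(3) weight_add weight_single cw using IH b by (simp add: algebra_simps)
    ultimately show ?thesis
      by simp
  qed
qed

section \<open>Leading exponents of quantum minors\<close>

definition dot :: "nat list \<Rightarrow> nat list \<Rightarrow> nat" where
  "dot xs ys = (\<Sum>(x, y)\<leftarrow>zip xs ys. x * y)"

lemma dot_simps [simp]: "dot [] ys = 0" "dot (x # xs) (y # ys) = x * y + dot xs ys"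
  by (simp_all add: dot_def)

text \<open>The two-term rearrangement inequality, which governs both the leading terms of minors
  and the descent when letters of a word are exchanged.\<close>

lemma rearrangement_aux:
  fixes i j :: nat
  assumes "i < i'" "j0 < j"
  shows "i * j + i' * j0 < i * j0 + i' * j"
proof -
  obtain d e where "i' = i + Suc d" "j = j0 + Suc e"
    using assms less_iff_Suc_add by auto
  then show ?thesis
    by (simp add: algebra_simps)
qed

text \<open>Exchanging \<open>j\<close> with the head \<open>j0\<close> in the first two places
  strictly lowers the sum, and by induction bringing \<open>j\<close> to the front of the remaining
  list does not raise it.\<close>

lemma dot_remove_less:
  "sorted_wrt (<) (i # is) \<Longrightarrow> sorted_wrt (<) js \<Longrightarrow> length js = Suc (length is) \<Longrightarrow>
    j \<in> set js \<Longrightarrow> j \<noteq> hd js \<Longrightarrow> dot (i # is) (j # remove1 j js) < dot (i # is) js"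
proof (induction js arbitrary: i "is")
  case (Cons j0 js)
  then have j: "j \<in> set js" "j0 < j"
    by auto
  with Cons.prems obtain i' is' where is': "is = i' # is'"
    by (cases "is") auto
  obtain j1 js' where js': "js = j1 # js'"
    using j by (cases js) auto
  have "dot (i' # is') (j # remove1 j js) \<le> dot (i' # is') js"
  proof (cases "j = j1")
    case False
    then show ?thesis
      using Cons.IH[of i' is'] Cons.prems is' j js' by (auto intro: less_imp_le)
  qed (simp add: js')
  moreover have "i * j + i' * j0 < i * j0 + i' * j"
    using Cons.prems(1) is' j by (intro rearrangement_aux) auto
  ultimately show ?case
    using j by (simp add: is')
qed simp

text \<open>The corrections \<open>f\<close> and \<open>g\<close> depend on rows and columns alone,
  so they are equal in all terms of a minor and only the products \<open>i * j\<close> compete. Term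
  \<open>j\<close> of the row expansion pairs \<open>i\<close> with \<open>j\<close>, which is
  strictly lighter unless \<open>j\<close> is the smallest column. Leading exponents are required
  only along the order-preserving matching, because other entries may vanish.\<close>

lemma row_minor_leads:
  fixes x :: "nat \<Rightarrow> nat \<Rightarrow> 'k::field torus" and f g :: "nat \<Rightarrow> int"
  assumes "\<And>i j. i \<in> set is \<Longrightarrow> j \<in> J \<Longrightarrow> below (int i * int j - f i - g j) (x i j)"
    and "sorted_wrt (<) is" "finite J" "card J = length is"
  defines "w \<equiv> \<lambda>is J. int (dot is (sorted_list_of_set J)) - (\<Sum>i\<leftarrow>is. f i) - (\<Sum>j\<in>J. g j)"
  shows "below (w is J) (row_minor qgen x is J) \<and>
    ((\<forall>(i, j)\<in>set (zip is (sorted_list_of_set J)).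
        leads (E i j) (x i j) \<and> weight (E i j) = int i * int j - f i - g j) \<longrightarrow>
      leads (\<Sum>(i, j)\<leftarrow>zip is (sorted_list_of_set J). E i j) (row_minor qgen x is J) \<and>
      weight (\<Sum>(i, j)\<leftarrow>zip is (sorted_list_of_set J). E i j) = w is J)"
  using assms(1-4)
proof (induction "is" arbitrary: J)
  case Nil
  then have "row_minor qgen x [] J = heis_mon 0 0 1"
    by (simp add: one_heis_mon)
  then show ?case
    using Nil below_heis_mon[of 0] leads_heis_mon[of "1 :: 'k" 0 0] by (simp add: w_def del: row_minor.simps)
next
  case (Cons i "is")
  let ?js = "sorted_list_of_set J"
  let ?M = "\<lambda>j. row_minor qgen x is (J - {j})"
  let ?T = "\<lambda>j. (- qgen) ^ card {l\<in>J. l < j} * (x i j * ?M j)"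
  have js: "set ?js = J" "length ?js = Suc (length is)" "sorted_wrt (<) ?js"
    using Cons.prems by auto
  then obtain j0 js' where j0: "?js = j0 # js'"
    by (cases ?js) auto
  then have "j0 \<in> J"
    using js(1) by auto
  have remove: "sorted_list_of_set (J - {j}) = remove1 j ?js" for j
    using Cons.prems(3) by (rule sorted_list_of_set_remove)
  have unit: "below 0 ((- qgen) ^ e :: 'k torus)" for e
    using leads_below[OF leads_unit] by simp
  have IH: "below (w is (J - {j})) (?M j) \<and>
    ((\<forall>(i, j)\<in>set (zip is (sorted_list_of_set (J - {j}))).
        leads (E i j) (x i j) \<and> weight (E i j) = int i * int j - f i - g j) \<longrightarrow>
      leads (\<Sum>(i, j)\<leftarrow>zip is (sorted_list_of_set (J - {j})). E i j) (?M j) \<and>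
      weight (\<Sum>(i, j)\<leftarrow>zip is (sorted_list_of_set (J - {j})). E i j) = w is (J - {j}))"
    if "j \<in> J" for j
  proof (rule Cons.IH)
    show "card (J - {j}) = length is"
      using Cons.prems(3,4) that by simp
  qed (use Cons.prems in auto)
  have w_Cons: "int i * int j - f i - g j + w is (J - {j}) =
      int (dot (i # is) (j # remove1 j ?js)) - (\<Sum>i\<leftarrow>i # is. f i) - (\<Sum>j\<in>J. g j)" if "j \<in> J" for j
    using sum.remove[OF Cons.prems(3) that, of g] by (simp add: w_def remove)
  have below: "below (int (dot (i # is) (j # remove1 j ?js)) - (\<Sum>i\<leftarrow>i # is. f i) - (\<Sum>j\<in>J. g j)) (?T j)"
    if "j \<in> J" for j
  proof -
    have "below (0 + (int i * int j - f i - g j + w is (J - {j}))) (?T j)"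
      using IH[OF that] Cons.prems(1)[of i j] that by (intro below_mult unit) auto
    then show ?thesis
      unfolding w_Cons[OF that] by simp
  qed
  have less: "dot (i # is) (j # remove1 j ?js) < dot (i # is) ?js" if "j \<in> J" "j \<noteq> j0" for j
    by (rule dot_remove_less) (use Cons.prems js that j0 in auto)
  have head: "dot (i # is) (j0 # remove1 j0 ?js) = dot (i # is) ?js"
    by (simp add: j0)
  have eq: "row_minor qgen x (i # is) J = sum ?T J"
    by (simp add: row_op_def)
  have "below (w (i # is) J) (sum ?T J)"
  proof (rule below_sum)
    fix j assume "j \<in> J"
    then have "dot (i # is) (j # remove1 j ?js) \<le> dot (i # is) ?js"
      using less[of j] head by (cases "j = j0") (auto simp del: dot_simps)
    then show "below (w (i # is) J) (?T j)"
      by (intro below_mono[OF below[OF \<open>j \<in> J\<close>]]) (simp add: w_def del: dot_simps)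
  qed
  moreover have "leads (\<Sum>(i, j)\<leftarrow>zip (i # is) ?js. E i j) (sum ?T J) \<and>
      weight (\<Sum>(i, j)\<leftarrow>zip (i # is) ?js. E i j) = w (i # is) J"
    if E: "\<forall>(i, j)\<in>set (zip (i # is) ?js). leads (E i j) (x i j) \<and> weight (E i j) = int i * int j - f i - g j"
  proof -
    let ?e = "\<Sum>(i, j)\<leftarrow>zip is (remove1 j0 ?js). E i j"
    have sum: "(\<Sum>(i, j)\<leftarrow>zip (i # is) ?js. E i j) = E i j0 + ?e"
      by (simp add: j0)
    have E0: "leads (E i j0) (x i j0)" "weight (E i j0) = int i * int j0 - f i - g j0"
      using E by (auto simp: j0)
    have M: "leads ?e (?M j0)" "weight ?e = w is (J - {j0})"
      using IH[OF \<open>j0 \<in> J\<close>] E unfolding remove by (auto simp: j0)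
    have weight: "weight (E i j0 + ?e) = w (i # is) J"
      unfolding weight_add E0 M w_Cons[OF \<open>j0 \<in> J\<close>] head
      unfolding w_def ..
    have "leads (0 + (E i j0 + ?e)) (?T j0)"
      by (intro leads_mult leads_unit E0 M)
    then have "leads (E i j0 + ?e) (sum ?T J)"
    proof (intro leads_sum[OF Cons.prems(3) \<open>j0 \<in> J\<close>])
      fix j assume j: "j \<in> J" "j \<noteq> j0"
      show "below (weight (E i j0 + ?e) - 1) (?T j)"
        unfolding weight using less[OF j] by (intro below_mono[OF below[OF j(1)]]) (simp add: w_def del: dot_simps)
    qed simp
    then show ?thesis
      unfolding sum using weight by blast
  qed
  ultimately show ?case
    unfolding eq by blast
qed

lemma sorted_nth_gap:
  fixes xs :: "nat list"
  assumes "sorted_wrt (<) xs"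
  shows "b < length xs \<Longrightarrow> a \<le> b \<Longrightarrow> xs ! a + (b - a) \<le> xs ! b"
proof (induction b)
  case (Suc b)
  show ?case
  proof (cases "a = Suc b")
    case False
    then have "xs ! a + (b - a) \<le> xs ! b"
      using Suc by auto
    moreover have "xs ! b < xs ! Suc b"
      using assms Suc.prems(1) by (simp add: sorted_wrt_nth_less)
    ultimately show ?thesis
      using Suc.prems False by auto
  qed simp
qed simp

text \<open>Counting back from the last element, which is at most \<open>n\<close>, a strictly
  increasing list loses at least one per place; the list of the largest indices loses exactly
  one.\<close>

lemma sorted_nth_le_top:
  assumes "sorted_wrt (<) xs" "set xs \<subseteq> {1..n}" "a < length xs"
  shows "xs ! a \<le> [n + 1 - length xs..<n + 1] ! a" "length xs \<le> n"
proof -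
  have last: "xs ! (length xs - 1) \<le> n"
    using subsetD[OF assms(2) nth_mem[of "length xs - 1" xs]] assms(3) by simp
  have gap: "xs ! b + (length xs - 1 - b) \<le> n" if "b < length xs" for b
  proof -
    have "xs ! b + (length xs - 1 - b) \<le> xs ! (length xs - 1)"
      by (rule sorted_nth_gap[OF assms(1)]) (use that in auto)
    with last show ?thesis
      by linarith
  qed
  moreover have "1 \<le> xs ! 0"
    using subsetD[OF assms(2) nth_mem[of 0 xs]] assms(3) by (cases xs) auto
  ultimately show "length xs \<le> n"
    using assms(3) by (cases xs) fastforce+
  then show "xs ! a \<le> [n + 1 - length xs..<n + 1] ! a"
    using gap[OF assms(3)] assms(3) by (simp del: upt_Suc)
qed

lemma dot_mono:
  "length ys = length zs \<Longrightarrow> length xs = length ys \<Longrightarrow> (\<And>a. a < length ys \<Longrightarrow> ys ! a \<le> zs ! a) \<Longrightarrow>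
    dot xs ys \<le> dot xs zs \<and> ((\<forall>x\<in>set xs. 0 < x) \<longrightarrow> ys \<noteq> zs \<longrightarrow> dot xs ys < dot xs zs)"
proof (induction ys zs arbitrary: xs rule: list_induct2)
  case (Cons y ys z zs)
  obtain x xs' where xs: "xs = x # xs'"
    using Cons.prems by (cases xs) auto
  have le: "y \<le> z"
    using Cons.prems(2)[of 0] by simp
  have IH: "dot xs' ys \<le> dot xs' zs \<and> ((\<forall>x\<in>set xs'. 0 < x) \<longrightarrow> ys \<noteq> zs \<longrightarrow> dot xs' ys < dot xs' zs)"
    using Cons.prems(1) Cons.prems(2)[of "Suc _"] by (intro Cons.IH) (auto simp: xs)
  have "x * y \<le> x * z"
    using le by simp
  moreover have "x * y < x * z" if "0 < x" "y \<noteq> z"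
    using le that by simp
  ultimately show ?case
    using IH by (auto simp: xs intro: add_mono add_le_less_mono add_less_le_mono)
qed simp

lemma dot_commute: "dot xs ys = dot ys xs"
proof (induction xs arbitrary: ys)
  case (Cons x xs)
  then show ?case
    by (cases ys) (auto simp: dot_def)
qed (simp add: dot_def)

definition row_exponent :: "bool \<Rightarrow> nat \<Rightarrow> nat list \<Rightarrow> expo" where
  "row_exponent e n r = (\<Sum>c<length r. path e n (r ! c) (n - c))"

lemma row_exponent_zip:
  assumes "length r \<le> n"
  shows "(\<Sum>(i, k)\<leftarrow>zip (rev r) [n + 1 - length r..<n + 1]. path e n i k) = row_exponent e n r"
proof -
  let ?k = "[n + 1 - length r..<n + 1]"
  have "zip (rev r) ?k = rev (zip r (rev ?k))"
    using assms by (simp add: zip_rev[symmetric])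
  then have "(\<Sum>(i, k)\<leftarrow>zip (rev r) ?k. path e n i k) = (\<Sum>(i, k)\<leftarrow>zip r (rev ?k). path e n i k)"
    by (simp only: rev_map[symmetric] sum_list_rev)
  also have "\<dots> = (\<Sum>c<length r. path e n (r ! c) (rev ?k ! c))"
    using assms by (subst sum_list_sum_nth) (auto simp: atLeast0LessThan simp del: upt_Suc intro!: sum.cong)
  also have "\<dots> = row_exponent e n r"
    unfolding row_exponent_def using assms
    by (intro sum.cong refl) (auto simp: rev_nth simp del: upt_Suc)
  finally show ?thesis .
qed

lemma upper_below:
  assumes "i \<in> {1..n}" "b \<in> {1..n}"
  shows "below (int i * int b - int i * int i - 0) (upper n e n i b :: 'k::field torus)"
proof (cases "i \<le> b")
  case True
  have "leads (path e n i b) (upper n e n i b :: 'k torus)"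
    and weight: "weight (path e n i b) = int i * (int b - int i)"
    using upper_leads[OF assms True, of n e, where ?'k = 'k] assms by auto
  from leads_below[OF this(1)] show ?thesis
    unfolding weight by (simp add: algebra_simps)
next
  case False
  then show ?thesis
    using upper_eq_0[OF assms, of n e, where ?'k = 'k] by simp
qed

text \<open>The squares \<open>i * i\<close> and \<open>j * j\<close> in the weights do not depend
  on \<open>K\<close>, so the terms of the Cauchy-Binet sum compete through
  \<open>dot ?I K + dot K ?J\<close>. Both summands are monotone in \<open>K\<close>, the first
  strictly because the row indices are positive, so the set of largest indices wins alone.\<close>

theorem full_minor_leads:
  assumes r: "sorted_wrt (>) r" "set r \<subseteq> {1..n}" and r': "sorted_wrt (>) r'" "set r' \<subseteq> {1..n}"
    and len: "length r = length r'"
  shows "leads (row_exponent False n r + row_exponent True n r')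
    (row_minor qgen (full n) (rev r) (set r') :: 'k::field torus)"
proof -
  define s where "s = length r"
  let ?I = "rev r" and ?J = "set r'"
  let ?top = "[n + 1 - s..<n + 1]"
  let ?P = "\<lambda>K. row_minor qgen (upper n False n) ?I K :: 'k torus"
  let ?Q = "\<lambda>K. row_minor qgen (lower n) (sorted_list_of_set K) ?J :: 'k torus"
  have I: "sorted_wrt (<) ?I" "set ?I \<subseteq> {1..n}" "length ?I = s"
    using r by (auto simp: sorted_wrt_rev s_def)
  have I': "sorted_wrt (<) (rev r')" "set (rev r') \<subseteq> {1..n}" "length (rev r') = s"
    using r' len by (auto simp: sorted_wrt_rev s_def)
  have J: "sorted_list_of_set ?J = rev r'"
    using I'(1) sorted_list_of_set.idem_if_sorted_distinct[of "rev r'"]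
    by (auto simp: strict_sorted_iff)
  have cardJ: "card ?J = s"
    using I' J by (metis length_sorted_list_of_set)
  have "s \<le> n"
    using sorted_nth_le_top(2)[OF I(1,2), of 0] I(3) by (cases "s = 0") auto
  then have top: "sorted_wrt (<) ?top" "length ?top = s" "set ?top \<subseteq> {1..n}"
    by (auto simp del: upt_Suc)
  have K0: "sorted_list_of_set (set ?top) = ?top"
    by (rule sorted_list_of_set.idem_if_sorted_distinct) (auto simp del: upt_Suc)
  have cardK0: "card (set ?top) = s"
    using top(2) distinct_card[OF distinct_upt] by metis
  have P: "below (int (dot ?I (sorted_list_of_set K)) - (\<Sum>i\<leftarrow>?I. int i * int i) - (\<Sum>j\<in>K. 0)) (?P K) \<and>
    ((\<forall>(i, k)\<in>set (zip ?I (sorted_list_of_set K)).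
        leads (path False n i k) (upper n False n i k :: 'k torus) \<and>
        weight (path False n i k) = int i * int k - int i * int i - 0) \<longrightarrow>
      leads (\<Sum>(i, k)\<leftarrow>zip ?I (sorted_list_of_set K). path False n i k) (?P K) \<and>
      weight (\<Sum>(i, k)\<leftarrow>zip ?I (sorted_list_of_set K). path False n i k) =
        int (dot ?I (sorted_list_of_set K)) - (\<Sum>i\<leftarrow>?I. int i * int i) - (\<Sum>j\<in>K. 0))"
    if "K \<subseteq> {1..n}" "card K = s" for K
  proof (rule row_minor_leads)
    fix i j assume "i \<in> set ?I" "j \<in> K"
    then show "below (int i * int j - int i * int i - 0) (upper n False n i j :: 'k torus)"
      using I(2) that by (intro upper_below) auto
  qed (use that I finite_subset in auto)
  have Q: "below (int (dot (sorted_list_of_set K) (sorted_list_of_set ?J)) -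
      (\<Sum>k\<leftarrow>sorted_list_of_set K. 0) - (\<Sum>j\<in>?J. int j * int j)) (?Q K) \<and>
    ((\<forall>(k, j)\<in>set (zip (sorted_list_of_set K) (sorted_list_of_set ?J)).
        leads (path True n j k) (lower n k j :: 'k torus) \<and>
        weight (path True n j k) = int k * int j - 0 - int j * int j) \<longrightarrow>
      leads (\<Sum>(k, j)\<leftarrow>zip (sorted_list_of_set K) (sorted_list_of_set ?J). path True n j k) (?Q K) \<and>
      weight (\<Sum>(k, j)\<leftarrow>zip (sorted_list_of_set K) (sorted_list_of_set ?J). path True n j k) =
        int (dot (sorted_list_of_set K) (sorted_list_of_set ?J)) -
        (\<Sum>k\<leftarrow>sorted_list_of_set K. 0) - (\<Sum>j\<in>?J. int j * int j))"
    if "K \<subseteq> {1..n}" "card K = s" for K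
  proof (rule row_minor_leads)
    have fin: "finite K"
      using that finite_subset by blast
    fix k j assume "k \<in> set (sorted_list_of_set K)" "j \<in> ?J"
    then have "j \<in> {1..n}" "k \<in> {1..n}"
      using that r' fin by auto
    from upper_below[OF this, of True, where ?'k = 'k]
    show "below (int k * int j - 0 - int j * int j) (lower n k j :: 'k torus)"
      by (simp add: mult.commute)
  qed (use that cardJ in auto)
  let ?w = "int (dot ?I ?top) - (\<Sum>i\<leftarrow>?I. int i * int i) + (int (dot ?top (rev r')) - (\<Sum>j\<in>?J. int j * int j))"
  have path_leads: "leads (path e n i k) (upper n e n i k :: 'k torus) \<and>
      weight (path e n i k) = int i * int k - int i * int i"
    if "(i, k) \<in> set (zip xs ?top)" "sorted_wrt (<) xs" "set xs \<subseteq> {1..n}" "length xs = s" for xs i k e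
  proof -
    from that obtain a where a: "a < s" "i = xs ! a" "k = ?top ! a"
      by (auto simp: in_set_zip simp del: upt_Suc)
    have "i \<in> {1..n}"
      unfolding a(2) by (rule subsetD[OF that(3) nth_mem]) (use a that(4) in simp)
    moreover have "k \<in> {1..n}"
      unfolding a(3) by (rule subsetD[OF top(3) nth_mem]) (use a top(2) in simp)
    \<comment> \<open>Only entries on or above the diagonal have a leading exponent; the matching
      with the largest indices never goes below it.\<close>
    moreover have "i \<le> k"
      using sorted_nth_le_top(1)[OF that(2,3), of a] that(4) a by (simp del: upt_Suc)
    ultimately show ?thesis
      using upper_leads[of i n k n e, where ?'k = 'k] by (auto simp: algebra_simps)
  qed
  have P0: "leads (row_exponent False n r) (?P (set ?top))"
    "weight (row_exponent False n r) = int (dot ?I ?top) - (\<Sum>i\<leftarrow>?I. int i * int i)"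
    using P[OF top(3) cardK0] path_leads[OF _ I, of _ _ False]
      row_exponent_zip[of r n False] \<open>s \<le> n\<close> unfolding K0 s_def[symmetric] by auto
  have swap: "(\<Sum>(k, j)\<leftarrow>zip ?top (rev r'). path True n j k) = row_exponent True n r'"
  proof -
    have "(\<Sum>(k, j)\<leftarrow>zip ?top (rev r'). path True n j k) = (\<Sum>(j, k)\<leftarrow>zip (rev r') ?top. path True n j k)"
      by (subst zip_commute) (simp add: comp_def case_prod_unfold del: upt_Suc)
    then show ?thesis
      using row_exponent_zip[of r' n True] \<open>s \<le> n\<close> len by (simp only: s_def)
  qed
  have Q0: "leads (row_exponent True n r') (?Q (set ?top))"
    "weight (row_exponent True n r') = int (dot ?top (rev r')) - (\<Sum>j\<in>?J. int j * int j)"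
  proof -
    have "leads (path True n j k) (lower n k j :: 'k torus) \<and>
        weight (path True n j k) = int k * int j - 0 - int j * int j"
      if "(k, j) \<in> set (zip ?top (rev r'))" for k j
    proof -
      have "(j, k) \<in> set (zip (rev r') ?top)"
        using that by (auto simp: in_set_zip simp del: upt_Suc)
      from path_leads[OF this I', of True] show ?thesis
        by (simp add: mult.commute)
    qed
    then show "leads (row_exponent True n r') (?Q (set ?top))"
      "weight (row_exponent True n r') = int (dot ?top (rev r')) - (\<Sum>j\<in>?J. int j * int j)"
      using Q[OF top(3) cardK0] unfolding K0 J swap by auto
  qed
  have "leads (row_exponent False n r + row_exponent True n r') (\<Sum>K\<in>Pow {1..n}. ?P K * ?Q K)"
  proof (rule leads_sum[of _ "set ?top"])
    show "set ?top \<in> Pow {1..n}"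
      using top(3) by blast
    show "leads (row_exponent False n r + row_exponent True n r') (?P (set ?top) * ?Q (set ?top))"
      by (intro leads_mult P0 Q0)
    fix K assume K: "K \<in> Pow {1..n}" "K \<noteq> set ?top"
    then have fin: "finite K"
      using finite_subset by blast
    show "below (weight (row_exponent False n r + row_exponent True n r') - 1) (?P K * ?Q K)"
    proof (cases "card K = s")
      case False
      then have "?P K = 0"
        using I fin by (intro row_minor_eq_0) auto
      then show ?thesis
        by simp
    next
      case True
      let ?K = "sorted_list_of_set K"
      have sK: "sorted_wrt (<) ?K" "set ?K \<subseteq> {1..n}" "length ?K = s"
        using K fin True by auto
      have le: "?K ! a \<le> ?top ! a" if "a < length ?K" for a
        using sorted_nth_le_top(1)[OF sK(1,2) that] unfolding sK(3) .
      have ne: "?K \<noteq> ?top"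
        using K(2) fin by (metis set_sorted_list_of_set)
      have "dot ?I ?K < dot ?I ?top"
        using dot_mono[of ?K ?top ?I] le ne sK(3) top(2) I by fastforce
      moreover have "dot ?K (rev r') \<le> dot ?top (rev r')"
        using dot_mono[of ?K ?top "rev r'"] le sK(3) top(2) I' by (simp add: dot_commute del: upt_Suc)
      moreover have "below (int (dot ?I ?K) - (\<Sum>i\<leftarrow>?I. int i * int i) +
          (int (dot ?K (rev r')) - (\<Sum>j\<in>?J. int j * int j))) (?P K * ?Q K)"
        using P[of K] Q[of K] K True unfolding J by (intro below_mult) auto
      ultimately show ?thesis
        by (elim below_mono) (simp add: weight_add P0 Q0)
    qed
  qed simp
  also have "(\<Sum>K\<in>Pow {1..n}. ?P K * ?Q K) = row_minor qgen (full n) ?I ?J"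
    by (rule cauchy_binet[symmetric, OF central_heis_mon qgen_inverse qmat_transpose[OF qmat_upper]
        upper_lower_commute r'(2)])
  finally show ?thesis .
qed

section \<open>The exponent of a bitableau determines it\<close>

text \<open>Time \<open>t'\<close> sees the step out of \<open>i + t' - 1\<close> as long as
  \<open>t' \<le> b - i\<close>, and afterwards the rest at \<open>b\<close>.\<close>

lemma lookup_path:
  "i \<le> b \<Longrightarrow> b \<le> i + t \<Longrightarrow> lookup (path e t i b) ((e', t'), p) =
    (if e' = e \<and> 1 \<le> t' \<and> t' \<le> t \<and> p = (if t' \<le> b - i then 2 * (i + t' - 1) + 1 else 2 * b) then 1 else 0)"
proof (induction t arbitrary: b)
  case (Suc t)
  show ?case
  proof (cases "b \<le> i + t")
    case True
    then show ?thesis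
      using Suc.IH[OF Suc.prems(1) True] Suc.prems
      by (auto simp: lookup_add lookup_single when_def le_Suc_eq)
  next
    case False
    then have b: "b = i + Suc t"
      using Suc.prems by simp
    have "i \<le> b - 1" "b - 1 \<le> i + t"
      using b by auto
    note IH = Suc.IH[OF this]
    have path: "path e (Suc t) i b = path e t i (b - 1) + Poly_Mapping.single ((e, Suc t), Suc (2 * (b - 1))) 1"
      using False by simp
    consider "t' \<le> t" | "t' = Suc t" | "Suc t < t'"
      by linarith
    then show ?thesis
      unfolding path lookup_add IH lookup_single when_def using b by cases auto
  qed
qed simp

text \<open>The coordinate \<open>2 * a + 1\<close> at time \<open>t\<close> is the step from
  \<open>a\<close> to \<open>a + 1\<close>. An earliest path from \<open>i'\<close> stands at
  \<open>i' + t - 1\<close> just before its step number \<open>t\<close>, so it uses this coordinate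
  iff \<open>i' = i\<close> and its end \<open>b\<close> lies beyond \<open>a\<close>, which reads
  \<open>c < m\<close>.\<close>

lemma partial_index_iff:
  fixes a b c i i' m n t :: nat
  assumes "t + i + m = n + 1" "b + c = n" "a + m = n" "i' \<le> b" "1 \<le> i" "1 \<le> t"
  shows "2 * a + 1 = (if t \<le> b - i' then 2 * (i' + t - 1) + 1 else 2 * b) \<longleftrightarrow> i' = i \<and> c < m"
proof (cases "t \<le> b - i'")
  case True
  have "2 * a + 1 = 2 * (i' + t - 1) + 1 \<longleftrightarrow> i' = i"
    using assms by arith
  with True assms show ?thesis
    by auto
next
  case False
  moreover have "2 * a + 1 \<noteq> 2 * b"
    by presburger
  ultimately show ?thesis
    using assms by auto
qed

definition tableau_exponent :: "bool \<Rightarrow> nat \<Rightarrow> tableau \<Rightarrow> expo" where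
  "tableau_exponent e n T = (\<Sum>r\<leftarrow>T. row_exponent e n r)"

definition col_count :: "tableau \<Rightarrow> nat \<Rightarrow> nat \<Rightarrow> nat" where
  "col_count T c i = card {p. p < length T \<and> c < length (T ! p) \<and> T ! p ! c = i}"

lemma decreasing_row_bound:
  fixes r :: "nat list"
  assumes "sorted_wrt (>) r" "set r \<subseteq> {1..n}"
  shows "c < length r \<Longrightarrow> r ! c + c \<le> n"
proof (induction c)
  case 0
  then show ?case
    using subsetD[OF assms(2) nth_mem[OF 0]] by simp
next
  case (Suc c)
  then have "r ! Suc c < r ! c"
    using sorted_wrt_nth_less[OF assms(1), of c "Suc c"] by simp
  with Suc show ?case
    by simp
qed

context
  fixes n :: nat and T :: tableau
  assumes T: "is_tableau n T" "decreasing_tableau T"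
begin

lemma tableau_entry_bounds:
  assumes "p < length T" "c < length (T ! p)"
  shows "1 \<le> T ! p ! c" "T ! p ! c \<le> n - c" "c < n"
proof -
  have row: "sorted_wrt (>) (T ! p)" "set (T ! p) \<subseteq> {1..n}"
    using T nth_mem[OF assms(1)] by (auto simp: is_tableau_def decreasing_tableau_def)
  from decreasing_row_bound[OF this assms(2)] tableau_entry_pos[OF T(1) assms]
  show "1 \<le> T ! p ! c" "T ! p ! c \<le> n - c" "c < n"
    by auto
qed

lemma col_count_eq_0: "\<not> (c < n \<and> 1 \<le> i \<and> i \<le> n - c) \<Longrightarrow> col_count T c i = 0"
proof -
  assume "\<not> (c < n \<and> 1 \<le> i \<and> i \<le> n - c)"
  then have "{p. p < length T \<and> c < length (T ! p) \<and> T ! p ! c = i} = {}"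
    using tableau_entry_bounds[of _ c] by blast
  then show ?thesis
    unfolding col_count_def by (simp only: card.empty)
qed

lemma lookup_tableau_exponent:
  "lookup (tableau_exponent e n T) x =
    (\<Sum>c<n. \<Sum>i\<in>{1..n}. col_count T c i * lookup (path e n i (n - c)) x)"
proof -
  let ?f = "\<lambda>c i. lookup (path e n i (n - c)) x"
  have "lookup (tableau_exponent e n T) x =
      (\<Sum>p<length T. \<Sum>c<length (T ! p). ?f c (T ! p ! c))"
    by (simp add: tableau_exponent_def row_exponent_def sum_list_sum_nth atLeast0LessThan lookup_sum)
  also have "\<dots> = (\<Sum>p<length T. \<Sum>c<n. if c < length (T ! p) then ?f c (T ! p ! c) else 0)"
  proof (rule sum.cong[OF refl])
    fix p assume "p \<in> {..<length T}"
    then have "{..<length (T ! p)} \<subseteq> {..<n}"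
      using tableau_entry_bounds(3) by (meson lessThan_iff subsetI)
    then have "(\<Sum>c<length (T ! p). ?f c (T ! p ! c)) = (\<Sum>c\<in>{..<n} \<inter> {c. c < length (T ! p)}. ?f c (T ! p ! c))"
      by (intro sum.cong) auto
    then show "(\<Sum>c<length (T ! p). ?f c (T ! p ! c)) =
      (\<Sum>c<n. if c < length (T ! p) then ?f c (T ! p ! c) else 0)"
      by (simp add: sum.inter_restrict)
  qed
  also have "\<dots> = (\<Sum>c<n. \<Sum>p<length T. if c < length (T ! p) then ?f c (T ! p ! c) else 0)"
    by (rule sum.swap)
  also have "\<dots> = (\<Sum>c<n. \<Sum>i\<in>{1..n}. col_count T c i * ?f c i)"
  proof (rule sum.cong[OF refl])
    fix c
    let ?P = "{p. p < length T \<and> c < length (T ! p)}"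
    have "(\<Sum>p<length T. if c < length (T ! p) then ?f c (T ! p ! c) else 0) = (\<Sum>p\<in>?P. ?f c (T ! p ! c))"
      by (rule sum.mono_neutral_cong_right) auto
    also have "\<dots> = (\<Sum>i\<in>{1..n}. \<Sum>p\<in>{p\<in>?P. T ! p ! c = i}. ?f c (T ! p ! c))"
      by (rule sum.group[symmetric]) (use tableau_entry_pos[OF T(1)] in auto)
    also have "\<dots> = (\<Sum>i\<in>{1..n}. col_count T c i * ?f c i)"
      by (rule sum.cong[OF refl]) (simp add: col_count_def conj_assoc)
    finally show "(\<Sum>p<length T. if c < length (T ! p) then ?f c (T ! p ! c) else 0) =
      (\<Sum>i\<in>{1..n}. col_count T c i * ?f c i)" .
  qed
  finally show ?thesis .
qed

text \<open>The step out of \<open>n - m\<close> at time \<open>n + 1 - i - m\<close> is made by the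
  paths that start at \<open>i\<close> and end beyond \<open>n - m\<close>, hence by the entries
  \<open>i\<close> in the columns \<open>c < m\<close>. Odd coordinates show only these partial
  sums; their differences isolate a column.\<close>

lemma lookup_tableau_exponent_partial:
  assumes i: "1 \<le> i" "m + i \<le> n"
  shows "lookup (tableau_exponent e n T) ((e, n + 1 - i - m), 2 * (n - m) + 1) =
    (\<Sum>c<m. col_count T c i)"
proof -
  have "(\<Sum>i'\<in>{1..n}. col_count T c i' *
      lookup (path e n i' (n - c)) ((e, n + 1 - i - m), 2 * (n - m) + 1)) =
    (if c < m then col_count T c i else 0)" if c: "c < n" for c
  proof -
    have "col_count T c i' * lookup (path e n i' (n - c)) ((e, n + 1 - i - m), 2 * (n - m) + 1) =
      (if i' = i then if c < m then col_count T c i else 0 else 0)" if i': "i' \<in> {1..n}" for i'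
    proof (cases "i' \<le> n - c")
      case True
      have iff: "2 * (n - m) + 1 = (if n + 1 - i - m \<le> n - c - i' then 2 * (i' + (n + 1 - i - m) - 1) + 1 else 2 * (n - c))
        \<longleftrightarrow> i' = i \<and> c < m"
        by (rule partial_index_iff) (use i c i' True in auto)
      have le: "n - c \<le> i' + n" and t: "1 \<le> n + 1 - i - m" "n + 1 - i - m \<le> n"
        using i by auto
      show ?thesis
        unfolding lookup_path[OF True le] iff using t by simp
    next
      case False
      then show ?thesis
        using col_count_eq_0[of c i'] by auto
    qed
    then show ?thesis
      using i by (simp add: sum.delta)
  qed
  then have "lookup (tableau_exponent e n T) ((e, n + 1 - i - m), 2 * (n - m) + 1) =
    (\<Sum>c<n. if c < m then col_count T c i else 0)"
    unfolding lookup_tableau_exponent by (intro sum.cong refl) auto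
  also have "\<dots> = (\<Sum>c<m. col_count T c i)"
    by (rule sum.mono_neutral_cong_right) (use i in auto)
  finally show ?thesis .
qed

text \<open>An entry \<open>n - c\<close> in column \<open>c\<close> is the largest possible one
  there. Its path makes no step and so leaves no odd coordinate, but it is the only kind of path
  that rests at \<open>n - c\<close> already at time 1.\<close>

lemma lookup_tableau_exponent_diagonal:
  assumes c: "c < n"
  shows "lookup (tableau_exponent e n T) ((e, 1), 2 * (n - c)) = col_count T c (n - c)"
proof -
  have "(\<Sum>i\<in>{1..n}. col_count T c' i *
      lookup (path e n i (n - c')) ((e, 1), 2 * (n - c))) =
    (if c' = c then col_count T c (n - c) else 0)" if c': "c' < n" for c'
  proof -
    have "col_count T c' i * lookup (path e n i (n - c')) ((e, 1), 2 * (n - c)) =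
      (if i = n - c then if c' = c then col_count T c (n - c) else 0 else 0)" if i: "i \<in> {1..n}" for i
    proof (cases "i \<le> n - c'")
      case True
      have "2 * (n - c) \<noteq> 2 * (i + 1 - 1) + 1"
        by presburger
      then have iff: "2 * (n - c) = (if 1 \<le> n - c' - i then 2 * (i + 1 - 1) + 1 else 2 * (n - c'))
        \<longleftrightarrow> i = n - c \<and> c' = c"
        using c c' i True by auto
      have le: "n - c' \<le> i + n"
        by simp
      show ?thesis
        unfolding lookup_path[OF True le] iff using c by simp
    next
      case False
      then show ?thesis
        using col_count_eq_0[of c' i] by auto
    qed
    then show ?thesis
      using c by (simp add: sum.delta Suc_le_eq)
  qed
  then have "lookup (tableau_exponent e n T) ((e, 1), 2 * (n - c)) =
    (\<Sum>c'<n. if c' = c then col_count T c (n - c) else 0)"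
    unfolding lookup_tableau_exponent by (intro sum.cong refl) auto
  then show ?thesis
    using c by (simp add: sum.delta)
qed

lemma profile_col_count: "profile T c i = (\<Sum>i'\<in>{i..n}. col_count T c i')"
proof -
  have "{p. p < length T \<and> c < length (T ! p) \<and> i \<le> T ! p ! c} =
    (\<Union>i'\<in>{i..n}. {p. p < length T \<and> c < length (T ! p) \<and> T ! p ! c = i'})"
    using tableau_entry_pos(2)[OF T(1)] by auto
  then show ?thesis
    unfolding profile_def col_count_def by (simp, subst card_UN_disjoint) auto
qed

end

lemma tableau_exponent_inj:
  assumes T: "is_tableau n T" "decreasing_tableau T" and S: "is_tableau n S" "decreasing_tableau S"
    and eq: "\<And>x. lookup (tableau_exponent e n T) ((e, fst x), snd x) =
      lookup (tableau_exponent e n S) ((e, fst x), snd x)"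
  shows "T = S"
proof (rule tableau_eqI[OF T S])
  have col: "col_count T c i = col_count S c i" for c i
  proof -
    consider "\<not> (c < n \<and> 1 \<le> i \<and> i \<le> n - c)" | "c < n" "i = n - c" | "1 \<le> i" "Suc c + i \<le> n"
      by linarith
    then show ?thesis
    proof cases
      case 1
      then show ?thesis
        using col_count_eq_0[OF T 1] col_count_eq_0[OF S 1] by simp
    next
      case 2
      then show ?thesis
        using lookup_tableau_exponent_diagonal[OF T 2(1), of e]
          lookup_tableau_exponent_diagonal[OF S 2(1), of e] eq[of "(1, 2 * (n - c))"] by simp
    next
      case 3
      have part: "(\<Sum>c<m. col_count T c i) = (\<Sum>c<m. col_count S c i)" if "m + i \<le> n" for m
        using lookup_tableau_exponent_partial[OF T 3(1) that, of e]
          lookup_tableau_exponent_partial[OF S 3(1) that, of e]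
          eq[of "(n + 1 - i - m, 2 * (n - m) + 1)"] by simp
      show ?thesis
        using part[of "Suc c"] part[of c] 3 by simp
    qed
  qed
  show "profile T c i = profile S c i" for c i
    unfolding profile_col_count[OF T] profile_col_count[OF S] col ..
qed

lemma lookup_path_other: "e \<noteq> e' \<Longrightarrow> lookup (path e t i b) ((e', t'), p) = 0"
  by (induction t arbitrary: b) (auto simp: lookup_add lookup_single when_def)

lemma lookup_tableau_exponent_other:
  assumes "e \<noteq> e'"
  shows "lookup (tableau_exponent e n T) ((e', t), p) = 0"
  by (induction T) (auto simp: tableau_exponent_def row_exponent_def lookup_add lookup_sum lookup_path_other[OF assms])

definition bitableau_exponent :: "nat \<Rightarrow> tableau \<times> tableau \<Rightarrow> expo" where
  "bitableau_exponent n B = tableau_exponent False n (fst B) + tableau_exponent True n (snd B)"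

lemma inj_on_bitableau_exponent: "inj_on (bitableau_exponent n) (antistandard_bitableaux n)"
proof (rule inj_onI)
  fix B B' assume B: "B \<in> antistandard_bitableaux n" and B': "B' \<in> antistandard_bitableaux n"
    and eq: "bitableau_exponent n B = bitableau_exponent n B'"
  obtain T S T' S' where TS: "B = (T, S)" "B' = (T', S')"
    by (cases B, cases B')
  have "lookup (tableau_exponent False n T) ((False, fst x), snd x) =
      lookup (tableau_exponent False n T') ((False, fst x), snd x)"
    "lookup (tableau_exponent True n S) ((True, fst x), snd x) =
      lookup (tableau_exponent True n S') ((True, fst x), snd x)" for x
    using arg_cong[OF eq, of "\<lambda>v. lookup v ((False, fst x), snd x)"]
      arg_cong[OF eq, of "\<lambda>v. lookup v ((True, fst x), snd x)"]
    by (simp_all add: TS bitableau_exponent_def lookup_add lookup_tableau_exponent_other)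
  then show "B = B'"
    using B B' tableau_exponent_inj[of n T T' False] tableau_exponent_inj[of n S S' True]
    by (auto simp: TS antistandard_bitableaux_def is_bitableau_def)
qed

section \<open>Specialisation of the torus\<close>

definition const :: "'k::field \<Rightarrow> 'k torus" where
  "const a = heis_mon 0 0 a"

lemma const_add: "const (a + b) = const a + const b"
  by (simp add: const_def heis_mon_def single_add)

lemma const_mult: "const (a * b) = const a * const b"
  by (simp add: const_def heis_mon_mult)

lemma const_one [simp]: "const 1 = 1" and const_zero [simp]: "const 0 = 0"
  by (simp add: const_def one_heis_mon) (simp add: const_def heis_mon_def)

lemma const_minus: "const (- a) = - const a"
  by (simp add: const_def heis_mon_def single_uminus)

lemma central_const: "central (const a)"
  unfolding const_def by (rule central_heis_mon)

definition spec :: "'k::field \<Rightarrow> expo \<Rightarrow> 'k torus \<Rightarrow> 'k" where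
  "spec q v f = (\<Sum>h\<in>keys f. if hexp h = v then lookup f h * q powi hcent h else 0)"

lemma spec_superset:
  assumes "finite S" "keys f \<subseteq> S"
  shows "spec q v f = (\<Sum>h\<in>S. if hexp h = v then lookup f h * q powi hcent h else 0)"
  unfolding spec_def by (rule sum.mono_neutral_left) (use assms in \<open>auto simp: in_keys_iff\<close>)

lemma spec_add: "spec q v (f + g) = spec q v f + spec q v g"
proof -
  let ?S = "keys f \<union> keys g"
  have S: "finite ?S" "keys (f + g) \<subseteq> ?S" "keys f \<subseteq> ?S" "keys g \<subseteq> ?S"
    using Poly_Mapping.keys_add[of f g] by auto
  show ?thesis
    unfolding spec_superset[OF S(1,2)] spec_superset[OF S(1,3)] spec_superset[OF S(1,4)] sum.distrib[symmetric]
    by (rule sum.cong) (simp_all add: lookup_add distrib_right)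
qed

lemma spec_zero [simp]: "spec q v 0 = 0"
  by (simp add: spec_def)

lemma spec_uminus: "spec q v (- f) = - spec q v f"
  using spec_add[of q v f "- f"] by (simp add: add_eq_0_iff)

lemma spec_diff: "spec q v (f - g) = spec q v f - spec q v g"
  using spec_add[of q v f "- g"] by (simp add: spec_uminus)

lemma spec_sum: "spec q v (sum f A) = (\<Sum>k\<in>A. spec q v (f k))"
  by (induction A rule: infinite_finite_induct) (simp_all add: spec_add)

lemma spec_heis_mon: "spec q v (heis_mon c w a) = (if w = v then a * q powi c else 0)"
  by (simp add: spec_def heis_mon_def)

lemma torus_decomposition:
  "f = (\<Sum>h\<in>keys f. heis_mon (hcent h) (hexp h) (lookup f h))"
  unfolding heis_mon_def by (simp add: poly_mapping_sum_single)

lemma spec_const_mult: "spec q v (const a * f) = a * spec q v f"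
proof -
  have "spec q v (const a * f) =
      (\<Sum>h\<in>keys f. spec q v (const a * heis_mon (hcent h) (hexp h) (lookup f h)))"
    by (subst torus_decomposition[of f]) (simp add: sum_distrib_left spec_sum)
  also have "\<dots> = a * spec q v f"
    unfolding sum_distrib_left spec_def[of q v f]
    by (rule sum.cong) (simp_all add: const_def heis_mon_mult spec_heis_mon)
  finally show ?thesis .
qed

lemma spec_qgen_mult:
  assumes "q \<noteq> 0"
  shows "spec q v (qgen * f) = q * spec q v f"
proof -
  have "spec q v (qgen * f) =
      (\<Sum>h\<in>keys f. spec q v (qgen * heis_mon (hcent h) (hexp h) (lookup f h)))"
    by (subst torus_decomposition[of f]) (simp add: sum_distrib_left spec_sum)
  also have "\<dots> = q * spec q v f"
    unfolding sum_distrib_left spec_def[of q v f]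
    by (rule sum.cong) (simp_all add: heis_mon_mult spec_heis_mon power_int_add[OF disjI1[OF assms]])
  finally show ?thesis .
qed

text \<open>
  \<open>spec\<close> extracts a coefficient after the central generator has been set to \<open>q\<close>; it is not
  multiplicative, hence the two-sided closure.
\<close>

definition null_ideal :: "'k::field \<Rightarrow> 'k torus set" where
  "null_ideal q = {f. \<forall>g h v. spec q v (g * f * h) = 0}"

lemma null_add: "f \<in> null_ideal q \<Longrightarrow> g \<in> null_ideal q \<Longrightarrow> f + g \<in> null_ideal q"
  by (simp add: null_ideal_def distrib_left distrib_right spec_add)

lemma null_zero: "0 \<in> null_ideal q"
  by (simp add: null_ideal_def)

lemma null_uminus: "f \<in> null_ideal q \<Longrightarrow> - f \<in> null_ideal q"
  by (simp add: null_ideal_def spec_uminus)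

lemma null_sum: "(\<And>k. k \<in> A \<Longrightarrow> f k \<in> null_ideal q) \<Longrightarrow> sum f A \<in> null_ideal q"
  by (induction A rule: infinite_finite_induct) (auto intro: null_add null_zero)

lemma null_mult_left: "f \<in> null_ideal q \<Longrightarrow> g * f \<in> null_ideal q"
  by (simp add: null_ideal_def flip: mult.assoc)

lemma null_mult_right: "f \<in> null_ideal q \<Longrightarrow> f * g \<in> null_ideal q"
  by (simp add: null_ideal_def mult.assoc)

lemma null_mult_diff:
  assumes "f - f' \<in> null_ideal q" "g - g' \<in> null_ideal q"
  shows "f * g - f' * g' \<in> null_ideal q"
proof -
  have "f * g - f' * g' = (f - f') * g + f' * (g - g')"
    by (simp add: algebra_simps)
  then show ?thesis
    using assms by (simp add: null_add null_mult_left null_mult_right)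
qed

lemma spec_null: "f \<in> null_ideal q \<Longrightarrow> spec q v f = 0"
  unfolding null_ideal_def by (drule CollectD, drule spec[of _ 1], drule spec[of _ 1]) simp

text \<open>The difference is central, so both multipliers can be collected on one side;
  \<open>spec\<close> then turns the variable and the constant into the same factor
  \<open>q\<close>.\<close>

lemma null_qgen:
  assumes "q \<noteq> 0"
  shows "qgen - const q \<in> null_ideal q"
  unfolding null_ideal_def
proof (intro CollectI allI)
  fix g h v
  have "central (qgen - const q)"
    by (intro central_diff central_heis_mon central_const)
  then have "g * (qgen - const q) * h = (qgen - const q) * (g * h)"
    unfolding mult.assoc by (rule central_left_commute)
  then show "spec q v (g * (qgen - const q) * h) = 0"
    by (simp add: left_diff_distrib spec_diff spec_qgen_mult[OF assms] spec_const_mult)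
qed

lemma null_qgen_inv:
  assumes "q \<noteq> 0"
  shows "qgen_inv - const (inverse q) \<in> null_ideal q"
proof -
  have "const q * (qgen_inv * const (inverse q)) = qgen_inv"
    using assms by (simp add: const_def heis_mon_mult)
  moreover have "qgen * (qgen_inv * const (inverse q)) = const (inverse q)"
    by (simp add: const_def heis_mon_mult)
  ultimately have "qgen_inv - const (inverse q) = - ((qgen - const q) * (qgen_inv * const (inverse q)))"
    by (simp only: left_diff_distrib minus_diff_eq)
  then show ?thesis
    using null_qgen[OF assms] by (simp only: null_uminus null_mult_right)
qed

lemma null_minus_qgen_power:
  assumes "q \<noteq> 0"
  shows "const ((- q) ^ e) - (- qgen) ^ e \<in> null_ideal q"
proof (induction e)
  case (Suc e)
  have "const (- q) - (- qgen) \<in> null_ideal q"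
    using null_qgen[OF assms] by (simp add: const_minus)
  from null_mult_diff[OF this Suc] show ?case
    by (simp only: power_Suc const_mult)
qed (simp add: null_zero)

lemma spec_leads:
  assumes "q \<noteq> 0" "leads v f"
  shows "spec q v f \<noteq> 0" "w \<noteq> v \<Longrightarrow> weight v \<le> weight w \<Longrightarrow> spec q w f = 0"
proof -
  obtain c a g where f: "a \<noteq> 0" "below (weight v - 1) g" "f = heis_mon c v a + g"
    using assms(2) unfolding leads_def by blast
  have g: "spec q w g = 0" if "weight v \<le> weight w" for w
    unfolding spec_def using f(2) that by (intro sum.neutral) (auto simp: below_def)
  show "spec q v f \<noteq> 0"
    using f(1) assms(1) g[of v] by (simp add: f(3) spec_add spec_heis_mon power_int_eq_0_iff)
  show "w \<noteq> v \<Longrightarrow> weight v \<le> weight w \<Longrightarrow> spec q w f = 0"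
    using g[of w] by (simp add: f(3) spec_add spec_heis_mon)
qed

section \<open>Evaluation of the free algebra in the torus\<close>

definition word_eval :: "nat \<Rightarrow> (nat \<times> nat) list \<Rightarrow> 'k::field torus" where
  "word_eval n w = prod_list (map (\<lambda>(i, j). full n i j) w)"

lemma word_eval_append: "word_eval n (u @ v) = word_eval n u * word_eval n v"
  by (simp add: word_eval_def)

definition ev :: "nat \<Rightarrow> (nat \<times> nat, 'k::field) free_algebra \<Rightarrow> 'k torus" where
  "ev n f = (\<Sum>w\<in>keys f. const (lookup f w) * word_eval n (letters w))"

lemma ev_superset:
  assumes "finite S" "keys f \<subseteq> S"
  shows "ev n f = (\<Sum>w\<in>S. const (lookup f w) * word_eval n (letters w))"
  unfolding ev_def by (rule sum.mono_neutral_left) (use assms in \<open>auto simp: in_keys_iff\<close>)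

lemma ev_add: "ev n (f + g) = ev n f + ev n g"
proof -
  let ?S = "keys f \<union> keys g"
  have S: "finite ?S" "keys (f + g) \<subseteq> ?S" "keys f \<subseteq> ?S" "keys g \<subseteq> ?S"
    using Poly_Mapping.keys_add[of f g] by auto
  show ?thesis
    unfolding ev_superset[OF S(1,2)] ev_superset[OF S(1,3)] ev_superset[OF S(1,4)] sum.distrib[symmetric]
    by (rule sum.cong) (simp_all add: lookup_add const_add distrib_right)
qed

lemma ev_zero [simp]: "ev n 0 = 0"
  by (simp add: ev_def)

lemma ev_uminus: "ev n (- f) = - ev n f"
  using ev_add[of n f "- f"] by (simp add: add_eq_0_iff)

lemma ev_diff: "ev n (f - g) = ev n f - ev n g"
  using ev_add[of n f "- g"] by (simp add: ev_uminus)

lemma ev_sum: "ev n (sum f A) = (\<Sum>k\<in>A. ev n (f k))"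
  by (induction A rule: infinite_finite_induct) (simp_all add: ev_add)

lemma ev_single: "ev n (Poly_Mapping.single w a) = const a * word_eval n (letters w)"
  by (subst ev_superset[of "{w}"]) auto

lemma ev_mult: "ev n (f * g) = ev n f * ev n g"
proof -
  let ?s = "\<lambda>f w. Poly_Mapping.single w (lookup f w)"
  have single: "ev n (?s f u * ?s g v) = ev n (?s f u) * ev n (?s g v)" for u v
    by (simp add: mult_single ev_single plus_free_monoid_def word_eval_append const_mult mult.assoc
        central_left_commute[OF central_const, of "word_eval n (letters u)"])
  have "ev n (f * g) = ev n (sum (?s f) (keys f) * sum (?s g) (keys g))"
    by (simp add: poly_mapping_sum_single)
  also have "\<dots> = ev n (sum (?s f) (keys f)) * ev n (sum (?s g) (keys g))"
    by (simp add: sum_product ev_sum single)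
  finally show ?thesis
    by (simp add: poly_mapping_sum_single)
qed

lemma ev_scalar: "ev n (scalar c) = const c"
  by (simp add: scalar_def ev_single zero_free_monoid_def word_eval_def)

lemma ev_one: "ev n 1 = 1"
  using ev_scalar[of n 1] by (simp add: scalar_def)

lemma ev_gen: "ev n (gen (i, j)) = full n i j"
  by (simp add: gen_def ev_single word_eval_def)

text \<open>The relators contain the scalar \<open>q\<close>, while \<open>full\<close> satisfies
  the relations with the formal variable. The image of a relator is thus a multiple of the
  difference of the two parameters, not zero.\<close>

lemma ev_relators:
  assumes "q \<noteq> 0" "f \<in> qmatrix_relators n q"
  shows "ev n f \<in> null_ideal q"
proof -
  let ?x = "full n :: nat \<Rightarrow> nat \<Rightarrow> 'a torus"
  note x = qmat_full[of n, where ?'k = 'a]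
  have 1: "qgen * z - const q * z \<in> null_ideal q" for z
    using null_mult_right[OF null_qgen[OF assms(1)], of z] by (simp add: left_diff_distrib)
  have "(qgen - qgen_inv) - const (q - inverse q) \<in> null_ideal q"
    using null_add[OF null_qgen[OF assms(1)] null_uminus[OF null_qgen_inv[OF assms(1)]]]
    by (simp add: const_add const_minus algebra_simps diff_conv_add_uminus[of q] del: add_uminus_conv_diff)
  from null_mult_right[OF this] have 2: "(qgen - qgen_inv) * z - const (q - inverse q) * z \<in> null_ideal q" for z
    by (simp only: left_diff_distrib)
  show ?thesis
    using assms(2) unfolding qmatrix_relators_def
  proof (elim UnE CollectE exE conjE)
    fix i j l assume f: "f = X i j * X l j - scalar q * X l j * X i j" "{i, j, l} \<subseteq> {1..n}" "i < l"
    then have "ev n f = qgen * (?x l j * ?x i j) - const q * (?x l j * ?x i j)"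
      using qmat_col[OF x, of i j l j] by (simp add: ev_diff ev_mult ev_scalar ev_gen mult.assoc)
    then show ?thesis
      using 1 by simp
  next
    fix i j m assume f: "f = X i j * X i m - scalar q * X i m * X i j" "{i, j, m} \<subseteq> {1..n}" "j < m"
    then have "ev n f = qgen * (?x i m * ?x i j) - const q * (?x i m * ?x i j)"
      using qmat_row[OF x, of i j i m] by (simp add: ev_diff ev_mult ev_scalar ev_gen mult.assoc)
    then show ?thesis
      using 1 by simp
  next
    fix i j l m assume f: "f = X i j * X l m - X l m * X i j" "{i, j, l, m} \<subseteq> {1..n}" "i < l" "m < j"
    then have "ev n f = 0"
      using qmat_anti[OF x, of i j l m] by (simp add: ev_diff ev_mult ev_gen)
    then show ?thesis
      by (simp add: null_zero)
  next
    fix i j l m assume f: "f = X i j * X l m - X l m * X i j - scalar (q - inverse q) * X i m * X l j"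
      "{i, j, l, m} \<subseteq> {1..n}" "i < l" "j < m"
    then have "ev n f = (qgen - qgen_inv) * (?x i m * ?x l j) - const (q - inverse q) * (?x i m * ?x l j)"
      using qmat_diag[OF x, of i j l m] by (simp add: ev_diff ev_mult ev_scalar ev_gen mult.assoc)
    then show ?thesis
      using 2 by simp
  qed
qed

text \<open>The elements that \<open>ev\<close> sends into the null ideal form an ideal, because
  \<open>ev\<close> is additive and multiplicative, and it contains the relators.\<close>

lemma ev_qmatrix_ideal:
  assumes "q \<noteq> 0" "f \<in> qmatrix_ideal n q"
  shows "ev n f \<in> null_ideal q"
proof -
  let ?R = "free_matrix_ring n :: (nat \<times> nat, 'a) free_algebra ring"
  let ?I = "{f \<in> carrier ?R. ev n f \<in> null_ideal q}"
  interpret R: ring ?R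
    by (rule ring_free_algebra_ring)
  have ops: "x \<oplus>\<^bsub>?R\<^esub> y = x + y" "x \<otimes>\<^bsub>?R\<^esub> y = x * y" "\<zero>\<^bsub>?R\<^esub> = 0" for x y
    by (simp_all add: free_algebra_ring_def)
  have minus: "\<ominus>\<^bsub>?R\<^esub> x = - x" if x: "x \<in> carrier ?R" for x
  proof (rule R.minus_equality)
    show "- x \<oplus>\<^bsub>?R\<^esub> x = \<zero>\<^bsub>?R\<^esub>"
      by (simp only: ops left_minus)
    show "- x \<in> carrier ?R"
      using x by (auto simp: free_algebra_ring_def in_keys_iff)
  qed (rule x)
  have "ideal ?I ?R"
  proof (rule idealI[OF ring_free_algebra_ring])
    show "subgroup ?I (add_monoid ?R)"
    proof (rule R.add.subgroupI)
      have "0 \<in> ?I"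
        using R.zero_closed null_zero by (simp add: ops(3) del: One_nat_def)
      then show "?I \<noteq> {}"
        by blast
      fix a b assume a: "a \<in> ?I"
      then have "\<ominus>\<^bsub>?R\<^esub> a = - a"
        using minus by blast
      then show "\<ominus>\<^bsub>?R\<^esub> a \<in> ?I"
        using a R.a_inv_closed[of a] by (auto simp: ev_uminus null_uminus simp del: One_nat_def)
      assume "b \<in> ?I"
      with a show "a \<oplus>\<^bsub>?R\<^esub> b \<in> ?I"
        using R.a_closed[of a b] by (auto simp: ops ev_add null_add simp del: One_nat_def)
    qed auto
    fix a x assume "a \<in> ?I" "x \<in> carrier ?R"
    then show "x \<otimes>\<^bsub>?R\<^esub> a \<in> ?I" "a \<otimes>\<^bsub>?R\<^esub> x \<in> ?I"
      using R.m_closed[of x a] R.m_closed[of a x]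
      by (auto simp: ops ev_mult null_mult_left null_mult_right simp del: One_nat_def)
  qed
  moreover have "qmatrix_relators n q \<subseteq> ?I"
    using qmatrix_relators_carrier ev_relators[OF assms(1)] by blast
  ultimately have "qmatrix_ideal n q \<subseteq> ?I"
    unfolding qmatrix_ideal_def by (rule R.genideal_minimal)
  then show ?thesis
    using assms(2) by blast
qed

section \<open>Linear independence\<close>

lemma map2_nth: "length xs = length ys \<Longrightarrow> map2 f xs ys = map (\<lambda>a. f (xs ! a) (ys ! a)) [0..<length ys]"
  by (rule nth_equalityI) auto

lemma inversions_card:
  "distinct xs \<Longrightarrow> inversions xs = card {(a, b). a < b \<and> b < length xs \<and> xs ! b < xs ! a}"
proof (induction xs)
  case (Cons x xs)
  let ?A = "{(a, b). a < b \<and> b < length xs \<and> xs ! b < xs ! a}" and ?B = "{b. b < length xs \<and> xs ! b < x}"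
  have "bij_betw ((!) xs) ?B {l\<in>set xs. l < x}"
    using Cons.prems by (auto simp: bij_betw_def inj_on_def nth_eq_iff_index_eq in_set_conv_nth)
  then have B: "card {l\<in>set xs. l < x} = card ?B"
    by (rule bij_betw_same_card[symmetric])
  have fin: "finite ?A"
    by (rule finite_subset[of _ "{..<length xs} \<times> {..<length xs}"]) auto
  have "{(a, b). a < b \<and> b < length (x # xs) \<and> (x # xs) ! b < (x # xs) ! a} =
    (\<lambda>b. (0, Suc b)) ` ?B \<union> map_prod Suc Suc ` ?A" (is "?L = ?R")
  proof (rule Set.set_eqI)
    fix p :: "nat \<times> nat"
    obtain a b where p: "p = (a, b)"
      by (cases p)
    show "p \<in> ?L \<longleftrightarrow> p \<in> ?R"
      unfolding p by (cases a; cases b) (auto simp: image_iff)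
  qed
  moreover have "card ((\<lambda>b. (0, Suc b)) ` ?B \<union> map_prod Suc Suc ` ?A) = card ?B + card ?A"
    using fin by (subst card_Un_disjoint) (auto simp: card_image inj_on_def)
  ultimately show ?case
    using Cons B by simp
qed simp

lemma bij_betw_permute_list:
  assumes "distinct xs"
  shows "bij_betw (\<lambda>\<sigma>. permute_list \<sigma> xs) {\<sigma>. \<sigma> permutes {..<length xs}} (permutations_of_set (set xs))"
  unfolding bij_betw_def
proof
  show "inj_on (\<lambda>\<sigma>. permute_list \<sigma> xs) {\<sigma>. \<sigma> permutes {..<length xs}}"
  proof (rule inj_onI)
    fix \<sigma> \<tau> assume st: "\<sigma> \<in> {\<sigma>. \<sigma> permutes {..<length xs}}" "\<tau> \<in> {\<sigma>. \<sigma> permutes {..<length xs}}"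
      and eq: "permute_list \<sigma> xs = permute_list \<tau> xs"
    show "\<sigma> = \<tau>"
    proof
      fix a
      show "\<sigma> a = \<tau> a"
      proof (cases "a < length xs")
        case True
        then have "xs ! \<sigma> a = xs ! \<tau> a"
          using arg_cong[OF eq, of "\<lambda>l. l ! a"] permute_list_nth[of \<sigma> xs a] permute_list_nth[of \<tau> xs a] st
          by simp
        moreover have "\<sigma> a < length xs" "\<tau> a < length xs"
          using st True permutes_in_image[of \<sigma> "{..<length xs}" a] permutes_in_image[of \<tau> "{..<length xs}" a] by auto
        ultimately show ?thesis
          using nth_eq_iff_index_eq[OF assms, of "\<sigma> a" "\<tau> a"] by simp
      next
        case False
        then show ?thesis
          using st by (auto simp: permutes_def)
      qed
    qed
  qed
  show "(\<lambda>\<sigma>. permute_list \<sigma> xs) ` {\<sigma>. \<sigma> permutes {..<length xs}} = permutations_of_set (set xs)"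
  proof (intro equalityI subsetI)
    fix ys assume "ys \<in> (\<lambda>\<sigma>. permute_list \<sigma> xs) ` {\<sigma>. \<sigma> permutes {..<length xs}}"
    then obtain \<sigma> where "\<sigma> permutes {..<length xs}" "ys = permute_list \<sigma> xs"
      by blast
    then show "ys \<in> permutations_of_set (set xs)"
      using assms by (intro permutations_of_setI) (simp_all add: set_permute_list distinct_permute_list)
  next
    fix ys assume "ys \<in> permutations_of_set (set xs)"
    then have "mset ys = mset xs"
      using set_eq_iff_mset_eq_distinct[of ys xs] assms permutations_of_setD[of ys "set xs"] by simp
    from mset_eq_permutation[OF this] obtain \<sigma> where "\<sigma> permutes {..<length xs}" "permute_list \<sigma> xs = ys" .
    then show "ys \<in> (\<lambda>\<sigma>. permute_list \<sigma> xs) ` {\<sigma>. \<sigma> permutes {..<length xs}}"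
      by blast
  qed
qed

lemma ev_prod_list: "ev n (prod_list fs) = prod_list (map (ev n) fs)"
  by (induction fs) (simp_all add: ev_one ev_mult)

text \<open>The two sides differ in the parameter, a scalar in one and the formal variable in the
  other, and in the form of the sum: \<open>permute_list\<close> turns permutations of positions
  into orderings of \<open>J\<close> and their length into inversions.\<close>

lemma ev_qminor_expr:
  fixes q :: "'k::field"
  assumes q: "q \<noteq> 0" and fin: "finite I" "finite J" and card: "card I = card J"
  shows "ev n (qminor_expr q I J) - row_minor qgen (full n) (sorted_list_of_set I) J \<in> null_ideal q"
proof -
  define s "is" js where "s = card I" "is = sorted_list_of_set I" "js = sorted_list_of_set J"
  have lens: "length is = s" "length js = s" and js: "distinct js" "sorted_wrt (<) js" "set js = J"
    using fin card by (auto simp: s_is_js_def)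
  let ?S = "{\<sigma>. \<sigma> permutes {..<s}}"
  let ?p = "\<lambda>\<sigma>. prod_list (map (\<lambda>a. full n (is ! a) (js ! \<sigma> a)) [0..<s]) :: 'k torus"
  have "ev n (qminor_expr q I J) = (\<Sum>\<sigma>\<in>?S. const ((- q) ^ perm_length s \<sigma>) * ?p \<sigma>)"
    unfolding qminor_expr_def Let_def s_is_js_def[symmetric]
    by (simp add: ev_sum ev_mult ev_scalar ev_prod_list comp_def ev_gen)
  moreover have "row_minor qgen (full n) is J = (\<Sum>\<sigma>\<in>?S. (- qgen) ^ perm_length s \<sigma> * ?p \<sigma>)"
  proof -
    have bij: "bij_betw (\<lambda>\<sigma>. permute_list \<sigma> js) ?S (permutations_of_set (set js))"
      using bij_betw_permute_list[OF js(1)] by (simp only: lens)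
    have "row_minor qgen (full n) is J =
      (\<Sum>ks\<in>permutations_of_set (set js). (- qgen :: 'k torus) ^ inversions ks * prod_list (map2 (full n) is ks))"
      using row_minor_permutations[OF central_heis_mon fin(2), of "is"] card by (simp add: lens js s_is_js_def(1))
    also have "\<dots> = (\<Sum>\<sigma>\<in>?S. (- qgen) ^ inversions (permute_list \<sigma> js) *
        prod_list (map2 (full n) is (permute_list \<sigma> js)))"
      by (rule sum.reindex_bij_betw[OF bij, symmetric])
    also have "\<dots> = (\<Sum>\<sigma>\<in>?S. (- qgen) ^ perm_length s \<sigma> * ?p \<sigma>)"
    proof (rule sum.cong[OF refl])
      fix \<sigma> assume "\<sigma> \<in> ?S"
      then have \<sigma>: "\<sigma> permutes {..<length js}"
        using lens by simp
      have nth: "permute_list \<sigma> js ! a = js ! \<sigma> a" "\<sigma> a < s" if "a < s" for a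
        using permute_list_nth[OF \<sigma>] permutes_in_image[OF \<sigma>, of a] that by (auto simp: lens)
      have less: "js ! a < js ! b \<longleftrightarrow> a < b" if "a < s" "b < s" for a b
        using sorted_wrt_nth_less[OF js(2), of a b] sorted_wrt_nth_less[OF js(2), of b a] that lens
        by (metis linorder_neqE_nat order_less_asym less_irrefl)
      have "distinct (permute_list \<sigma> js)"
        using js \<sigma> by (simp add: distinct_permute_list)
      then have "inversions (permute_list \<sigma> js) =
        card {(a, b). a < b \<and> b < s \<and> permute_list \<sigma> js ! b < permute_list \<sigma> js ! a}"
        by (simp add: inversions_card lens)
      also have "{(a, b). a < b \<and> b < s \<and> permute_list \<sigma> js ! b < permute_list \<sigma> js ! a} =
        {(a, b). a < b \<and> b < s \<and> \<sigma> a > \<sigma> b}"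
        using nth less by auto
      finally have inv: "inversions (permute_list \<sigma> js) = perm_length s \<sigma>"
        by (simp add: perm_length_def)
      have "map2 (full n :: nat \<Rightarrow> nat \<Rightarrow> 'k torus) is (permute_list \<sigma> js) = map (\<lambda>a. full n (is ! a) (js ! \<sigma> a)) [0..<s]"
      proof -
        have "map2 (full n :: nat \<Rightarrow> nat \<Rightarrow> 'k torus) is (permute_list \<sigma> js) =
            map (\<lambda>a. full n (is ! a) (permute_list \<sigma> js ! a)) [0..<s]"
          using map2_nth[of "is" "permute_list \<sigma> js"] lens by simp
        also have "\<dots> = map (\<lambda>a. full n (is ! a) (js ! \<sigma> a)) [0..<s]"
          by (rule map_cong) (simp_all add: nth)
        finally show ?thesis .
      qed
      with inv show "(- qgen) ^ inversions (permute_list \<sigma> js) * prod_list (map2 (full n) is (permute_list \<sigma> js)) =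
        (- qgen) ^ perm_length s \<sigma> * ?p \<sigma>"
        by simp
    qed
    finally show ?thesis .
  qed
  ultimately have "ev n (qminor_expr q I J) - row_minor qgen (full n) is J =
    (\<Sum>\<sigma>\<in>?S. (const ((- q) ^ perm_length s \<sigma>) - (- qgen) ^ perm_length s \<sigma>) * ?p \<sigma>)"
    by (simp add: sum_subtractf left_diff_distrib)
  then show ?thesis
    unfolding s_is_js_def(2)[symmetric] by (simp only: null_sum null_mult_right null_minus_qgen_power[OF q])
qed

section \<open>Bitableau products in the free algebra and their leading exponents\<close>

definition rows_expr :: "'k::field \<Rightarrow> (nat list \<times> nat list) list \<Rightarrow> (nat \<times> nat, 'k) free_algebra" where
  "rows_expr q rs = foldr (\<lambda>(r, r') f. qminor_expr q (set r) (set r') * f) rs 1"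

definition bitableau_expr :: "'k::field \<Rightarrow> tableau \<times> tableau \<Rightarrow> (nat \<times> nat, 'k) free_algebra" where
  "bitableau_expr q B = rows_expr q (zip (fst B) (snd B))"

definition row_pair :: "nat \<Rightarrow> nat list \<Rightarrow> nat list \<Rightarrow> bool" where
  "row_pair n r r' \<longleftrightarrow> sorted_wrt (>) r \<and> sorted_wrt (>) r' \<and> set r \<subseteq> {1..n} \<and> set r' \<subseteq> {1..n} \<and>
     length r = length r'"

lemma sorted_list_of_set_row: "sorted_wrt (>) r \<Longrightarrow> sorted_list_of_set (set r) = rev (r :: nat list)"
  using sorted_list_of_set.idem_if_sorted_distinct[of "rev r"] sorted_wrt_rev[of "(<)" r]
  by (auto simp: strict_sorted_iff)

lemma card_row: "sorted_wrt (>) r \<Longrightarrow> card (set r) = length (r :: nat list)"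
  using sorted_list_of_set_row[of r] length_sorted_list_of_set[of "set r"] by simp

lemma antistandard_rows:
  assumes "B \<in> antistandard_bitableaux n"
  shows "list_all2 (row_pair n) (fst B) (snd B)"
proof -
  obtain T T' where B: "B = (T, T')"
    by (cases B)
  have T: "is_tableau n T" "is_tableau n T'" "map length T = map length T'" "decreasing_tableau T" "decreasing_tableau T'"
    using assms by (auto simp: B antistandard_bitableaux_def is_bitableau_def shape_def)
  have len: "length T = length T'"
    using map_eq_imp_length_eq[OF T(3)] .
  have "row_pair n (T ! p) (T' ! p)" if p: "p < length T" for p
  proof -
    have mem: "T ! p \<in> set T" "T' ! p \<in> set T'"
      using p len by auto
    have "length (T ! p) = length (T' ! p)"
      using arg_cong[OF T(3), of "\<lambda>l. l ! p"] p len by simp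
    then show ?thesis
      using mem T by (auto simp: row_pair_def is_tableau_def decreasing_tableau_def)
  qed
  then show ?thesis
    using len by (simp add: B list_all2_conv_all_nth)
qed

text \<open>The leading exponent is that of \<open>g\<close>, a product of minors in the formal
  variable. The evaluated expression carries the scalar \<open>q\<close> and agrees with
  \<open>g\<close> only modulo the null ideal.\<close>

lemma rows_expr_leads:
  assumes q: "q \<noteq> 0"
  shows "list_all2 (row_pair n) T T' \<Longrightarrow>
    \<exists>g. ev n (rows_expr q (zip T T')) - g \<in> null_ideal q \<and>
      leads (tableau_exponent False n T + tableau_exponent True n T') g"
proof (induction T T' rule: list_all2_induct)
  case Nil
  have "leads 0 (1 :: 'a torus)"
    unfolding one_heis_mon by (rule leads_heis_mon) simp
  then show ?case
    by (intro exI[of _ 1]) (simp add: rows_expr_def tableau_exponent_def ev_one null_zero)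
next
  case (Cons r T r' T')
  then obtain g where g: "ev n (rows_expr q (zip T T')) - g \<in> null_ideal q"
    "leads (tableau_exponent False n T + tableau_exponent True n T') g"
    by blast
  have r: "sorted_wrt (>) r" "set r \<subseteq> {1..n}" "sorted_wrt (>) r'" "set r' \<subseteq> {1..n}" "length r = length r'"
    using Cons.hyps(1) by (auto simp: row_pair_def)
  let ?m = "row_minor qgen (full n) (rev r) (set r') :: 'a torus"
  have "ev n (qminor_expr q (set r) (set r')) - ?m \<in> null_ideal q"
    using ev_qminor_expr[OF q, of "set r" "set r'" n] r by (simp add: card_row sorted_list_of_set_row)
  from null_mult_diff[OF this g(1)]
  have "ev n (rows_expr q (zip (r # T) (r' # T'))) - ?m * g \<in> null_ideal q"
    by (simp add: rows_expr_def ev_mult)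
  moreover have "leads (tableau_exponent False n (r # T) + tableau_exponent True n (r' # T')) (?m * g)"
    using leads_mult[OF full_minor_leads[OF r] g(2)] by (simp add: tableau_exponent_def ac_simps)
  ultimately show ?case
    by blast
qed

lemma spec_bitableau_expr:
  assumes q: "q \<noteq> 0" and B: "B \<in> antistandard_bitableaux n"
  shows "spec q (bitableau_exponent n B) (ev n (bitableau_expr q B)) \<noteq> 0"
    and "w \<noteq> bitableau_exponent n B \<Longrightarrow> weight (bitableau_exponent n B) \<le> weight w \<Longrightarrow>
      spec q w (ev n (bitableau_expr q B)) = 0"
proof -
  obtain g where g: "ev n (bitableau_expr q B) - g \<in> null_ideal q" "leads (bitableau_exponent n B) g"
    using rows_expr_leads[OF q antistandard_rows[OF B]] unfolding bitableau_expr_def bitableau_exponent_def by blast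
  have eq: "spec q w (ev n (bitableau_expr q B)) = spec q w g" for w
    using spec_null[OF g(1), of w] by (simp add: spec_diff)
  show "spec q (bitableau_exponent n B) (ev n (bitableau_expr q B)) \<noteq> 0"
    unfolding eq by (rule spec_leads(1)[OF q g(2)])
  show "w \<noteq> bitableau_exponent n B \<Longrightarrow> weight (bitableau_exponent n B) \<le> weight w \<Longrightarrow>
      spec q w (ev n (bitableau_expr q B)) = 0"
    unfolding eq by (rule spec_leads(2)[OF q g(2)])
qed

text \<open>Triangularity: among the products with nonzero coefficient take one, \<open>B\<close>,
  of greatest weight. At its exponent all the others vanish under \<open>spec\<close>, since their
  leading exponents differ from it by injectivity and weigh no more.\<close>

lemma bitableau_expr_independent:
  assumes q: "q \<noteq> 0" and A: "finite A" "A \<subseteq> antistandard_bitableaux n"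
    and zero: "(\<Sum>B\<in>A. scalar (a B) * bitableau_expr q B) \<in> qmatrix_ideal n q"
  shows "\<forall>B\<in>A. a B = 0"
proof (rule ccontr)
  assume "\<not> (\<forall>B\<in>A. a B = 0)"
  then have ne: "{B\<in>A. a B \<noteq> 0} \<noteq> {}"
    by auto
  let ?w = "\<lambda>B. weight (bitableau_exponent n B)"
  obtain B where B: "B \<in> A" "a B \<noteq> 0" and max: "\<And>B'. B' \<in> A \<Longrightarrow> a B' \<noteq> 0 \<Longrightarrow> ?w B' \<le> ?w B"
  proof -
    have "finite (?w ` {B\<in>A. a B \<noteq> 0})"
      using A(1) by simp
    from Max_in[OF this] Max_ge[OF this] ne that show ?thesis
      by (auto simp del: Max_ge_iff)
  qed
  let ?v = "bitableau_exponent n B"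
  have "0 = spec q ?v (ev n (\<Sum>B\<in>A. scalar (a B) * bitableau_expr q B))"
    using spec_null[OF ev_qmatrix_ideal[OF q zero]] by simp
  also have "\<dots> = (\<Sum>B'\<in>A. a B' * spec q ?v (ev n (bitableau_expr q B')))"
    by (simp add: ev_sum ev_mult ev_scalar spec_sum spec_const_mult)
  also have "\<dots> = (\<Sum>B'\<in>A. if B' = B then a B * spec q ?v (ev n (bitableau_expr q B)) else 0)"
  proof (rule sum.cong[OF refl])
    fix B' assume B': "B' \<in> A"
    have "spec q ?v (ev n (bitableau_expr q B')) = 0" if "B' \<noteq> B" "a B' \<noteq> 0"
    proof (rule spec_bitableau_expr(2)[OF q])
      show "B' \<in> antistandard_bitableaux n"
        using A B' by blast
      show "?v \<noteq> bitableau_exponent n B'"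
        using inj_onD[OF inj_on_bitableau_exponent, of n B B'] that A B B' by blast
      show "?w B' \<le> ?w B"
        using max B' that by blast
    qed
    then show "a B' * spec q ?v (ev n (bitableau_expr q B')) =
      (if B' = B then a B * spec q ?v (ev n (bitableau_expr q B)) else 0)"
      by auto
  qed
  also have "\<dots> = a B * spec q ?v (ev n (bitableau_expr q B))"
    using A(1) B(1) by (simp add: sum.delta)
  finally show False
    using B spec_bitableau_expr(1)[OF q, of B n] A by auto
qed

section \<open>Monomials modulo the relations\<close>

definition mword :: "(nat \<times> nat) list \<Rightarrow> (nat \<times> nat, 'k::field) free_algebra" where
  "mword w = Poly_Mapping.single (Word w) 1"

lemma mword_append: "mword (u @ v) = mword u * mword v"
  by (simp add: mword_def mult_single plus_free_monoid_def)

lemma mword_pair: "mword [(i, j), (l, m)] = X i j * X l m"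
  by (simp add: mword_def gen_def mult_single plus_free_monoid_def)

lemma scalar_mult_single: "scalar c * Poly_Mapping.single w a = Poly_Mapping.single w (c * a)"
  "Poly_Mapping.single w a * scalar c = Poly_Mapping.single w (a * c)"
  by (simp_all add: scalar_def mult_single)

lemma scalar_commute: "f * scalar c = scalar c * f"
proof -
  have "(\<Sum>w\<in>keys f. Poly_Mapping.single w (lookup f w)) * scalar c =
    scalar c * (\<Sum>w\<in>keys f. Poly_Mapping.single w (lookup f w))"
    by (simp add: sum_distrib_left sum_distrib_right scalar_mult_single mult.commute)
  then show ?thesis
    by (simp add: poly_mapping_sum_single)
qed

lemma mword_decomposition:
  "f = (\<Sum>w\<in>keys f. scalar (lookup f w) * mword (letters w))"
  by (simp add: mword_def scalar_mult_single poly_mapping_sum_single)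

lemma scalar_simps: "scalar (c + d) = scalar c + scalar d" "scalar (c * d) = scalar c * scalar d"
  "scalar (- c) = - scalar c" "scalar 0 = 0" "scalar 1 = 1"
  by (simp_all add: scalar_def single_add mult_single single_uminus)

definition cross_weight :: "(nat \<times> nat) list \<Rightarrow> nat" where
  "cross_weight w = (\<Sum>(i, j)\<leftarrow>w. i * j)"

context
  fixes n :: nat and q :: "'k::field"
begin

abbreviation (input) "freeR \<equiv> free_matrix_ring n :: (nat \<times> nat, 'k) free_algebra ring"
abbreviation (input) "relI \<equiv> qmatrix_ideal n q"

lemma free_ops: "x \<oplus>\<^bsub>freeR\<^esub> y = x + y" "x \<otimes>\<^bsub>freeR\<^esub> y = x * y" "\<zero>\<^bsub>freeR\<^esub> = 0" "\<one>\<^bsub>freeR\<^esub> = 1"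
  by (simp_all add: free_algebra_ring_def)

lemma carrier_closed:
  "0 \<in> carrier freeR" "1 \<in> carrier freeR"
  "f \<in> carrier freeR \<Longrightarrow> g \<in> carrier freeR \<Longrightarrow> f + g \<in> carrier freeR"
  "f \<in> carrier freeR \<Longrightarrow> g \<in> carrier freeR \<Longrightarrow> f * g \<in> carrier freeR"
proof -
  interpret R: ring freeR
    by (rule ring_free_algebra_ring)
  show "0 \<in> carrier freeR" "1 \<in> carrier freeR"
    "f \<in> carrier freeR \<Longrightarrow> g \<in> carrier freeR \<Longrightarrow> f + g \<in> carrier freeR"
    "f \<in> carrier freeR \<Longrightarrow> g \<in> carrier freeR \<Longrightarrow> f * g \<in> carrier freeR"
    using R.zero_closed R.one_closed R.a_closed[of f g] R.m_closed[of f g] unfolding free_ops by blast+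
qed

lemma carrier_sum: "(\<And>k. k \<in> A \<Longrightarrow> f k \<in> carrier freeR) \<Longrightarrow> sum f A \<in> carrier freeR"
  by (induction A rule: infinite_finite_induct) (auto intro: carrier_closed simp del: One_nat_def)

lemma mword_carrier: "set w \<subseteq> {1..n} \<times> {1..n} \<Longrightarrow> mword w \<in> carrier freeR"
  by (auto simp: mword_def free_algebra_ring_def)

lemma ideal_closed:
  "0 \<in> relI" "f \<in> relI \<Longrightarrow> f \<in> carrier freeR"
  "f \<in> relI \<Longrightarrow> g \<in> relI \<Longrightarrow> f + g \<in> relI"
  "f \<in> relI \<Longrightarrow> h \<in> carrier freeR \<Longrightarrow> h * f \<in> relI" "f \<in> relI \<Longrightarrow> h \<in> carrier freeR \<Longrightarrow> f * h \<in> relI"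
proof -
  interpret I: ideal relI freeR
    by (rule ideal_qmatrix_ideal)
  show "0 \<in> relI" "f \<in> relI \<Longrightarrow> f \<in> carrier freeR"
    "f \<in> relI \<Longrightarrow> g \<in> relI \<Longrightarrow> f + g \<in> relI"
    "f \<in> relI \<Longrightarrow> h \<in> carrier freeR \<Longrightarrow> h * f \<in> relI" "f \<in> relI \<Longrightarrow> h \<in> carrier freeR \<Longrightarrow> f * h \<in> relI"
    using additive_subgroup.zero_closed[OF I.additive_subgroup_axioms] I.Icarr[of f]
      additive_subgroup.a_closed[OF I.additive_subgroup_axioms, of f g] I.I_l_closed[of f h] I.I_r_closed[of f h]
    unfolding free_ops by blast+
qed

lemma ideal_scalar: "f \<in> relI \<Longrightarrow> scalar c * f \<in> relI"
  by (rule ideal_closed(4)[OF _ scalar_carrier])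

lemma relators_in_ideal: "f \<in> qmatrix_relators n q \<Longrightarrow> f \<in> relI"
  unfolding qmatrix_ideal_def
  using ring.genideal_self[OF ring_free_algebra_ring qmatrix_relators_carrier] by blast

lemma exchange:
  assumes q: "q \<noteq> 0" and x: "x \<in> {1..n} \<times> {1..n}" and y: "y \<in> {1..n} \<times> {1..n}"
  shows "\<exists>c d z. mword [x, y] - (scalar c * mword [y, x] + scalar d * mword z) \<in> relI \<and>
    (d = 0 \<or> set z \<subseteq> {1..n} \<times> {1..n} \<and> mset (map fst z) = mset (map fst [x, y]) \<and>
      mset (map snd z) = mset (map snd [x, y]) \<and> cross_weight z < cross_weight [x, y])"
proof -
  obtain i j l m where xy: "x = (i, j)" "y = (l, m)"
    by (cases x, cases y)
  have ij: "i \<in> {1..n}" "j \<in> {1..n}" "l \<in> {1..n}" "m \<in> {1..n}"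
    using x y by (auto simp: xy)
  note rel = relators_in_ideal[unfolded qmatrix_relators_def]
  have inv: "scalar (inverse q) * (scalar q * f) = f" for f :: "(nat \<times> nat, 'k) free_algebra"
    using q by (simp add: scalar_simps(5) flip: mult.assoc scalar_simps(2))
  \<comment> \<open>Seven of the nine relative positions of two letters leave no remainder. Then
    \<open>d = 0\<close> puts no condition on \<open>z\<close>, and \<open>[]\<close> is a
    placeholder.\<close>
  have trivial: ?thesis if "mword [x, y] - scalar c * mword [y, x] \<in> relI" for c
    using that by (intro exI[of _ c] exI[of _ 0] exI[of _ "[]"]) (simp add: scalar_simps)
  \<comment> \<open>When the letters stand in the order opposite to the defining relation, that
    relation is divided by \<open>q\<close>.\<close>
  have qcase: "mword [x, y] - scalar (inverse q) * mword [y, x] \<in> relI"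
    if "mword [y, x] - scalar q * mword [x, y] \<in> relI"
    using ideal_scalar[OF that, of "- inverse q"]
    by (simp add: scalar_simps right_diff_distrib inv)
  have col: "X i j * X l j - scalar q * X l j * X i j \<in> relI" if "i < l" "i \<in> {1..n}" "j \<in> {1..n}" "l \<in> {1..n}" for i j l
    using that by (intro rel) blast
  have row: "X i j * X i m - scalar q * X i m * X i j \<in> relI" if "j < m" "i \<in> {1..n}" "j \<in> {1..n}" "m \<in> {1..n}" for i j m
    using that by (intro rel) blast
  have anti: "X i j * X l m - X l m * X i j \<in> relI"
    if "i < l" "m < j" "i \<in> {1..n}" "j \<in> {1..n}" "l \<in> {1..n}" "m \<in> {1..n}" for i j l m
    using that by (intro rel) blast
  have diag: "X i j * X l m - X l m * X i j - scalar (q - inverse q) * X i m * X l j \<in> relI"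
    if "i < l" "j < m" "i \<in> {1..n}" "j \<in> {1..n}" "l \<in> {1..n}" "m \<in> {1..n}" for i j l m
    using that by (intro rel) blast
  have cw: "cross_weight [(i, m), (l, j)] < cross_weight [(i, j), (l, m)]" if "i < l" "j < m" for i j l m
    using rearrangement_aux[OF that] by (simp add: cross_weight_def)
  consider "i = l" "j = m" | "i = l" "j < m" | "i = l" "m < j" | "i < l" "j = m" | "l < i" "j = m"
    | "i < l" "m < j" | "l < i" "j < m" | "i < l" "j < m" | "l < i" "m < j"
    using linorder_less_linear[of i l] linorder_less_linear[of j m] by blast
  then show ?thesis
  proof cases
    case 1
    then show ?thesis
      using ideal_closed(1) by (intro trivial[of 1]) (simp add: xy scalar_simps)
  next
    case 2
    then show ?thesis
      using row[OF 2(2) ij(1,2,4)] by (intro trivial[of q]) (simp add: xy mword_pair mult.assoc)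
  next
    case 3
    then show ?thesis
      using row[OF 3(2) ij(1,4,2)] by (intro trivial[of "inverse q"] qcase) (simp add: xy mword_pair mult.assoc)
  next
    case 4
    then show ?thesis
      using col[OF 4(1) ij(1,2,3)] by (intro trivial[of q]) (simp add: xy mword_pair mult.assoc)
  next
    case 5
    then show ?thesis
      using col[OF 5(1) ij(3,2,1)] by (intro trivial[of "inverse q"] qcase) (simp add: xy mword_pair mult.assoc)
  next
    case 6
    then show ?thesis
      using anti[OF 6 ij] by (intro trivial[of 1]) (simp add: xy mword_pair scalar_simps)
  next
    case 7
    then show ?thesis
      using ideal_scalar[OF anti[OF 7 ij(3,4,1,2)], of "- 1"]
      by (intro trivial[of 1]) (simp add: xy mword_pair scalar_simps)
  next
    case 8
    have "mword [x, y] - (scalar 1 * mword [y, x] + scalar (q - inverse q) * mword [(i, m), (l, j)]) \<in> relI"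
      using diag[OF 8 ij] by (simp add: xy mword_pair scalar_simps(5) mult.assoc diff_diff_eq)
    then show ?thesis
      using ij cw[OF 8] by (intro exI[of _ 1] exI[of _ "q - inverse q"] exI[of _ "[(i, m), (l, j)]"])
        (auto simp: xy simp del: One_nat_def)
  next
    case 9
    \<comment> \<open>This is the diagonal relation with the roles of the two letters exchanged,
      whence the negative coefficient of the remainder.\<close>
    have "mword [x, y] - (scalar 1 * mword [y, x] + scalar (- (q - inverse q)) * mword [(l, j), (i, m)]) =
      scalar (- 1) * (X l m * X i j - X i j * X l m - scalar (q - inverse q) * X l j * X i m)"
      unfolding scalar_simps(3) by (simp add: xy mword_pair scalar_simps(5) mult.assoc algebra_simps)
    then have "mword [x, y] - (scalar 1 * mword [y, x] + scalar (- (q - inverse q)) * mword [(l, j), (i, m)]) \<in> relI"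
      using ideal_scalar[OF diag[OF 9 ij(3,4,1,2)], of "- 1"] by simp
    moreover have "cross_weight [(l, j), (i, m)] < cross_weight [x, y]"
      using cw[OF 9] by (simp add: xy cross_weight_def add.commute)
    ultimately show ?thesis
      using ij by (intro exI[of _ 1] exI[of _ "- (q - inverse q)"] exI[of _ "[(l, j), (i, m)]"])
        (auto simp: xy simp del: One_nat_def)
  qed
qed

end

text \<open>Sorting by adjacent swaps: the prefix \<open>u\<close> is already in place, and the next
  letter of \<open>w\<close> is brought to the front of \<open>w'\<close>. Keeping the multiset
  \<open>M\<close> fixed lets the swap rule rely on the content of the word.\<close>

lemma permutation_by_swaps:
  assumes swap: "\<And>u x y v. mset (u @ [x, y] @ v) = M \<Longrightarrow> Q (u @ [y, x] @ v) \<Longrightarrow> Q (u @ [x, y] @ v)"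
  shows "mset (u @ w) = M \<Longrightarrow> mset w = mset w' \<Longrightarrow> Q (u @ w') \<Longrightarrow> Q (u @ w)"
proof (induction w arbitrary: u w')
  case (Cons a w)
  then have "a \<in> set w'"
    by (metis list.set_intros(1) mset_eq_setD)
  then obtain p r where w': "w' = p @ a # r"
    by (meson split_list)
  have move: "mset (u @ p @ a # r) = M \<Longrightarrow> Q (u @ p @ a # r) \<Longrightarrow> Q (u @ a # p @ r)" for p r
  proof (induction p arbitrary: r rule: rev_induct)
    case (snoc b p)
    have Q: "Q ((u @ p) @ [b, a] @ r)" and M: "mset ((u @ p) @ [a, b] @ r) = M"
      using snoc.prems by (simp_all add: add_mset_commute)
    from swap[OF M Q] have "Q (u @ p @ a # (b # r))"
      by simp
    moreover have "mset (u @ p @ a # (b # r)) = M"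
      using M by simp
    ultimately show ?case
      using snoc.IH[of "b # r"] by simp
  qed simp
  have "mset (u @ p @ a # r) = M"
    using Cons.prems w' by simp
  from move[OF this] have "Q ((u @ [a]) @ (p @ r))"
    using Cons.prems(3) w' by simp
  then show ?case
    using Cons.IH[of "u @ [a]" "p @ r"] Cons.prems w' by simp
qed simp

section \<open>The quotient as a vector space\<close>

context
  fixes n :: nat and q :: "'k::field"
begin

abbreviation (input) "freeC \<equiv> carrier (free_matrix_ring n) :: (nat \<times> nat, 'k) free_algebra set"
abbreviation (input) "qalg \<equiv> qmatrix_algebra n q"
abbreviation (input) "qpr \<equiv> qmatrix_proj n q"

lemma proj_closed: "f \<in> freeC \<Longrightarrow> qpr f \<in> carrier qalg"
  and proj_add: "f \<in> freeC \<Longrightarrow> g \<in> freeC \<Longrightarrow> qpr (f + g) = qpr f \<oplus>\<^bsub>qalg\<^esub> qpr g"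
  and proj_mult: "f \<in> freeC \<Longrightarrow> g \<in> freeC \<Longrightarrow> qpr (f * g) = qpr f \<otimes>\<^bsub>qalg\<^esub> qpr g"
  and proj_one: "qpr 1 = \<one>\<^bsub>qalg\<^esub>"
  and proj_smult: "f \<in> freeC \<Longrightarrow> c \<odot>\<^bsub>qalg\<^esub> qpr f = qpr (scalar c * f)"
  and proj_zero_iff: "f \<in> freeC \<Longrightarrow> qpr f = \<zero>\<^bsub>qalg\<^esub> \<longleftrightarrow> f \<in> qmatrix_ideal n q"
  and proj_surj: "v \<in> carrier qalg \<Longrightarrow> \<exists>f\<in>freeC. v = qpr f"
proof -
  interpret I: ideal "qmatrix_ideal n q" "free_matrix_ring n"
    by (rule ideal_qmatrix_ideal)
  have hom: "qpr \<in> Ring.ring_hom (free_matrix_ring n) (qmatrix_ring n q)"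
    using I.rcos_ring_hom by (simp add: qmatrix_proj_def[abs_def])
  show "f \<in> freeC \<Longrightarrow> qpr f \<in> carrier qalg"
    using ring_hom_closed[OF hom] by (simp add: qmatrix_algebra_def del: One_nat_def)
  show "f \<in> freeC \<Longrightarrow> g \<in> freeC \<Longrightarrow> qpr (f + g) = qpr f \<oplus>\<^bsub>qalg\<^esub> qpr g"
    using ring_hom_add[OF hom, of f g] by (simp add: qmatrix_algebra_def free_ops del: One_nat_def)
  show mult: "f \<in> freeC \<Longrightarrow> g \<in> freeC \<Longrightarrow> qpr (f * g) = qpr f \<otimes>\<^bsub>qalg\<^esub> qpr g" for f g
    using ring_hom_mult[OF hom, of f g] by (simp add: qmatrix_algebra_def free_ops del: One_nat_def)
  show "qpr 1 = \<one>\<^bsub>qalg\<^esub>"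
    using ring_hom_one[OF hom] by (simp add: qmatrix_algebra_def free_ops del: One_nat_def)
  show "c \<odot>\<^bsub>qalg\<^esub> qpr f = qpr (scalar c * f)" if "f \<in> freeC"
    unfolding mult[OF scalar_carrier that] by (simp add: qmatrix_algebra_def)
  have zero: "\<zero>\<^bsub>qalg\<^esub> = qmatrix_ideal n q"
    by (simp add: qmatrix_algebra_def FactRing_def)
  show "qpr f = \<zero>\<^bsub>qalg\<^esub> \<longleftrightarrow> f \<in> qmatrix_ideal n q" if "f \<in> freeC"
    unfolding zero qmatrix_proj_def using I.a_rcos_const[of f] I.rcos_const_imp_mem[OF that] by blast
  show "\<exists>f\<in>freeC. v = qpr f" if "v \<in> carrier qalg"
    using that by (auto simp: qmatrix_algebra_def FactRing_def A_RCOSETS_def' qmatrix_proj_def simp del: One_nat_def)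
qed

lemma abelian_group_qmatrix_algebra: "abelian_group qalg"
  by (rule module.axioms(2)[OF vectorspace.axioms(1)[OF vectorspace_qmatrix_algebra]])

interpretation A: abelian_group qalg
  by (rule abelian_group_qmatrix_algebra)

interpretation V: vectorspace class_ring qalg
  by (rule vectorspace_qmatrix_algebra)

lemma proj_cong:
  assumes "f \<in> freeC" "g \<in> freeC" "f - g \<in> qmatrix_ideal n q"
  shows "qpr f = qpr g"
proof -
  have "qpr f = qpr ((f - g) + g)"
    by simp
  also have "\<dots> = qpr (f - g) \<oplus>\<^bsub>qalg\<^esub> qpr g"
    using assms ideal_closed(2) by (intro proj_add)
  also have "qpr (f - g) = \<zero>\<^bsub>qalg\<^esub>"
    using assms(3) proj_zero_iff ideal_closed(2) by blast
  finally show ?thesis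
    using proj_closed[OF assms(2)] A.l_zero by simp
qed

lemma proj_sum:
  assumes "finite S" "\<And>k. k \<in> S \<Longrightarrow> f k \<in> freeC"
  shows "finsum qalg (\<lambda>k. qpr (f k)) S = qpr (sum f S)"
  using assms
proof (induction S rule: finite_induct)
  case empty
  have "qpr 0 = \<zero>\<^bsub>qalg\<^esub>"
    using proj_zero_iff[OF carrier_closed(1)] ideal_closed(1) by blast
  then show ?case
    by (simp add: A.finsum_empty)
next
  case (insert k S)
  have "finsum qalg (\<lambda>k. qpr (f k)) (insert k S) = qpr (f k) \<oplus>\<^bsub>qalg\<^esub> finsum qalg (\<lambda>k. qpr (f k)) S"
    using insert by (intro A.finsum_insert) (auto intro: proj_closed simp del: One_nat_def)
  also have "finsum qalg (\<lambda>k. qpr (f k)) S = qpr (sum f S)"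
    using insert by blast
  also have "qpr (f k) \<oplus>\<^bsub>qalg\<^esub> qpr (sum f S) = qpr (f k + sum f S)"
    by (intro proj_add[symmetric] carrier_sum insert.prems) auto
  finally show ?case
    using insert by simp
qed

context
  fixes S
  assumes S: "S \<subseteq> carrier qalg"
begin

lemma span_submodule: "LinearCombinations.submodule class_ring (V.span S) qalg"
  by (rule V.span_is_submodule[OF S])

lemma span_zero: "\<zero>\<^bsub>qalg\<^esub> \<in> V.span S"
  by (rule LinearCombinations.submodule.zero_closed[OF span_submodule])

lemma span_proj_add:
  "f \<in> freeC \<Longrightarrow> g \<in> freeC \<Longrightarrow>
    qpr f \<in> V.span S \<Longrightarrow> qpr g \<in> V.span S \<Longrightarrow> qpr (f + g) \<in> V.span S"
  unfolding proj_add by (rule LinearCombinations.submodule.m_closed[OF span_submodule])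

lemma span_proj_scalar:
  assumes "f \<in> freeC" "qpr f \<in> V.span S"
  shows "qpr (scalar c * f) \<in> V.span S"
  unfolding proj_smult[OF assms(1), symmetric]
  by (rule LinearCombinations.submodule.smult_closed[OF span_submodule]) (use assms in auto)

lemma span_proj_words:
  assumes "\<And>w. w \<in> keys f \<Longrightarrow>
    set (letters w) \<subseteq> {1..n} \<times> {1..n} \<and> qpr (mword (letters w)) \<in> V.span S"
  shows "qpr f \<in> V.span S"
proof -
  have "qpr (\<Sum>w\<in>K. scalar (lookup f w) * mword (letters w)) \<in> V.span S"
    if "finite K" "K \<subseteq> keys f" for K
    using that
  proof (induction K rule: finite_induct)
    case empty
    have "qpr 0 = \<zero>\<^bsub>qalg\<^esub>"
      using proj_zero_iff[OF carrier_closed(1)] ideal_closed(1) by blast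
    then show ?case
      using span_zero by simp
  next
    case (insert w K)
    have car: "scalar (lookup f u) * mword (letters u) \<in> freeC"
      if "u \<in> insert w K" for u
      using assms insert.prems that by (intro carrier_closed scalar_carrier mword_carrier) blast
    have "qpr (scalar (lookup f w) * mword (letters w)) \<in> V.span S"
      using assms insert.prems by (intro span_proj_scalar mword_carrier) blast+
    moreover have "qpr (\<Sum>w\<in>K. scalar (lookup f w) * mword (letters w)) \<in> V.span S"
      using insert by blast
    ultimately have "qpr (scalar (lookup f w) * mword (letters w) +
        (\<Sum>w\<in>K. scalar (lookup f w) * mword (letters w))) \<in> V.span S"
      using car by (intro span_proj_add carrier_sum) blast+
    then show ?case
      using insert.hyps by simp
  qed
  from this[of "keys f"] show ?thesis
    using mword_decomposition[of f] by simp
qed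

end

section \<open>Spanning by monomials of fixed content\<close>

text \<open>The multidegree by row and column indices. The relators are homogeneous for it, and
  every degree contains finitely many multisets, so that spanning can be decided by
  counting.\<close>

definition content_class :: "nat multiset \<Rightarrow> nat multiset \<Rightarrow> (nat \<times> nat) multiset set" where
  "content_class a b = {M. set_mset M \<subseteq> {1..n} \<times> {1..n} \<and> image_mset fst M = a \<and> image_mset snd M = b}"

lemma finite_content_class: "finite (content_class a b)"
proof (rule finite_subset)
  show "content_class a b \<subseteq> mset ` {w. set w \<subseteq> {1..n} \<times> {1..n} \<and> length w = size a}"
  proof
    fix M assume M: "M \<in> content_class a b"
    obtain w where w: "mset w = M"
      using ex_mset by blast
    then have "set w \<subseteq> {1..n} \<times> {1..n}" "length w = size a"
      using M by (auto simp: content_class_def simp flip: size_mset set_mset_mset)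
    then show "M \<in> mset ` {w. set w \<subseteq> {1..n} \<times> {1..n} \<and> length w = size a}"
      using w by blast
  qed
  show "finite (mset ` {w. set w \<subseteq> {1..n} \<times> {1..n} \<and> length w = size a})"
    by (intro finite_imageI finite_lists_length_eq) simp
qed

text \<open>Any ordering of the letters serves: two orderings agree up to a scalar and words of
  smaller \<open>cross_weight\<close>.\<close>

definition monomial :: "(nat \<times> nat) multiset \<Rightarrow> (nat \<times> nat, 'k) free_algebra set" where
  "monomial M = qpr (mword (SOME w. mset w = M))"

lemma mset_some: "mset (SOME w. mset w = M) = M"
  by (rule someI_ex) (rule ex_mset)

lemma cross_weight_mset: "cross_weight w = sum_mset (image_mset (\<lambda>(i, j). i * j) (mset w))"
  unfolding cross_weight_def by (simp flip: sum_mset_sum_list)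

lemma monomials_carrier: "monomial ` content_class a b \<subseteq> carrier qalg"
proof
  fix v assume "v \<in> monomial ` content_class a b"
  then obtain M where M: "M \<in> content_class a b" "v = monomial M"
    by blast
  have "set (SOME w. mset w = M) \<subseteq> {1..n} \<times> {1..n}"
    using M(1) mset_some[of M] by (metis (no_types, lifting) content_class_def mem_Collect_eq set_mset_mset)
  then show "v \<in> carrier qalg"
    unfolding M(2) monomial_def by (intro proj_closed mword_carrier)
qed

text \<open>The outer induction on \<open>cross_weight\<close> absorbs the remainders of
  \<open>exchange\<close>; at a fixed multiset of letters, adjacent swaps lead from every ordering
  to the chosen one.\<close>

lemma word_in_span:
  assumes q: "q \<noteq> 0"
  shows "mset w \<in> content_class a b \<Longrightarrow> qpr (mword w) \<in> V.span (monomial ` content_class a b)"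
proof (induction "cross_weight w" arbitrary: w rule: less_induct)
  case less
  let ?S = "monomial ` content_class a b"
  note S = monomials_carrier[of a b]
  let ?Q = "\<lambda>w. qpr (mword w) \<in> V.span ?S"
  have set: "set v \<subseteq> {1..n} \<times> {1..n}" if "mset v = mset w" for v
  proof -
    have "set v = set_mset (mset w)"
      using that by (metis set_mset_mset)
    then show ?thesis
      using less.prems by (simp add: content_class_def del: One_nat_def)
  qed
  have swap: "?Q (u @ [x, y] @ v)" if M: "mset (u @ [x, y] @ v) = mset w" and Q: "?Q (u @ [y, x] @ v)" for u x y v
  proof -
    have sub: "set (u @ [x, y] @ v) \<subseteq> {1..n} \<times> {1..n}"
      by (rule set[OF M])
    then have uv: "mword u \<in> freeC" "mword v \<in> freeC"
      "x \<in> {1..n} \<times> {1..n}" "y \<in> {1..n} \<times> {1..n}" and yx: "set (u @ [y, x] @ v) \<subseteq> {1..n} \<times> {1..n}"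
      by (auto intro!: mword_carrier simp del: One_nat_def)
    obtain c d z where in_ideal: "mword [x, y] - (scalar c * mword [y, x] + scalar d * mword z) \<in> qmatrix_ideal n q"
      and z: "d = 0 \<or> set z \<subseteq> {1..n} \<times> {1..n} \<and> mset (map fst z) = mset (map fst [x, y]) \<and>
        mset (map snd z) = mset (map snd [x, y]) \<and> cross_weight z < cross_weight [x, y]"
      using exchange[OF q uv(3,4)] by blast
    have "mword u * (mword [x, y] - (scalar c * mword [y, x] + scalar d * mword z)) * mword v =
      mword (u @ [x, y] @ v) - (scalar c * mword (u @ [y, x] @ v) + scalar d * mword (u @ z @ v))"
    proof -
      have move: "mword u * (scalar e * mword t) * mword v = scalar e * mword (u @ t @ v)" for e t
        by (metis mword_append mult.assoc scalar_commute)
      have "a * (b - (c + d)) * e = a * b * e - (a * c * e + a * d * e)"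
        for a b c d e :: "(nat \<times> nat, 'k) free_algebra"
        by (simp only: left_diff_distrib right_diff_distrib distrib_left distrib_right)
      then show ?thesis
        by (simp only: move) (simp only: mword_append mult.assoc)
    qed
    then have diff: "mword (u @ [x, y] @ v) -
        (scalar c * mword (u @ [y, x] @ v) + scalar d * mword (u @ z @ v)) \<in> qmatrix_ideal n q"
      using ideal_closed(5)[OF ideal_closed(4)[OF in_ideal uv(1)] uv(2)] by simp
    have zspan: "scalar d * mword (u @ z @ v) \<in> freeC \<and>
        qpr (scalar d * mword (u @ z @ v)) \<in> V.span ?S"
    proof (cases "d = 0")
      case True
      have "qpr 0 = \<zero>\<^bsub>qalg\<^esub>"
        using proj_zero_iff[OF carrier_closed(1)] ideal_closed(1) by blast
      then show ?thesis
        using True span_zero[OF S] carrier_closed(1) by (simp add: scalar_simps del: One_nat_def)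
    next
      case False
      then have z': "set z \<subseteq> {1..n} \<times> {1..n}" "mset (map fst z) = mset (map fst [x, y])"
        "mset (map snd z) = mset (map snd [x, y])" "cross_weight z < cross_weight [x, y]"
        using z by auto
      have uzv: "set (u @ z @ v) \<subseteq> {1..n} \<times> {1..n}"
        using z'(1) sub by auto
      have "image_mset fst (mset (u @ z @ v)) = image_mset fst (mset (u @ [x, y] @ v))"
        "image_mset snd (mset (u @ z @ v)) = image_mset snd (mset (u @ [x, y] @ v))"
        using z'(2,3) by simp_all
      then have "mset (u @ z @ v) \<in> content_class a b"
        using less.prems uzv unfolding M content_class_def by (simp del: One_nat_def)
      moreover have "cross_weight (u @ z @ v) < cross_weight w"
      proof -
        have "cross_weight w = cross_weight (u @ [x, y] @ v)"
          unfolding cross_weight_mset M ..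
        then show ?thesis
          using z'(4) by (simp add: cross_weight_def)
      qed
      ultimately have "qpr (mword (u @ z @ v)) \<in> V.span ?S"
        using less.hyps by blast
      then show ?thesis
        using uzv by (intro conjI span_proj_scalar[OF S] mword_carrier carrier_closed(4) scalar_carrier)
    qed
    have "qpr (mword (u @ [x, y] @ v)) = qpr (scalar c * mword (u @ [y, x] @ v) + scalar d * mword (u @ z @ v))"
      by (rule proj_cong[OF mword_carrier[OF sub] carrier_closed(3)[OF
          carrier_closed(4)[OF scalar_carrier mword_carrier[OF yx]] conjunct1[OF zspan]] diff])
    also have "\<dots> \<in> V.span ?S"
      by (rule span_proj_add[OF S carrier_closed(4)[OF scalar_carrier mword_carrier[OF yx]]
          conjunct1[OF zspan] span_proj_scalar[OF S mword_carrier[OF yx] Q] conjunct2[OF zspan]])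
    finally show ?thesis .
  qed
  let ?w = "SOME v. mset v = mset w"
  have "?Q ([] @ ?w)"
    using V.in_own_span[OF S] less.prems by (auto simp: monomial_def)
  from permutation_by_swaps[of "mset w" ?Q "[]" w ?w, OF swap _ mset_some[symmetric] this] show ?case
    by simp
qed

end

section \<open>Homogeneity of minors and bitableau products in row and column content\<close>

definition has_content :: "nat multiset \<Rightarrow> nat multiset \<Rightarrow> (nat \<times> nat, 'k::field) free_algebra \<Rightarrow> bool" where
  "has_content a b f \<longleftrightarrow> (\<forall>w\<in>keys f.
     image_mset fst (mset (letters w)) = a \<and> image_mset snd (mset (letters w)) = b)"

lemma has_content_sum: "(\<And>k. k \<in> A \<Longrightarrow> has_content a b (f k)) \<Longrightarrow> has_content a b (sum f A)"
proof (induction A rule: infinite_finite_induct)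
  case (insert k A)
  then have k: "has_content a b (f k)" and A: "has_content a b (sum f A)"
    by blast+
  show ?case
    unfolding has_content_def
  proof
    fix w assume "w \<in> keys (sum f (insert k A))"
    then have "w \<in> keys (f k) \<or> w \<in> keys (sum f A)"
      using Poly_Mapping.keys_add[of "f k" "sum f A"] insert.hyps by auto
    then show "image_mset fst (mset (letters w)) = a \<and> image_mset snd (mset (letters w)) = b"
      using k A unfolding has_content_def by blast
  qed
qed (simp_all add: has_content_def)

lemma has_content_mult:
  assumes "has_content a b f" "has_content a' b' g"
  shows "has_content (a + a') (b + b') (f * g)"
  unfolding has_content_def
proof
  fix w assume "w \<in> keys (f * g)"
  then obtain u v where "u \<in> keys f" "v \<in> keys g" "w = u + v"
    using keys_mult[of f g] by blast
  then show "image_mset fst (mset (letters w)) = a + a' \<and> image_mset snd (mset (letters w)) = b + b'"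
    using assms by (simp add: has_content_def plus_free_monoid_def)
qed

lemma has_content_scalar: "has_content {#} {#} (scalar c)"
  by (simp add: has_content_def scalar_def zero_free_monoid_def)

lemma has_content_mword: "has_content (image_mset fst (mset w)) (image_mset snd (mset w)) (mword w)"
  by (simp add: has_content_def mword_def)

lemma has_content_one: "has_content {#} {#} 1"
  using has_content_scalar[of 1] by (simp add: scalar_simps)

lemma prod_list_gen: "prod_list (map gen w) = (mword w :: (nat \<times> nat, 'k::field) free_algebra)"
proof (induction w)
  case Nil
  then show ?case
    by (simp add: mword_def zero_free_monoid_def flip: single_one)
next
  case (Cons x w)
  have "mword (x # w) = mword [x] * (mword w :: (nat \<times> nat, 'k) free_algebra)"
    using mword_append[of "[x]" w] by simp
  with Cons show ?case
    by (simp add: mword_def[of "[x]"] gen_def)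
qed

lemma has_content_qminor_expr:
  assumes fin: "finite I" "finite J" and card: "card I = card J"
  shows "has_content (mset_set I) (mset_set J) (qminor_expr q I J)"
proof -
  define s "is" js where "s = card I" "is = sorted_list_of_set I" "js = sorted_list_of_set J"
  have lens: "length is = s" "length js = s" and ms: "mset is = mset_set I" "mset js = mset_set J"
    using fin card mset_set_set[of "sorted_list_of_set I"] mset_set_set[of "sorted_list_of_set J"]
    by (auto simp: s_is_js_def)
  have "has_content ({#} + mset_set I) ({#} + mset_set J)
      (scalar ((- q) ^ perm_length s \<sigma>) * (\<Prod>a\<leftarrow>[0..<s]. X (is ! a) (js ! \<sigma> a)))"
    if "\<sigma> permutes {..<s}" for \<sigma>
  proof (rule has_content_mult[OF has_content_scalar])
    let ?w = "map (\<lambda>a. (is ! a, js ! \<sigma> a)) [0..<s]"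
    have fst: "map fst ?w = is"
      using lens by (auto intro: nth_equalityI)
    have snd: "map snd ?w = permute_list \<sigma> js"
      using lens by (simp add: permute_list_def comp_def)
    have "has_content (mset_set I) (mset_set J) (mword ?w)"
      using has_content_mword[of ?w, folded mset_map, unfolded fst snd] that lens ms by (simp del: mset_map)
    also have "mword ?w = (\<Prod>a\<leftarrow>[0..<s]. X (is ! a) (js ! \<sigma> a))"
      by (simp add: comp_def flip: prod_list_gen)
    finally show "has_content (mset_set I) (mset_set J) (\<Prod>a\<leftarrow>[0..<s]. X (is ! a) (js ! \<sigma> a))" .
  qed
  then show ?thesis
    unfolding qminor_expr_def Let_def s_is_js_def[symmetric] by (intro has_content_sum) simp
qed

lemma mset_row: "sorted_wrt (>) r \<Longrightarrow> mset_set (set r) = mset (r :: nat list)"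
  using sorted_list_of_set_row[of r] sorted_list_of_set.distinct_sorted_key_list_of_set[of "set r"]
  by (simp add: mset_set_set)

lemma has_content_row:
  assumes "row_pair n r r'"
  shows "has_content (mset r) (mset r') (qminor_expr q (set r) (set r'))"
  using has_content_qminor_expr[of "set r" "set r'" q] assms by (simp add: row_pair_def mset_row card_row)

lemma has_content_carrier:
  assumes "has_content a b f" "set_mset a \<subseteq> {1..n}" "set_mset b \<subseteq> {1..n}"
  shows "w \<in> keys f \<Longrightarrow> mset (letters w) \<in> content_class n a b"
    and "f \<in> carrier (free_matrix_ring n)"
proof -
  show content: "mset (letters w) \<in> content_class n a b" if "w \<in> keys f" for w
  proof -
    have ab: "image_mset fst (mset (letters w)) = a" "image_mset snd (mset (letters w)) = b"
      using assms(1) that by (auto simp: has_content_def)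
    have "x \<in> {1..n} \<times> {1..n}" if "x \<in># mset (letters w)" for x
    proof -
      have "fst x \<in># a" "snd x \<in># b"
        unfolding ab[symmetric] using that by auto
      then show ?thesis
        using assms(2,3) by (cases x) auto
    qed
    then show ?thesis
      using ab unfolding content_class_def by blast
  qed
  then have "set (letters w) \<subseteq> {1..n} \<times> {1..n}" if "w \<in> keys f" for w
    using that by (simp add: content_class_def del: One_nat_def)
  then show "f \<in> carrier (free_matrix_ring n)"
    by (simp add: free_algebra_ring_def del: One_nat_def)
qed

lemma rows_expr_content:
  "list_all2 (row_pair n) T T' \<Longrightarrow> has_content (mset (concat T)) (mset (concat T')) (rows_expr q (zip T T'))"
proof (induction T T' rule: list_all2_induct)
  case (Cons r T r' T')
  then show ?case
    using has_content_mult[OF has_content_row] by (simp add: rows_expr_def)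
qed (simp add: rows_expr_def has_content_one)

lemma antistandard_content:
  assumes "B \<in> antistandard_bitableaux n"
  shows "has_content (mset (concat (fst B))) (mset (concat (snd B))) (bitableau_expr q B)"
    and "set_mset (mset (concat (fst B))) \<subseteq> {1..n}" "set_mset (mset (concat (snd B))) \<subseteq> {1..n}"
    and "bitableau_expr q B \<in> carrier (free_matrix_ring n)"
proof -
  show content: "has_content (mset (concat (fst B))) (mset (concat (snd B))) (bitableau_expr q B)"
    unfolding bitableau_expr_def by (rule rows_expr_content[OF antistandard_rows[OF assms]])
  have "is_tableau n (fst B)" "is_tableau n (snd B)"
    using assms by (auto simp: antistandard_bitableaux_def is_bitableau_def)
  then show sub: "set_mset (mset (concat (fst B))) \<subseteq> {1..n}" "set_mset (mset (concat (snd B))) \<subseteq> {1..n}"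
    using tableau_content by blast+
  show "bitableau_expr q B \<in> carrier (free_matrix_ring n)"
    by (rule has_content_carrier(2)[OF content sub])
qed

lemma bitableau_product_proj:
  assumes "B \<in> antistandard_bitableaux n"
  shows "bitableau_product n q B = qmatrix_proj n q (bitableau_expr q B)"
proof -
  have "rows_expr q (zip T T') \<in> carrier (free_matrix_ring n) \<and>
    foldr (\<lambda>(r, r') a. qminor n q (set r) (set r') \<otimes>\<^bsub>qmatrix_algebra n q\<^esub> a) (zip T T') \<one>\<^bsub>qmatrix_algebra n q\<^esub> =
      qmatrix_proj n q (rows_expr q (zip T T'))" if "list_all2 (row_pair n) T T'" for T T'
    using that
  proof (induction T T' rule: list_all2_induct)
    case Nil
    then show ?case
      using carrier_closed(2) by (simp add: rows_expr_def proj_one del: One_nat_def)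
  next
    case (Cons r T r' T')
    have "qminor_expr q (set r) (set r') \<in> carrier (free_matrix_ring n)"
      using Cons.hyps(1) by (intro has_content_carrier(2)[OF has_content_row[OF Cons.hyps(1)]])
        (auto simp: row_pair_def simp del: One_nat_def)
    moreover from this have "qminor_expr q (set r) (set r') * rows_expr q (zip T T') \<in> carrier (free_matrix_ring n)"
      using Cons.IH by (intro carrier_closed(4)) auto
    ultimately show ?case
      using Cons.IH by (simp add: rows_expr_def qminor_def proj_mult del: One_nat_def)
  qed
  from conjunct2[OF this[OF antistandard_rows[OF assms]]] show ?thesis
    by (simp add: bitableau_product_def bitableau_expr_def case_prod_beta)
qed

section \<open>The basis theorem\<close>

theorem corollary5p9:
  fixes q :: "'k::field" and n :: nat
  assumes "n > 0" and "q \<noteq> 0"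
  shows "inj_on (bitableau_product n q) (antistandard_bitableaux n) \<and>
         vectorspace.basis class_ring (qmatrix_algebra n q)
           (bitableau_product n q ` antistandard_bitableaux n)"
proof
  let ?V = "qmatrix_algebra n q" and ?A = "antistandard_bitableaux n" and ?b = "bitableau_product n q"
  let ?R = "free_matrix_ring n :: (nat \<times> nat, 'k) free_algebra ring"
  interpret A: abelian_group ?V
    by (rule abelian_group_qmatrix_algebra)
  interpret V: vectorspace class_ring ?V
    by (rule vectorspace_qmatrix_algebra)
  note expr = antistandard_content(4)
  have indep: "\<forall>B\<in>F. c B = 0"
    if F: "finite F" "F \<subseteq> ?A" and zero: "finsum ?V (\<lambda>B. c B \<odot>\<^bsub>?V\<^esub> ?b B) F = \<zero>\<^bsub>?V\<^esub>" for F c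
  proof (rule bitableau_expr_independent[OF assms(2) F])
    have car: "scalar (c B) * bitableau_expr q B \<in> carrier ?R" if "B \<in> F" for B
      using that F(2) expr by (intro carrier_closed(4) scalar_carrier) blast
    have summand: "c B \<odot>\<^bsub>?V\<^esub> ?b B = qmatrix_proj n q (scalar (c B) * bitableau_expr q B)" if "B \<in> F" for B
      using that F(2) expr[of B n q] by (subst bitableau_product_proj) (auto simp: proj_smult simp del: One_nat_def)
    have "finsum ?V (\<lambda>B. c B \<odot>\<^bsub>?V\<^esub> ?b B) F = finsum ?V (\<lambda>B. qmatrix_proj n q (scalar (c B) * bitableau_expr q B)) F"
      by (rule A.finsum_cong') (simp_all add: Pi_def summand proj_closed car del: One_nat_def)
    also have "\<dots> = qmatrix_proj n q (\<Sum>B\<in>F. scalar (c B) * bitableau_expr q B)"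
      by (rule proj_sum[OF F(1) car])
    finally have "qmatrix_proj n q (\<Sum>B\<in>F. scalar (c B) * bitableau_expr q B) = \<zero>\<^bsub>?V\<^esub>"
      using zero by simp
    moreover have "(\<Sum>B\<in>F. scalar (c B) * bitableau_expr q B) \<in> carrier ?R"
      by (rule carrier_sum[OF car])
    ultimately show "(\<Sum>B\<in>F. scalar (c B) * bitableau_expr q B) \<in> qmatrix_ideal n q"
      by (simp only: proj_zero_iff)
  qed
  show inj: "inj_on ?b ?A"
  proof (rule inj_onI)
    fix B B' assume B: "B \<in> ?A" "B' \<in> ?A" and eq: "?b B = ?b B'"
    show "B = B'"
    proof (rule ccontr)
      assume ne: "B \<noteq> B'"
      \<comment> \<open>Two bitableaux with the same product would satisfy a relation with
        coefficients 1 and -1, which independence in the free algebra modulo the ideal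
        forbids.\<close>
      let ?c = "\<lambda>x. if x = B then 1 else - 1 :: 'k"
      let ?f = "bitableau_expr q B" and ?g = "bitableau_expr q B'" and ?p = "qmatrix_proj n q"
      have f: "?f \<in> carrier ?R" and g: "?g \<in> carrier ?R"
        by (rule expr[OF B(1)], rule expr[OF B(2)])
      have neg: "scalar (- 1) * h \<in> carrier ?R" if "h \<in> carrier ?R" for h
        by (rule carrier_closed(4)[OF scalar_carrier that])
      have pfg: "?p ?g = ?p ?f"
        using eq unfolding bitableau_product_proj[OF B(1)] bitableau_product_proj[OF B(2)] by (rule sym)
      have "?p (?f + scalar (- 1) * ?g) = ?p ?f \<oplus>\<^bsub>?V\<^esub> (- 1) \<odot>\<^bsub>?V\<^esub> ?p ?g"
        by (simp only: proj_add[OF f neg[OF g]] proj_smult[OF g])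
      also have "\<dots> = ?p (?f + scalar (- 1) * ?f)"
        by (simp only: pfg proj_add[OF f neg[OF f]] proj_smult[OF f])
      also have "?f + scalar (- 1) * ?f = 0"
        by (simp add: scalar_simps)
      also have "?p 0 = \<zero>\<^bsub>?V\<^esub>"
        using proj_zero_iff[OF carrier_closed(1)] ideal_closed(1) by blast
      finally have "?f + scalar (- 1) * ?g \<in> qmatrix_ideal n q"
        by (simp only: proj_zero_iff[OF carrier_closed(3)[OF f neg[OF g]]])
      moreover have "(\<Sum>x\<in>{B, B'}. scalar (?c x) * bitableau_expr q x) = ?f + scalar (- 1) * ?g"
        using ne by (simp add: scalar_simps)
      ultimately have "\<forall>x\<in>{B, B'}. ?c x = 0"
        using B by (intro bitableau_expr_independent[OF assms(2)]) auto
      then show False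
        by simp
    qed
  qed
  have b_closed: "?b ` ?A \<subseteq> carrier ?V"
  proof
    fix v assume "v \<in> ?b ` ?A"
    then obtain B where B: "B \<in> ?A" "v = ?b B"
      by blast
    show "v \<in> carrier ?V"
      unfolding B(2) bitableau_product_proj[OF B(1)] by (rule proj_closed[OF expr[OF B(1)]])
  qed
  have li: "V.lin_indpt (?b ` ?A)"
  proof
    assume "V.lin_dep (?b ` ?A)"
    then obtain F a v where F: "finite F" "F \<subseteq> ?b ` ?A" "V.lincomb a F = \<zero>\<^bsub>?V\<^esub>" "v \<in> F" "a v \<noteq> 0"
      unfolding V.lin_dep_def by auto
    obtain G where G: "G \<subseteq> ?A" "F = ?b ` G"
      using F(2) by (rule subset_imageE)
    have injG: "inj_on ?b G"
      by (rule inj_on_subset[OF inj G(1)])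
    have finG: "finite G"
      by (rule finite_imageD[OF F(1)[unfolded G(2)] injG])
    have smult: "a v \<odot>\<^bsub>?V\<^esub> v \<in> carrier ?V" if "v \<in> F" for v
      by (rule V.smult_closed) (use that F(2) b_closed in auto)
    have "finsum ?V (\<lambda>B. a (?b B) \<odot>\<^bsub>?V\<^esub> ?b B) G = V.lincomb a F"
      unfolding V.lincomb_def G(2)
      by (rule A.finsum_reindex[symmetric, OF _ injG]) (use smult in \<open>simp add: Pi_def G(2)\<close>)
    with indep[OF finG G(1), of "\<lambda>B. a (?b B)"] F(3) have "\<forall>B\<in>G. a (?b B) = 0"
      by simp
    then show False
      using F(4,5) G(2) by blast
  qed
  have "carrier ?V \<subseteq> V.span (?b ` ?A)"
  proof
    fix v assume "v \<in> carrier ?V"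
    then obtain f where f: "f \<in> carrier ?R" "v = qmatrix_proj n q f"
      using proj_surj by blast
    have "qmatrix_proj n q (mword w) \<in> V.span (?b ` ?A)" if w: "set w \<subseteq> {1..n} \<times> {1..n}" for w
    proof -
      \<comment> \<open>Spanning is settled one content at a time: here the content of the given
        word, for which all sets involved are finite.\<close>
      define W where "W = content_class n (image_mset fst (mset w)) (image_mset snd (mset w))"
      let ?S = "monomial n q ` W" and ?B = "?b ` rsk n ` W"
      have S: "?S \<subseteq> carrier ?V"
        unfolding W_def by (rule monomials_carrier)
      have wW: "mset w \<in> W"
        using w by (simp add: W_def content_class_def del: One_nat_def)
      have finW: "finite W"
        unfolding W_def by (rule finite_content_class)
      have rsk: "rsk n ` W \<subseteq> ?A"
        using rsk_antistandard by blast
      have "card ?B = card (rsk n ` W)"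
        by (rule card_image[OF inj_on_subset[OF inj rsk]])
      also have "\<dots> = card W"
        by (rule card_image[OF inj_on_subset[OF inj_on_rsk]]) (auto simp: W_def content_class_def)
      \<comment> \<open>At this point \<open>monomial\<close> might identify multisets, so its image
        has at most \<open>card W\<close> elements, while injectivity gives exactly that many
        antistandard products.\<close>
      finally have card: "card ?S \<le> card ?B"
        using card_image_le[OF finW, of "monomial n q"] by simp
      have in_span: "?B \<subseteq> V.span ?S"
      proof
        fix x assume "x \<in> ?B"
        then obtain M where M: "M \<in> W" "x = ?b (rsk n M)"
          by blast
        have sub: "set_mset M \<subseteq> {1..n} \<times> {1..n}"
          using M(1) by (simp add: W_def content_class_def del: One_nat_def)
        note content = antistandard_content(1-3)[OF rsk_antistandard[of n M], unfolded rsk_content[OF sub]]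
        have W: "content_class n (image_mset fst M) (image_mset snd M) = W"
          using M(1) by (simp add: W_def content_class_def)
        show "x \<in> V.span ?S"
          unfolding M(2) bitableau_product_proj[OF rsk_antistandard]
        proof (rule span_proj_words[OF S])
          fix u assume "u \<in> keys (bitableau_expr q (rsk n M))"
          then have u: "mset (letters u) \<in> W"
            using has_content_carrier(1)[OF content] unfolding W by blast
          then have "set (letters u) \<subseteq> {1..n} \<times> {1..n}"
            by (simp add: W_def content_class_def del: One_nat_def)
          then show "set (letters u) \<subseteq> {1..n} \<times> {1..n} \<and> qmatrix_proj n q (mword (letters u)) \<in> V.span ?S"
            using word_in_span[OF assms(2), of "letters u" n] u unfolding W_def by blast
        qed
      qed
      have "V.lin_indpt ?B"
        by (rule V.subset_li_is_li[OF li image_mono[OF rsk]])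
      \<comment> \<open>The set \<open>C\<close> enlarges \<open>?B\<close> to a generating set of
        the span of \<open>?S\<close>. The difference of cardinalities that bounds
        \<open>card C\<close> is at most 0, so \<open>C\<close> is empty.\<close>
      from V.replacement[OF finite_imageI[OF finite_imageI[OF finW]] finite_imageI[OF finW] S this in_span]
      obtain C where C: "finite C" "int (card C) \<le> int (card ?S) - int (card ?B)"
        "V.span (?B \<union> C) = V.span ?S"
        by (elim exE conjE)
      from C(2) card have "card C = 0"
        by linarith
      then have "C = {}"
        using C(1) by simp
      with C(3) have "V.span ?B = V.span ?S"
        by simp
      moreover have "qmatrix_proj n q (mword w) \<in> V.span ?S"
        using word_in_span[OF assms(2), of w n] wW unfolding W_def by blast
      moreover have "V.span ?B \<subseteq> V.span (?b ` ?A)"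
        by (rule V.span_is_monotone[OF image_mono[OF rsk]])
      ultimately show ?thesis
        by blast
    qed
    then show "v \<in> V.span (?b ` ?A)"
      unfolding f(2) using f(1) by (intro span_proj_words[OF b_closed]) (auto simp: free_algebra_ring_def simp del: One_nat_def)
  qed
  then have "V.gen_set (?b ` ?A)"
    using V.span_is_subset2[OF b_closed] by blast
  then show "V.basis (?b ` ?A)"
    unfolding V.basis_def using li b_closed by blast
qed

end
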